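(* Let $0<a\le 1$ and let $\varphi(s)$ be a meromorphic function on $\mathbb{C}$. Then the formula $$\lim_{q\uparrow 1} g_q(s,\varphi(s),a)=\zeta(s,a)\qquad (s\in\mathbb{C})$$ holds (as an identity away from poles, in the sense made precise in the context) if and only if there is a positive integer $\nu$ such that $\varphi(s)=s-\nu$ for all $s\in\mathbb{C}$.
   Context: For $0<q<1$ and complex $x$ write $[x]_q=(1-q^x)/(1-q)$, where $q^x=e^{x\log q}$. For $0<a\le 1$ and $s,t\in\mathbb{C}$ with $\mathrm{Re}(t)>0$ put $$g_q(s,t,a)=\sum_{n=0}^{\infty}\frac{q^{(n+a)t}}{[n+a]_q^{\,s}}.$$ This series converges absolutely for $\mathrm{Re}(t)>0$, and $g_q(s,t,a)$ also denotes its meromorphic continuation to $(s,t)\in\mathbb{C}^2$. $\zeta(s,a)=\sum_{n\ge 0}(n+a)^{-s}$ is the Hurwitz zeta function, meromorphically continued to $\mathbb{C}$, with its only pole at $s=1$. For a meromorphic function $\varphi$, $g_q(s,\varphi(s),a)$ is regarded as a meromorphic function of the single variable $s$. The formula in the claim means: for $q$ sufficiently close to $1$ this is a well-defined meromorphic function of $s$, and the limit relation holds at every $s\neq 1$ which, for all $q<1$ sufficiently close to $1$, is not a pole of $s\mapsto g_q(s,\varphi(s),a)$ and is not a pole of $\varphi$. *)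

theory Defs
  imports "HOL-Complex_Analysis.Complex_Analysis"
begin

section \<open>Meromorphic functions of two complex variables\<close>

text \<open>
  Holomorphy on an open subset of \<open>\<complex>\<^sup>2\<close>: the total derivative exists everywhere and is
  \<open>\<complex>\<close>-linear.
\<close>
definition holomorphic2_on :: "(complex \<times> complex \<Rightarrow> complex) \<Rightarrow> (complex \<times> complex) set \<Rightarrow> bool"
  where "holomorphic2_on F U \<longleftrightarrow>
    (\<forall>z\<in>U. \<exists>A B. (F has_derivative (\<lambda>(u, v). A * u + B * v)) (at z))"

definition regular2_at :: "(complex \<times> complex \<Rightarrow> complex) \<Rightarrow> complex \<times> complex \<Rightarrow> bool"
  where "regular2_at F z \<longleftrightarrow> (\<exists>V. open V \<and> z \<in> V \<and> holomorphic2_on F V)"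

text \<open>
  Locally a quotient of two holomorphic functions whose denominator vanishes on no nonempty
  open set.  The values of \<open>F\<close> on the zero set of the denominator are unconstrained.
\<close>
definition meromorphic2 :: "(complex \<times> complex \<Rightarrow> complex) \<Rightarrow> bool"
  where "meromorphic2 F \<longleftrightarrow>
    (\<forall>z. \<exists>V h k. open V \<and> z \<in> V \<and> holomorphic2_on h V \<and> holomorphic2_on k V \<and>
       V \<subseteq> closure {w\<in>V. k w \<noteq> 0} \<and>
       (\<forall>w\<in>V. k w \<noteq> 0 \<longrightarrow> F w = h w / k w))"

text \<open>
  Two-variable counterpart of \<^const>\<open>nicely_meromorphic_on\<close>: all removable singularities are
  removed and the value on the polar set (which includes the points of indeterminacy) is \<open>0\<close>.
  By Riemann's extension theorem a singularity is removable iff the function is bounded near it,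
  so under this normalization the non-regular points are exactly those of the polar set, and
  a meromorphic function on \<open>\<complex>\<^sup>2\<close> is determined everywhere by its values on any
  nonempty open set.
\<close>
definition nicely_meromorphic2 :: "(complex \<times> complex \<Rightarrow> complex) \<Rightarrow> bool"
  where "nicely_meromorphic2 F \<longleftrightarrow> meromorphic2 F \<and>
    (\<forall>z. regular2_at F z \<or>
         (F z = 0 \<and> (\<forall>V. open V \<longrightarrow> z \<in> V \<longrightarrow> \<not> bounded (F ` V))))"


section \<open>The function \<open>g\<^sub>q(s,t,a)\<close>\<close>

definition q_bracket :: "real \<Rightarrow> complex \<Rightarrow> complex"
  where "q_bracket q x = (1 - of_real q powr x) / (1 - of_real q)"

definition gq_series :: "real \<Rightarrow> real \<Rightarrow> complex \<Rightarrow> complex \<Rightarrow> complex"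
  where "gq_series q a s t =
    (\<Sum>n. of_real q powr ((of_nat n + of_real a) * t) / q_bracket q (of_nat n + of_real a) powr s)"

text \<open>The meromorphic continuation of \<^const>\<open>gq_series\<close> from \<open>Re t > 0\<close> to all \<open>(s, t) \<in> \<complex>\<^sup>2\<close>.\<close>
definition gq :: "real \<Rightarrow> real \<Rightarrow> complex \<times> complex \<Rightarrow> complex"
  where "gq q a = (THE F. nicely_meromorphic2 F \<and>
    (\<forall>s t. Re t > 0 \<longrightarrow> F (s, t) = gq_series q a s t))"

text \<open>
  \<open>s \<mapsto> g\<^sub>q(s,\<phi>(s),a)\<close> as a meromorphic function of the single variable \<open>s\<close>.  The curve may meet
  the polar set of \<open>g\<^sub>q\<close> in points that are only removable singularities of the restriction,
  hence \<^const>\<open>remove_sings\<close>.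
\<close>
definition gq_along :: "real \<Rightarrow> real \<Rightarrow> (complex \<Rightarrow> complex) \<Rightarrow> complex \<Rightarrow> complex"
  where "gq_along q a \<phi> = remove_sings (\<lambda>s. gq q a (s, \<phi> s))"

text \<open>
  The restriction to the curve makes sense only if the curve does not run inside the polar set
  of \<open>g\<^sub>q\<close> (as it does for \<open>\<phi> = 0\<close>); it must then be meromorphic wherever \<open>\<phi>\<close> has no pole.
\<close>
definition gq_along_well_defined :: "real \<Rightarrow> real \<Rightarrow> (complex \<Rightarrow> complex) \<Rightarrow> bool"
  where "gq_along_well_defined q a \<phi> \<longleftrightarrow>
    {s. \<not> is_pole \<phi> s \<and> \<not> regular2_at (gq q a) (s, \<phi> s)} sparse_in {s. \<not> is_pole \<phi> s} \<and>
    gq_along q a \<phi> meromorphic_on {s. \<not> is_pole \<phi> s}"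


section \<open>The Hurwitz zeta function\<close>

text \<open>\<^const>\<open>nicely_meromorphic_on\<close> makes the continuation unique; its value at the pole \<open>s = 1\<close> is \<open>0\<close>.\<close>
definition hurwitz_zeta :: "real \<Rightarrow> complex \<Rightarrow> complex"
  where "hurwitz_zeta a = (THE f. f nicely_meromorphic_on UNIV \<and>
    (\<forall>s. Re s > 1 \<longrightarrow> f s = (\<Sum>n. (of_nat n + of_real a) powr (- s))))"


section \<open>The limit formula\<close>

definition q_limit_formula :: "real \<Rightarrow> (complex \<Rightarrow> complex) \<Rightarrow> bool"
  where "q_limit_formula a \<phi> \<longleftrightarrow>
    (\<forall>\<^sub>F q in at_left 1. gq_along_well_defined q a \<phi>) \<and>
    (\<forall>s. s \<noteq> 1 \<and> \<not> is_pole \<phi> s \<and> (\<forall>\<^sub>F q in at_left 1. \<not> is_pole (gq_along q a \<phi>) s) \<longrightarrow>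
         ((\<lambda>q. gq_along q a \<phi> s) \<longlongrightarrow> hurwitz_zeta a s) (at_left 1))"

end

theory Submission
  imports Defs
begin

text \<open>
  Write \<open>c\<^sub>r(s) = s (s + 1) \<dots> (s + r - 1) / r!\<close>.  Expanding the power of \<open>1 - q\<^sup>n\<^sup>+\<^sup>a\<close> in the series of
  \<open>g\<^sub>q\<close> binomially and summing over \<open>n\<close> first gives the continuation explicitly: \<open>g\<^sub>q(s, t, a)\<close> is
  \<open>(1 - q)\<^sup>s\<close> times the sum over \<open>r\<close> of \<open>c\<^sub>r(s) q\<^sup>a\<^sup>z / (1 - q\<^sup>z)\<close> with \<open>z = t + r\<close>.  It is singular exactly
  where some \<open>q\<^sup>t\<^sup>+\<^sup>r\<close> equals \<open>1\<close>, that is on the lines \<open>t = - r + 2\<pi>ik / log q\<close>; as \<open>q\<close> tends to \<open>1\<close>,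
  those with \<open>k \<noteq> 0\<close> move off to infinity.  (\<open>gq_eq_gq_explicit\<close>, \<open>regular2_at_gq_explicit_iff\<close>)

  \<^emph>\<open>Necessity.\<close>  Let \<open>-1 < Re s < 0\<close> and let \<open>t\<close> be no nonpositive integer.  Termwise passage to the
  limit shows that \<open>(1 - q)\<^sup>1\<^sup>-\<^sup>s g\<^sub>q(s, t, a)\<close> tends to the sum of all \<open>c\<^sub>r(s) / (t + r)\<close>, which is the Beta
  function \<open>B(t, 1 - s) = \<Gamma>(t) \<Gamma>(1 - s) / \<Gamma>(t + 1 - s)\<close>.  If \<open>g\<^sub>q(s, t, a)\<close> has a finite limit, then
  this is \<open>0\<close> and so \<open>t = s - \<nu>\<close> for some positive integer \<open>\<nu>\<close> (\<open>gq_explicit_convergent_imp\<close>).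
  Hence at each point \<open>s\<close> of a small disc, \<open>\<phi>(s)\<close> is a nonpositive integer or \<open>s - \<phi>(s)\<close> is a positive
  integer.  By continuity, one of these two integers is constant on some smaller disc, and by the
  identity theorem the resulting formula for \<open>\<phi>\<close> holds everywhere.  A constant \<open>\<phi> = - k\<close> would run
  inside the polar set of \<open>g\<^sub>q\<close>.

  \<^emph>\<open>Sufficiency.\<close>  The identity \<open>g\<^sub>q(s, t, a) = g\<^sub>q(s, t + 1, a) + (1 - q) g\<^sub>q(s - 1, t, a)\<close>
  (\<open>gq_explicit_step\<close>) reduces \<open>\<phi>(s) = s - \<nu>\<close> to \<open>\<nu> = 1\<close>.  Put \<open>G\<^sub>q(s) = g\<^sub>q(s, s - 1, a)\<close>.  For
  \<open>Re s > 2\<close> the series of \<open>G\<^sub>q\<close> is dominated uniformly in \<open>q\<close> and tends to \<open>\<zeta>(s, a)\<close>.  To go left,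
  split off the first four terms, so that \<open>a \<ge> 4\<close> may be assumed, and put \<open>W(x) = q\<^sup>-\<^sup>x [x]\<^sub>q\<close>, so that \<open>W(x + 1) = (W(x) + 1) / q\<close> and the terms of \<open>G\<^sub>q(s)\<close> are
  \<open>W\<^sup>-\<^sup>s (1 + (1 - q) W)\<close> at \<open>x = n + a\<close>.  Telescoping \<open>W\<^sup>1\<^sup>-\<^sup>s\<close> and expanding its differences yields
  \<open>W(a)\<^sup>1\<^sup>-\<^sup>s = d\<^sub>0(s) G\<^sub>q(s) + \<dots> + d\<^sub>K\<^sub>-\<^sub>1(s) G\<^sub>q(s + K - 1) + R(s)\<close> with a remainder series that is
  dominated uniformly in \<open>q\<close> for \<open>Re s > 2 - K\<close> (\<open>diag_recurrence\<close>).  All \<open>d\<^sub>j\<close> converge as \<open>q\<close> tends to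
  \<open>1\<close>, and \<open>d\<^sub>0(s)\<close> to \<open>s - 1\<close>.  So locally uniform convergence of \<open>G\<^sub>q\<close> propagates from \<open>Re s > 2\<close> to all
  \<open>s\<close> that are no integers, and Cauchy's formula on small circles extends it to the integers.  The same
  argument provides the continuation of the Hurwitz zeta function as the limit of the \<open>G\<^sub>q\<close>.
\<close>


section \<open>Series of holomorphic functions\<close>

lemma uniform_limit_partial_sums_locally:
  fixes f :: "nat \<Rightarrow> 'a::metric_space \<Rightarrow> 'b::banach"
  assumes "open U" "z \<in> U"
    and bound: "\<exists>V M. open V \<and> z \<in> V \<and> summable M \<and> (\<forall>n. \<forall>w\<in>V \<inter> U. norm (f n w) \<le> M n)"
  shows "\<exists>d>0. cball z d \<subseteq> U \<and>
           uniform_limit (cball z d) (\<lambda>n w. \<Sum>i<n. f i w) (\<lambda>w. \<Sum>i. f i w) sequentially"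
proof -
  obtain V M where V: "open V" "z \<in> V" "summable M" "\<And>n w. w \<in> V \<inter> U \<Longrightarrow> norm (f n w) \<le> M n"
    using bound by blast
  obtain d where d: "d > 0" "cball z d \<subseteq> V \<inter> U"
    using V \<open>open U\<close> \<open>z \<in> U\<close> by (meson open_contains_cball open_Int IntI)
  have "uniform_limit (cball z d) (\<lambda>n w. \<Sum>i<n. f i w) (\<lambda>w. \<Sum>i. f i w) sequentially"
    by (rule Weierstrass_m_test[OF _ V(3)]) (use V(4) d(2) in blast)
  with d show ?thesis by blast
qed

lemma holomorphic_on_suminf_locally_dominated:
  fixes f :: "nat \<Rightarrow> complex \<Rightarrow> complex"
  assumes U: "open U"
    and hol: "\<And>n. f n holomorphic_on U"
    and bound: "\<And>z. z \<in> U \<Longrightarrow>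
          \<exists>V M. open V \<and> z \<in> V \<and> summable M \<and> (\<forall>n. \<forall>w\<in>V \<inter> U. norm (f n w) \<le> M n)"
  shows "(\<lambda>z. \<Sum>n. f n z) holomorphic_on U"
proof (rule holomorphic_uniform_sequence[OF U])
  show "(\<lambda>w. \<Sum>i<n. f i w) holomorphic_on U" for n
    by (intro holomorphic_on_sum hol)
  show "\<exists>d>0. cball x d \<subseteq> U \<and>
           uniform_limit (cball x d) (\<lambda>n w. \<Sum>i<n. f i w) (\<lambda>w. \<Sum>i. f i w) sequentially"
    if "x \<in> U" for x
    by (rule uniform_limit_partial_sums_locally[OF U that bound[OF that]])
qed

lemma continuous_on_suminf_locally_dominated:
  fixes f :: "nat \<Rightarrow> 'a::metric_space \<Rightarrow> 'b::banach"
  assumes U: "open U"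
    and cont: "\<And>n. continuous_on U (f n)"
    and bound: "\<And>z. z \<in> U \<Longrightarrow>
          \<exists>V M. open V \<and> z \<in> V \<and> summable M \<and> (\<forall>n. \<forall>w\<in>V \<inter> U. norm (f n w) \<le> M n)"
  shows "continuous_on U (\<lambda>z. \<Sum>n. f n z)"
proof -
  have "isCont (\<lambda>z. \<Sum>n. f n z) x" if x: "x \<in> U" for x
  proof -
    obtain d where d: "d > 0" "cball x d \<subseteq> U"
      and ul: "uniform_limit (cball x d) (\<lambda>n w. \<Sum>i<n. f i w) (\<lambda>w. \<Sum>i. f i w) sequentially"
      using uniform_limit_partial_sums_locally[where f = f, OF U x bound[OF x]] by blast
    have "continuous_on (cball x d) (\<lambda>w. \<Sum>i. f i w)"
    proof (rule uniform_limit_theorem[OF _ ul])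
      show "\<forall>\<^sub>F n in sequentially. continuous_on (cball x d) (\<lambda>w. \<Sum>i<n. f i w)"
        by (intro always_eventually allI continuous_on_sum continuous_on_subset[OF cont d(2)])
    qed simp
    then show ?thesis
      using d(1) by (meson ball_subset_cball continuous_on_interior interior_maximal
                       open_ball centre_in_ball subsetD)
  qed
  then show ?thesis
    by (simp add: continuous_at_imp_continuous_on)
qed

section \<open>Holomorphic functions of two variables\<close>

text \<open>
  Osgood's lemma on a product of open sets.  By Cauchy's estimates the derivative in the second
  variable is the locally uniform limit of its neighbours, hence jointly continuous; a function
  with one partial derivative at the point and the other one jointly continuous is totally
  differentiable.
\<close>

lemma holomorphic2_on_TimesI:
  fixes F :: "complex \<times> complex \<Rightarrow> complex"
  assumes A: "open A" and B: "open B"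
    and cont: "continuous_on (A \<times> B) F"
    and hol1: "\<And>t. t \<in> B \<Longrightarrow> (\<lambda>s. F (s, t)) holomorphic_on A"
    and hol2: "\<And>s. s \<in> A \<Longrightarrow> (\<lambda>t. F (s, t)) holomorphic_on B"
  shows "holomorphic2_on F (A \<times> B)"
  unfolding holomorphic2_on_def
proof safe
  fix s0 t0 assume s0: "s0 \<in> A" and t0: "t0 \<in> B"
  obtain r1 where r1: "r1 > 0" "cball s0 r1 \<subseteq> A" using A s0 by (meson open_contains_cball)
  obtain r2 where r2: "r2 > 0" "cball t0 r2 \<subseteq> B" using B t0 by (meson open_contains_cball)
  define r where "r = min r1 (r2 / 2)"
  have r: "r > 0" "cball s0 r \<subseteq> A" "cball t0 (2 * r) \<subseteq> B"
    using r1 r2 by (auto simp: r_def subset_iff)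
  define X where "X = ball s0 r"
  define Y where "Y = ball t0 r"
  define fy where "fy = (\<lambda>s t. blinfun_mult_right (deriv (\<lambda>w. F (s, w)) t))"
  have shift_in: "w + t - t0 \<in> cball t0 (2 * r)" if "w \<in> ball t0 r" "t \<in> ball t0 r" for w t
  proof -
    have "dist t0 (w + t - t0) \<le> dist t0 w + dist t0 t"
      using norm_triangle_ineq[of "t0 - w" "t0 - t"] by (simp add: dist_norm algebra_simps norm_minus_commute)
    with that show ?thesis by auto
  qed
  have unif: "uniform_limit (ball t0 r) (\<lambda>p w. F (fst p, w + snd p - t0)) (\<lambda>w. F (s0, w))
               (at (s0, t0) within X \<times> Y)"
  proof (rule uniform_limitI)
    fix e :: real assume e: "e > 0"
    have "uniformly_continuous_on (cball s0 r \<times> cball t0 (2 * r)) F"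
      by (intro compact_uniformly_continuous compact_Times continuous_on_subset[OF cont])
         (use r in auto)
    then obtain d where d: "d > 0" "\<And>x x'. x \<in> cball s0 r \<times> cball t0 (2 * r) \<Longrightarrow>
        x' \<in> cball s0 r \<times> cball t0 (2 * r) \<Longrightarrow> dist x' x < d \<Longrightarrow> dist (F x') (F x) < e"
      using e unfolding uniformly_continuous_on_def by meson
    have "\<forall>\<^sub>F p in at (s0, t0) within X \<times> Y. p \<in> X \<times> Y \<and> dist p (s0, t0) < d"
      unfolding eventually_at using d(1) by auto
    then show "\<forall>\<^sub>F p in at (s0, t0) within X \<times> Y.
                 \<forall>w\<in>ball t0 r. dist (F (fst p, w + snd p - t0)) (F (s0, w)) < e"
    proof eventually_elim
      case (elim p)
      show ?case
      proof
        fix w assume w: "w \<in> ball t0 r"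
        have "dist (fst p, w + snd p - t0) (s0, w) = dist p (s0, t0)"
          by (cases p) (simp add: dist_prod_def dist_norm algebra_simps)
        moreover have "(fst p, w + snd p - t0) \<in> cball s0 r \<times> cball t0 (2 * r)"
          using elim w shift_in[of w "snd p"] by (auto simp: X_def Y_def)
        moreover have "(s0, w) \<in> cball s0 r \<times> cball t0 (2 * r)"
          using w r(1) by auto
        ultimately show "dist (F (fst p, w + snd p - t0)) (F (s0, w)) < e"
          using d(2) elim by auto
      qed
    qed
  qed
  have nontriv: "at (s0, t0) within X \<times> Y \<noteq> bot"
  proof -
    have "open (X \<times> Y)" "(s0, t0) \<in> X \<times> Y"
      using r(1) by (auto simp: X_def Y_def open_Times)
    then show ?thesis
      by (metis at_neq_bot at_within_open)
  qed
  have inX: "\<forall>\<^sub>F p in at (s0, t0) within X \<times> Y. p \<in> X \<times> Y"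
    by (auto simp: eventually_at intro: exI[of _ 1])
  have lim: "((\<lambda>p. deriv (\<lambda>w. F (fst p, w + snd p - t0)) t0) \<longlongrightarrow> deriv (\<lambda>w. F (s0, w)) t0)
           (at (s0, t0) within X \<times> Y)"
  proof (rule deriv_complex_uniform_limit[OF unif _ nontriv])
    show "\<forall>\<^sub>F p in at (s0, t0) within X \<times> Y.
             (\<lambda>w. F (fst p, w + snd p - t0)) holomorphic_on ball t0 r"
      using inX
    proof eventually_elim
      case (elim p)
      have "((\<lambda>t. F (fst p, t)) \<circ> (\<lambda>w. w + snd p - t0)) holomorphic_on ball t0 r"
      proof (rule holomorphic_on_compose_gen)
        show "(\<lambda>t. F (fst p, t)) holomorphic_on B"
          by (rule hol2) (use elim r in \<open>auto simp: X_def\<close>)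
        show "(\<lambda>w. w + snd p - t0) ` ball t0 r \<subseteq> B"
          using shift_in[of _ "snd p"] elim r by (auto simp: Y_def)
      qed (intro holomorphic_intros)
      then show ?case by (simp add: o_def)
    qed
  qed (use r in auto)
  have hd2: "(\<lambda>w. F (s, w)) field_differentiable at t" if "s \<in> X" "t \<in> Y" for s t
    using hol2[of s] that r B
    by (metis X_def Y_def ball_subset_cball holomorphic_on_imp_differentiable_at mem_ball mem_cball
          mult_2 add_increasing less_imp_le order.trans subsetD)
  have shift_eq: "deriv (\<lambda>w. F (s, w + t - t0)) t0 = deriv (\<lambda>w. F (s, w)) t"
    if st: "s \<in> X" "t \<in> Y" for s t
  proof -
    have "((\<lambda>w. F (s, w)) has_field_derivative deriv (\<lambda>w. F (s, w)) t) (at ((\<lambda>w. w + t - t0) t0))"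
      using hd2[OF st] by (simp add: field_differentiable_derivI)
    moreover have "((\<lambda>w. w + t - t0) has_field_derivative 1) (at t0)"
      by (auto intro!: derivative_eq_intros)
    ultimately have "((\<lambda>w. F (s, w)) \<circ> (\<lambda>w. w + t - t0) has_field_derivative
                        deriv (\<lambda>w. F (s, w)) t * 1) (at t0)"
      by (rule DERIV_chain)
    then show ?thesis by (auto simp: o_def intro!: DERIV_imp_deriv)
  qed
  have "((\<lambda>p. deriv (\<lambda>w. F (fst p, w)) (snd p)) \<longlongrightarrow> deriv (\<lambda>w. F (s0, w)) t0)
           (at (s0, t0) within X \<times> Y)"
    by (rule Lim_transform_eventually[OF lim])
       (use inX in eventually_elim, auto simp: shift_eq)
  then have fy_cont: "continuous (at (s0, t0) within X \<times> Y) (\<lambda>(s, t). fy s t)"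
    unfolding continuous_within fy_def case_prod_unfold
    by (intro bounded_linear.tendsto[OF bounded_linear_blinfun_mult_right]) simp
  have "((\<lambda>(s, t). F (s, t)) has_derivative
          (\<lambda>(u, v). deriv (\<lambda>s. F (s, t0)) s0 * u + fy s0 t0 v)) (at (s0, t0) within X \<times> Y)"
  proof (rule has_derivative_partialsI[where Y = Y])
    have "(\<lambda>s. F (s, t0)) field_differentiable at s0"
      using hol1[OF t0] A s0 holomorphic_on_imp_differentiable_at by blast
    then show "((\<lambda>s. F (s, t0)) has_derivative (*) (deriv (\<lambda>s. F (s, t0)) s0)) (at s0 within X)"
      by (metis DERIV_deriv_iff_field_differentiable has_field_derivative_def has_derivative_at_withinI)
    show "((\<lambda>t. F (s, t)) has_derivative blinfun_apply (fy s t)) (at t within Y)"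
      if "s \<in> X" "t \<in> Y" for s t
    proof -
      have "((\<lambda>t. F (s, t)) has_derivative (*) (deriv (\<lambda>w. F (s, w)) t)) (at t)"
        using hd2[OF that] by (metis DERIV_deriv_iff_field_differentiable has_field_derivative_def)
      moreover have "blinfun_apply (fy s t) = (*) (deriv (\<lambda>w. F (s, w)) t)"
        by (auto simp: fy_def)
      ultimately show ?thesis by (simp add: has_derivative_at_withinI)
    qed
  qed (use fy_cont r in \<open>auto simp: Y_def\<close>)
  then have "(F has_derivative (\<lambda>(u, v). deriv (\<lambda>s. F (s, t0)) s0 * u +
                                 deriv (\<lambda>w. F (s0, w)) t0 * v)) (at (s0, t0) within X \<times> Y)"
    by (simp add: fy_def)
  moreover have "at (s0, t0) within X \<times> Y = at (s0, t0)"
    by (intro at_within_open) (use r in \<open>auto simp: X_def Y_def open_Times\<close>)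
  ultimately show "\<exists>C D. (F has_derivative (\<lambda>(u, v). C * u + D * v)) (at (s0, t0))"
    by auto
qed

lemma open_Collect_mem_continuous:
  assumes "continuous_on U f" "open U" "open B"
  shows "open {w\<in>U. f w \<in> B}"
proof -
  have "{w\<in>U. f w \<in> B} = U \<inter> f -` B" by blast
  then show ?thesis using continuous_open_preimage[OF assms] by simp
qed

lemma holomorphic2_on_imp_isCont: "holomorphic2_on F U \<Longrightarrow> z \<in> U \<Longrightarrow> isCont F z"
  unfolding holomorphic2_on_def using has_derivative_continuous by blast

lemma holomorphic2_on_imp_continuous_on: "holomorphic2_on F U \<Longrightarrow> continuous_on U F"
  by (simp add: continuous_at_imp_continuous_on holomorphic2_on_imp_isCont)

lemma holomorphic2_on_subset: "holomorphic2_on F U \<Longrightarrow> V \<subseteq> U \<Longrightarrow> holomorphic2_on F V"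
  unfolding holomorphic2_on_def by blast

lemma holomorphic2_on_mult:
  assumes "holomorphic2_on F U" "holomorphic2_on G U"
  shows "holomorphic2_on (\<lambda>z. F z * G z) U"
  unfolding holomorphic2_on_def
proof
  fix z assume "z \<in> U"
  then obtain A B C D where
    "(F has_derivative (\<lambda>(u, v). A * u + B * v)) (at z)"
    "(G has_derivative (\<lambda>(u, v). C * u + D * v)) (at z)"
    using assms unfolding holomorphic2_on_def by meson
  from has_derivative_mult[OF this]
  have "((\<lambda>z. F z * G z) has_derivative
          (\<lambda>(u, v). (F z * C + A * G z) * u + (F z * D + B * G z) * v)) (at z)"
    by (rule has_derivative_eq_rhs) (auto simp: algebra_simps)
  then show "\<exists>A B. ((\<lambda>z. F z * G z) has_derivative (\<lambda>(u, v). A * u + B * v)) (at z)"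
    by blast
qed

lemma holomorphic2_on_diff:
  assumes "holomorphic2_on F U" "holomorphic2_on G U"
  shows "holomorphic2_on (\<lambda>z. F z - G z) U"
  unfolding holomorphic2_on_def
proof
  fix z assume "z \<in> U"
  then obtain A B C D where
    "(F has_derivative (\<lambda>(u, v). A * u + B * v)) (at z)"
    "(G has_derivative (\<lambda>(u, v). C * u + D * v)) (at z)"
    using assms unfolding holomorphic2_on_def by meson
  from has_derivative_diff[OF this]
  have "((\<lambda>z. F z - G z) has_derivative (\<lambda>(u, v). (A - C) * u + (B - D) * v)) (at z)"
    by (rule has_derivative_eq_rhs) (auto simp: algebra_simps)
  then show "\<exists>A B. ((\<lambda>z. F z - G z) has_derivative (\<lambda>(u, v). A * u + B * v)) (at z)"
    by blast
qed

lemma holomorphic2_on_compose_curve: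
  assumes F: "holomorphic2_on F U"
    and f: "f holomorphic_on S" and g: "g holomorphic_on S" and S: "open S"
    and img: "\<And>x. x \<in> S \<Longrightarrow> (f x, g x) \<in> U"
  shows "(\<lambda>x. F (f x, g x)) holomorphic_on S"
proof -
  have "\<exists>D. ((\<lambda>x. F (f x, g x)) has_field_derivative D) (at x)" if x: "x \<in> S" for x
  proof -
    obtain A B where AB: "(F has_derivative (\<lambda>(u, v). A * u + B * v)) (at (f x, g x))"
      using F img[OF x] unfolding holomorphic2_on_def by meson
    obtain f' g' where f': "(f has_field_derivative f') (at x)" and g': "(g has_field_derivative g') (at x)"
      using f g S x by (meson field_differentiable_def holomorphic_on_imp_differentiable_at)
    have "((\<lambda>x. (f x, g x)) has_derivative (\<lambda>u. (f' * u, g' * u))) (at x)"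
      using f' g' by (auto simp: has_field_derivative_def intro!: derivative_eq_intros)
    from has_derivative_compose[OF this AB]
    have "((\<lambda>x. F (f x, g x)) has_field_derivative (A * f' + B * g')) (at x)"
      unfolding has_field_derivative_def by (rule has_derivative_eq_rhs) (auto simp: algebra_simps)
    then show ?thesis by blast
  qed
  then show ?thesis
    by (auto simp: holomorphic_on_open[OF S])
qed

section \<open>Uniqueness of meromorphic continuations\<close>

lemma holomorphic2_identity_theorem:
  assumes B: "open B" "convex B" and H: "holomorphic2_on H B"
    and W: "open W" "W \<noteq> {}" "W \<subseteq> B" and zero: "\<And>w. w \<in> W \<Longrightarrow> H w = 0" and z: "z \<in> B"
  shows "H z = 0"
proof -
  obtain p where p: "p \<in> W" using W by blast
  \<comment> \<open>Restrict to the complex line through \<open>p\<close> and \<open>z\<close>.\<close>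
  define l where "l = (\<lambda>x::complex. (fst p + x * (fst z - fst p), snd p + x * (snd z - snd p)))"
  have cont_l: "continuous_on UNIV l" unfolding l_def by (intro continuous_intros)
  define S where "S = l -` B"
  have S: "open S" unfolding S_def using cont_l B(1) by (simp add: open_vimage)
  have conv: "convex S"
  proof (rule convexI)
    fix x y u v assume *: "x \<in> S" "y \<in> S" "0 \<le> u" "0 \<le> v" "u + v = (1::real)"
    have fold: "(of_real u :: complex) + of_real v = 1" using * by (metis of_real_1 of_real_add)
    have "l (u *\<^sub>R x + v *\<^sub>R y) = u *\<^sub>R l x + v *\<^sub>R l y"
    proof -
      have "c + (u *\<^sub>R x + v *\<^sub>R y) * d = u *\<^sub>R (c + x * d) + v *\<^sub>R (c + y * d)" for c d :: complex
      proof -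
        have "c + (u *\<^sub>R x + v *\<^sub>R y) * d = (of_real u + of_real v) * c + (u *\<^sub>R x + v *\<^sub>R y) * d"
          using fold by simp
        then show ?thesis by (simp add: scaleR_conv_of_real algebra_simps)
      qed
      then show ?thesis by (simp add: l_def)
    qed
    then show "u *\<^sub>R x + v *\<^sub>R y \<in> S"
      using * B(2) unfolding S_def by (simp add: convexD)
  qed
  have "l 0 = p" by (simp add: l_def)
  have "l 1 = z" by (simp add: l_def)
  have hol: "(\<lambda>x. H (l x)) holomorphic_on S"
    unfolding l_def
    by (rule holomorphic2_on_compose_curve[OF H]) (use S in \<open>auto simp: S_def l_def intro!: holomorphic_intros\<close>)
  have "open (l -` W)" using cont_l W(1) by (simp add: open_vimage)
  then have "H (l 1) = 0"
    by (intro analytic_continuation_open[of "l -` W" S "\<lambda>x. H (l x)" "\<lambda>_. 0" 1])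
       (use S conv hol W p z zero \<open>l 0 = p\<close> \<open>l 1 = z\<close> in
         \<open>auto simp: S_def convex_connected intro: exI[of _ 0]\<close>)
  then show ?thesis using \<open>l 1 = z\<close> by simp
qed

text \<open>
  The relation \<open>F = G\<close> holds on a dense open part of a neighbourhood of a point if and only if it
  does so on a dense open part of any small ball around it (clear denominators and use the
  identity theorem), so the set of these points is open and closed.  At a regular
  point of one function the other one is then bounded nearby, hence regular with the same value; at
  all other points both values are \<open>0\<close>.
\<close>

lemma nicely_meromorphic2_unique:
  assumes F: "nicely_meromorphic2 F" and G: "nicely_meromorphic2 G"
    and W0: "open W0" "W0 \<noteq> {}" and eq: "\<And>w. w \<in> W0 \<Longrightarrow> F w = G w"
  shows "F = G"
proof -
  \<comment> \<open>\<open>Q V\<close>: the two functions agree on a dense open part of \<open>V\<close>.\<close>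
  define Q where "Q = (\<lambda>V. \<forall>W. open W \<longrightarrow> W \<noteq> {} \<longrightarrow> W \<subseteq> V \<longrightarrow>
                          (\<exists>W'. open W' \<and> W' \<noteq> {} \<and> W' \<subseteq> W \<and> (\<forall>w\<in>W'. F w = G w)))"
  define E where "E = {z. \<exists>V. open V \<and> z \<in> V \<and> Q V}"
  have "open E"
  proof (rule Topological_Spaces.openI)
    fix z assume "z \<in> E"
    then obtain V where "open V" "z \<in> V" "Q V" by (auto simp: E_def)
    then show "\<exists>T. open T \<and> z \<in> T \<and> T \<subseteq> E" by (intro exI[of _ V]) (auto simp: E_def)
  qed
  moreover have "closed E"
  proof -
    have "z \<in> E" if z: "z \<in> closure E" for z
    proof -
      obtain V1 h1 k1 where 1: "open V1" "z \<in> V1" "holomorphic2_on h1 V1" "holomorphic2_on k1 V1"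
        "V1 \<subseteq> closure {w\<in>V1. k1 w \<noteq> 0}" "\<And>w. w \<in> V1 \<Longrightarrow> k1 w \<noteq> 0 \<Longrightarrow> F w = h1 w / k1 w"
        using F unfolding nicely_meromorphic2_def meromorphic2_def by meson
      obtain V2 h2 k2 where 2: "open V2" "z \<in> V2" "holomorphic2_on h2 V2" "holomorphic2_on k2 V2"
        "V2 \<subseteq> closure {w\<in>V2. k2 w \<noteq> 0}" "\<And>w. w \<in> V2 \<Longrightarrow> k2 w \<noteq> 0 \<Longrightarrow> G w = h2 w / k2 w"
        using G unfolding nicely_meromorphic2_def meromorphic2_def by meson
      obtain r where r: "r > 0" "ball z r \<subseteq> V1 \<inter> V2"
        using 1 2 by (meson IntI open_Int open_contains_ball)
      define B where "B = ball z r"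
      have op: "open {w\<in>V1. k1 w \<noteq> 0}" "open {w\<in>V2. k2 w \<noteq> 0}"
        using open_Collect_mem_continuous[OF holomorphic2_on_imp_continuous_on[OF 1(4)] 1(1), of "-{0}"]
          open_Collect_mem_continuous[OF holomorphic2_on_imp_continuous_on[OF 2(4)] 2(1), of "-{0}"]
        by (simp_all add: open_Compl)
      have dense: "\<exists>W'. open W' \<and> W' \<noteq> {} \<and> W' \<subseteq> W \<and> (\<forall>w\<in>W'. k1 w \<noteq> 0 \<and> k2 w \<noteq> 0)"
        if W: "open W" "W \<noteq> {}" "W \<subseteq> B" for W
      proof -
        have "W \<inter> {w\<in>V1. k1 w \<noteq> 0} \<noteq> {}"
        proof -
          have "W \<inter> closure {w\<in>V1. k1 w \<noteq> 0} \<noteq> {}"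
            using W 1(5) r unfolding B_def by blast
          then show ?thesis by (simp add: open_Int_closure_eq_empty[OF W(1)])
        qed
        moreover have "open (W \<inter> {w\<in>V1. k1 w \<noteq> 0})" using W op by blast
        moreover have "W \<inter> {w\<in>V1. k1 w \<noteq> 0} \<subseteq> closure {w\<in>V2. k2 w \<noteq> 0}"
          using 2(5) W r unfolding B_def by blast
        ultimately have "W \<inter> {w\<in>V1. k1 w \<noteq> 0} \<inter> {w\<in>V2. k2 w \<noteq> 0} \<noteq> {}"
          using open_Int_closure_eq_empty[of "W \<inter> {w\<in>V1. k1 w \<noteq> 0}" "{w\<in>V2. k2 w \<noteq> 0}"] by blast
        then show ?thesis
          using W op by (intro exI[of _ "W \<inter> {w\<in>V1. k1 w \<noteq> 0} \<inter> {w\<in>V2. k2 w \<noteq> 0}"]) auto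
      qed
      obtain z' where z': "z' \<in> B" "z' \<in> E"
        using z r(1) unfolding closure_approachable by (auto simp: B_def dist_commute)
      then obtain V' where V': "open V'" "z' \<in> V'" "Q V'" by (auto simp: E_def)
      have "open (V' \<inter> B)" "V' \<inter> B \<noteq> {}" using V' z' by (auto simp: B_def)
      then obtain W1 where W1: "open W1" "W1 \<noteq> {}" "W1 \<subseteq> V' \<inter> B" "\<And>w. w \<in> W1 \<Longrightarrow> F w = G w"
        using V'(3)[unfolded Q_def, rule_format, of "V' \<inter> B"] by blast
      then obtain W2 where W2: "open W2" "W2 \<noteq> {}" "W2 \<subseteq> W1" "\<And>w. w \<in> W2 \<Longrightarrow> k1 w \<noteq> 0 \<and> k2 w \<noteq> 0"
        using dense[of W1] by (metis le_inf_iff)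
      have hol: "holomorphic2_on (\<lambda>w. h1 w * k2 w - h2 w * k1 w) B"
        by (intro holomorphic2_on_diff holomorphic2_on_mult)
           (use 1 2 r in \<open>auto simp: B_def intro: holomorphic2_on_subset\<close>)
      have cross: "h1 w * k2 w - h2 w * k1 w = 0" if w: "w \<in> B" for w
      proof (rule holomorphic2_identity_theorem[OF _ _ hol W2(1,2) _ _ w])
        show "h1 w * k2 w - h2 w * k1 w = 0" if "w \<in> W2" for w
        proof -
          have "w \<in> W1" using that W2(3) by blast
          then have "w \<in> V1" "w \<in> V2" "F w = G w" using W1(3,4) r unfolding B_def by blast+
          moreover have "k1 w \<noteq> 0" "k2 w \<noteq> 0" using W2(4)[OF that] by auto
          ultimately show ?thesis using 1(6)[of w] 2(6)[of w] by (simp add: field_simps)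
        qed
      qed (use W1 W2 in \<open>auto simp: B_def\<close>)
      have FG: "F w = G w" if w: "w \<in> B" "k1 w \<noteq> 0" "k2 w \<noteq> 0" for w
      proof -
        have "w \<in> V1" "w \<in> V2" using w r unfolding B_def by blast+
        with w show ?thesis using cross[OF w(1)] 1(6)[of w] 2(6)[of w] by (simp add: frac_eq_eq)
      qed
      have "Q B"
        unfolding Q_def
      proof (intro allI impI)
        fix W assume W: "open W" "W \<noteq> {}" "W \<subseteq> B"
        then obtain W' where "open W'" "W' \<noteq> {}" "W' \<subseteq> W" "\<forall>w\<in>W'. k1 w \<noteq> 0 \<and> k2 w \<noteq> 0"
          using dense by metis
        then show "\<exists>W'. open W' \<and> W' \<noteq> {} \<and> W' \<subseteq> W \<and> (\<forall>w\<in>W'. F w = G w)"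
          using FG W by (metis subsetD)
      qed
      then show "z \<in> E" using r(1) by (auto simp: E_def B_def intro!: exI[of _ "ball z r"])
    qed
    then show ?thesis using closure_subset closed_closure by (metis subsetI subset_antisym)
  qed
  moreover have "E \<noteq> {}"
  proof -
    obtain w where "w \<in> W0" using W0 by blast
    moreover have "Q W0" unfolding Q_def using eq by blast
    ultimately show ?thesis using W0 by (auto simp: E_def)
  qed
  ultimately have E: "E = UNIV"
    using connected_UNIV by (metis clopen)
  have main: "F z = G z"
    if F: "nicely_meromorphic2 F" and G: "nicely_meromorphic2 G" and reg: "regular2_at F z"
      and V: "open V" "z \<in> V" and
      Q: "\<And>W. open W \<Longrightarrow> W \<noteq> {} \<Longrightarrow> W \<subseteq> V \<Longrightarrow> \<exists>W'. open W' \<and> W' \<noteq> {} \<and> W' \<subseteq> W \<and> (\<forall>w\<in>W'. F w = G w)"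
    for F G z V
  proof -
    obtain V0 where V0: "open V0" "z \<in> V0" "holomorphic2_on F V0"
      using reg unfolding regular2_at_def by blast
    have Qpt: "\<exists>w\<in>W. F w = G w" if "open W" "W \<noteq> {}" "W \<subseteq> V" for W
      using Q[OF that] by blast
    have contF: "continuous_on V0 F" by (rule holomorphic2_on_imp_continuous_on[OF V0(3)])
    define C where "C = norm (F z) + 1"
    define U where "U = V \<inter> {w\<in>V0. norm (F w) < C}"
    have "open {w\<in>V0. norm (F w) < C}"
      using open_Collect_mem_continuous[OF contF V0(1), of "ball 0 C"] by simp
    then have U: "open U" "z \<in> U" using V V0 by (auto simp: U_def C_def)
    have "norm (G w) \<le> C" if w: "w \<in> U" for w
    proof (cases "regular2_at G w")
      case True
      then obtain V1 where V1: "open V1" "w \<in> V1" "holomorphic2_on G V1"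
        unfolding regular2_at_def by blast
      show ?thesis
      proof (rule ccontr)
        assume *: "\<not> norm (G w) \<le> C"
        have "open {w\<in>V1. C < norm (G w)}"
          using open_Collect_mem_continuous[OF holomorphic2_on_imp_continuous_on[OF V1(3)] V1(1), of "- cball 0 C"]
          by (simp add: not_le open_Compl)
        then have "open (U \<inter> {w\<in>V1. C < norm (G w)})" "w \<in> U \<inter> {w\<in>V1. C < norm (G w)}"
          using U V1 w * by auto
        then have "\<exists>v\<in>U \<inter> {w\<in>V1. C < norm (G w)}. F v = G v"
          by (intro Qpt) (auto simp: U_def)
        then show False by (auto simp: U_def)
      qed
    next
      case False
      then have "G w = 0" using G unfolding nicely_meromorphic2_def by blast
      then show ?thesis by (simp add: C_def)
    qed
    then have "bounded (G ` U)" unfolding bounded_iff by blast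
    then have "regular2_at G z" using G U unfolding nicely_meromorphic2_def by blast
    then obtain V1 where V1: "open V1" "z \<in> V1" "holomorphic2_on G V1"
      unfolding regular2_at_def by blast
    have contFG: "continuous_on (V0 \<inter> V1) (\<lambda>w. F w - G w)"
      by (intro continuous_intros continuous_on_subset[OF contF]
            continuous_on_subset[OF holomorphic2_on_imp_continuous_on[OF V1(3)]]) auto
    show ?thesis
    proof (rule ccontr)
      assume *: "F z \<noteq> G z"
      have op: "open {w\<in>V0 \<inter> V1. F w \<noteq> G w}"
        using open_Collect_mem_continuous[OF contFG, of "-{0}"] V0 V1
        by (simp add: open_Int open_Compl)
      have "z \<in> V \<inter> {w\<in>V0 \<inter> V1. F w \<noteq> G w}" using V V0 V1 * by auto
      then have "\<exists>v\<in>V \<inter> {w\<in>V0 \<inter> V1. F w \<noteq> G w}. F v = G v"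
        using op V by (intro Qpt) auto
      then show False by auto
    qed
  qed
  show ?thesis
  proof
    fix z
    obtain V where V: "open V" "z \<in> V" "Q V" using E by (auto simp: E_def)
    show "F z = G z"
    proof (cases "regular2_at F z")
      case True
      show ?thesis by (rule main[OF F G True V(1,2)]) (use V(3) in \<open>auto simp: Q_def\<close>)
    next
      case nF: False
      show ?thesis
      proof (cases "regular2_at G z")
        case True
        have "G z = F z"
          by (rule main[OF G F True V(1,2)]) (use V(3) in \<open>unfold Q_def, metis\<close>)
        then show ?thesis by simp
      next
        case False
        then show ?thesis using nF F G unfolding nicely_meromorphic2_def by metis
      qed
    qed
  qed
qed

text \<open>
  Off the two sparse sets of poles, whose complement is connected, this is the identity theorem.  At a
  pole of one function the other one has a pole too, and both values are \<open>0\<close>.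
\<close>

lemma nicely_meromorphic_on_unique:
  assumes f: "f nicely_meromorphic_on UNIV" and g: "g nicely_meromorphic_on UNIV"
    and W: "open W" "W \<noteq> {}" and eq: "\<And>w. w \<in> W \<Longrightarrow> f w = g w"
  shows "f = g"
proof -
  have sp: "{z. is_pole h z} sparse_in UNIV" if "h nicely_meromorphic_on UNIV" for h
    using that unfolding nicely_meromorphic_on_def sparse_in_open[OF open_UNIV]
    by (meson UNIV_I meromorphic_on_isolated_singularity meromorphic_on_meromorphic_at not_islimpt_poles)
  define P where "P = {z. is_pole f z} \<union> {z. is_pole g z}"
  have P: "P sparse_in UNIV" unfolding P_def by (intro sparse_in_union' sp f g)
  have opS: "open (UNIV - P)" by (rule open_diff_sparse_pts[OF open_UNIV P])
  have conS: "connected (UNIV - P)"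
    by (rule sparse_imp_connected[OF _ connected_UNIV open_UNIV P]) simp
  have hol: "h holomorphic_on UNIV - P" if "h nicely_meromorphic_on UNIV" "{z. is_pole h z} \<subseteq> P" for h
  proof -
    have "h analytic_on {z}" if "z \<in> UNIV - P" for z
      by (rule nicely_meromorphic_on_imp_analytic_at[OF \<open>h nicely_meromorphic_on UNIV\<close>])
         (use that \<open>{z. is_pole h z} \<subseteq> P\<close> in auto)
    then show ?thesis
      using analytic_imp_holomorphic analytic_on_analytic_at by blast
  qed
  have "W - P \<noteq> {}"
  proof
    assume "W - P = {}"
    then obtain w where "w \<in> W" "W \<subseteq> P" using W by blast
    then have "w islimpt P" using W islimpt_subset interior_limit_point interior_open by metis
    then show False using P unfolding sparse_in_open[OF open_UNIV] by blast
  qed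
  have off: "f z = g z" if "z \<notin> P" for z
  proof (rule analytic_continuation_open[of "W - P" "UNIV - P" f g z])
    show "open (W - P)" using W(1) sparse_in_UNIV_imp_closed[OF P] by (rule open_Diff)
    show "f holomorphic_on UNIV - P" "g holomorphic_on UNIV - P"
      by (rule hol; use f g in \<open>simp add: P_def\<close>)+
  qed (use that eq opS conS \<open>W - P \<noteq> {}\<close> in blast)+
  have ev: "\<forall>\<^sub>F w in at z. f w = g w" for z
  proof -
    have "\<forall>\<^sub>F w in at z. w \<notin> P"
      using P unfolding sparse_in_eventually_iff[OF open_UNIV] by blast
    then show ?thesis by eventually_elim (rule off)
  qed
  have zero: "h z = 0" if "h nicely_meromorphic_on UNIV" "is_pole h z" for h z
    using that not_tendsto_and_filterlim_at_infinity[OF at_neq_bot]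
    unfolding nicely_meromorphic_on_def is_pole_def by blast
  show ?thesis
  proof
    fix z
    show "f z = g z"
    proof (cases "z \<in> P")
      case True
      then have "is_pole f z" "is_pole g z" using is_pole_cong[OF ev refl] by (auto simp: P_def)
      then show ?thesis using zero f g by metis
    qed (rule off)
  qed
qed

lemma nicely_meromorphic_on_tendsto_imp_eq:
  assumes "f nicely_meromorphic_on UNIV" "f \<midarrow>z\<rightarrow> c"
  shows "f z = c"
proof -
  have "\<not> is_pole f z"
    using not_tendsto_and_filterlim_at_infinity[OF at_neq_bot assms(2)] unfolding is_pole_def by blast
  then have "f \<midarrow>z\<rightarrow> f z" using assms(1) unfolding nicely_meromorphic_on_def by blast
  then show ?thesis using assms(2) LIM_unique by blast
qed

section \<open>Powers with positive real base and negative binomial coefficients\<close>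

text \<open>
  Unlike \<^const>\<open>powr\<close>, this is given by a single exponential and so is holomorphic in the exponent
  without side conditions.
\<close>

definition qpow :: "real \<Rightarrow> complex \<Rightarrow> complex"
  where "qpow q z = exp (of_real (ln q) * z)"

lemma powr_eq_qpow: "q > 0 \<Longrightarrow> of_real q powr z = qpow q z"
  by (simp add: qpow_def powr_def Ln_of_real mult.commute)

lemma qpow_add: "qpow q (x + y) = qpow q x * qpow q y"
  by (simp add: qpow_def distrib_left exp_add)

lemma qpow_diff: "qpow q (x - y) = qpow q x / qpow q y"
  by (simp add: qpow_def right_diff_distrib exp_diff)

lemma qpow_minus: "qpow q (- x) = inverse (qpow q x)"
  by (simp add: qpow_def exp_minus)

lemma qpow_0 [simp]: "qpow q 0 = 1"
  by (simp add: qpow_def)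

lemma qpow_nonzero [simp]: "qpow q x \<noteq> 0"
  by (simp add: qpow_def)

lemma qpow_of_real: "q > 0 \<Longrightarrow> qpow q (of_real x) = of_real (q powr x)"
  by (simp add: qpow_def powr_def exp_of_real[symmetric] mult.commute)

lemma norm_qpow: "q > 0 \<Longrightarrow> norm (qpow q z) = q powr Re z"
  by (simp add: qpow_def powr_def mult.commute)

lemma qpow_mult_of_nat: "qpow q (of_nat n * z) = qpow q z ^ n"
  by (simp add: qpow_def exp_of_nat_mult[symmetric] mult_ac)

lemma continuous_on_qpow [continuous_intros]:
  "continuous_on A f \<Longrightarrow> continuous_on A (\<lambda>x. qpow q (f x))"
  unfolding qpow_def by (intro continuous_intros)

lemma holomorphic_on_qpow [holomorphic_intros]:
  "f holomorphic_on A \<Longrightarrow> (\<lambda>x. qpow q (f x)) holomorphic_on A"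
  unfolding qpow_def by (intro holomorphic_intros)

text \<open>
  The solutions of \<open>q\<^sup>z = 1\<close> are the multiples of \<open>2\<pi>i / log q\<close>; the bound on \<open>Im z\<close> excludes all but
  \<open>0\<close>.  For fixed \<open>z\<close> it holds as soon as \<open>q\<close> is close to \<open>1\<close>.
\<close>

lemma qpow_eq_1_iff_0:
  assumes "0 < q" "q < 1" "\<bar>Im z\<bar> * (- ln q) < 2 * pi"
  shows "qpow q z = 1 \<longleftrightarrow> z = 0"
proof
  assume "qpow q z = 1"
  then obtain n :: int where n: "ln q * Re z = 0" "ln q * Im z = of_int (2 * n) * pi"
    unfolding qpow_def exp_eq_1 by auto
  have lnq: "ln q < 0" using assms by simp
  have "\<bar>of_int (2 * n) * pi\<bar> = \<bar>Im z\<bar> * (- ln q)"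
    using n(2) lnq by (metis abs_mult abs_of_neg mult.commute)
  then have "\<bar>of_int n\<bar> * (2 * pi) < 1 * (2 * pi)"
    using assms(3) by (simp add: abs_mult mult_ac)
  then have "\<bar>real_of_int n\<bar> < 1" using pi_gt_zero by (subst (asm) mult_less_cancel_right) auto
  then have "n = 0" by linarith
  with n lnq show "z = 0" by (simp add: complex_eq_iff)
qed simp

text \<open>
  The Taylor coefficients at \<open>0\<close> of the function sending \<open>x\<close> to \<open>(1 - x)\<^sup>-\<^sup>s\<close>.
\<close>

definition neg_binom :: "'a::field_char_0 \<Rightarrow> nat \<Rightarrow> 'a"
  where "neg_binom s r = pochhammer s r / fact r"

lemma neg_binom_0 [simp]: "neg_binom s 0 = 1"
  by (simp add: neg_binom_def)

lemma neg_binom_gbinomial: "neg_binom s r = (-1) ^ r * ((- s) gchoose r)"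
  by (simp add: neg_binom_def gbinomial_pochhammer power_mult_distrib[symmetric] mult.assoc[symmetric])

lemma neg_binom_Suc: "of_nat (Suc r) * neg_binom s (Suc r) = (s + of_nat r) * neg_binom s r"
  by (simp add: neg_binom_def pochhammer_Suc field_simps del: of_nat_Suc)

lemma neg_binom_shift: "neg_binom (s - 1) (Suc r) = neg_binom s (Suc r) - neg_binom s r"
proof -
  have "(s - 1) * neg_binom s r = of_nat (Suc r) * neg_binom (s - 1) (Suc r)"
    by (simp add: neg_binom_def pochhammer_rec del: of_nat_Suc)
  moreover have "(s - 1) * neg_binom s r = of_nat (Suc r) * (neg_binom s (Suc r) - neg_binom s r)"
    by (simp only: right_diff_distrib neg_binom_Suc) (simp add: algebra_simps)
  ultimately show ?thesis
    by (metis mult_left_cancel of_nat_neq_0)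
qed

lemma continuous_on_neg_binom [continuous_intros]:
  "continuous_on A f \<Longrightarrow> continuous_on A (\<lambda>x. neg_binom (f x :: 'a::real_normed_field) r)"
  unfolding neg_binom_def pochhammer_prod by (intro continuous_intros) auto

lemma holomorphic_on_neg_binom [holomorphic_intros]:
  "f holomorphic_on A \<Longrightarrow> (\<lambda>x. neg_binom (f x) r) holomorphic_on A"
  unfolding neg_binom_def pochhammer_prod by (intro holomorphic_intros) auto

lemma norm_neg_binom_le:
  fixes s :: complex
  assumes "norm s \<le> R"
  shows "norm (neg_binom s r) \<le> neg_binom R r"
proof -
  have "norm (s + of_nat i) \<le> R + of_nat i" for i
    using norm_triangle_ineq[of s "of_nat i"] assms by simp
  then have "norm (pochhammer s r) \<le> pochhammer R r"
    unfolding pochhammer_prod prod_norm[symmetric] by (intro prod_mono conjI norm_ge_zero)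
  then show ?thesis
    by (simp add: neg_binom_def norm_divide divide_right_mono)
qed

lemma neg_binom_nonneg: "R \<ge> 0 \<Longrightarrow> neg_binom (R::real) r \<ge> 0"
  by (cases "R = 0") (auto simp: neg_binom_def pochhammer_nonneg pochhammer_0_left)

lemma summable_neg_binom:
  fixes R x :: real
  assumes "0 \<le> x" "x < 1"
  shows "summable (\<lambda>r. neg_binom R r * x ^ r)"
proof -
  have "summable (\<lambda>r. ((- R) gchoose r) * (- x) ^ r)"
    using gen_binomial_real[of "- x" "- R"] assms by (auto simp: sums_iff)
  moreover have "((- R) gchoose r) * (- x) ^ r = neg_binom R r * x ^ r" for r
  proof -
    have "((- 1) ^ r * ((- 1) ^ r)) = (1::real)" by (simp add: power_mult_distrib[symmetric])
    then show ?thesis by (simp add: neg_binom_gbinomial power_minus[of x])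
  qed
  ultimately show ?thesis by simp
qed

lemma neg_binom_sums:
  fixes s x :: complex
  assumes "norm x < 1"
  shows "(\<lambda>r. neg_binom s r * x ^ r) sums (1 - x) powr (- s)"
proof -
  have "((- s) gchoose r) * (- x) ^ r = neg_binom s r * x ^ r" for r
    by (simp add: neg_binom_gbinomial power_minus[of x])
  then show ?thesis
    using gen_binomial_complex[of "- x" "- s"] assms by simp
qed

section \<open>The explicit continuation\<close>

text \<open>
  The condition on \<open>t\<close> for some denominator of the explicit series to vanish.
\<close>

definition polar :: "real \<Rightarrow> complex \<Rightarrow> bool"
  where "polar q t \<longleftrightarrow> (\<exists>r::nat. qpow q (t + of_nat r) = 1)"

text \<open>
  For \<open>Re z > 0\<close> this is the sum of the geometric series with terms \<open>q\<^sup>(\<^sup>n\<^sup>+\<^sup>a\<^sup>)\<^sup>z\<close>.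
\<close>

definition geom_factor :: "real \<Rightarrow> real \<Rightarrow> complex \<Rightarrow> complex"
  where "geom_factor q a z = qpow q (of_real a * z) / (1 - qpow q z)"

definition gq_explicit :: "real \<Rightarrow> real \<Rightarrow> complex \<times> complex \<Rightarrow> complex"
  where "gq_explicit q a = (\<lambda>(s, t). if polar q t then 0 else
           qpow (1 - q) s * (\<Sum>r. neg_binom s r * geom_factor q a (t + of_nat r)))"

lemma qpow_eq_1_imp_Re_eq_0:
  assumes "0 < q" "q < 1" "qpow q z = 1"
  shows "Re z = 0"
proof -
  have "q powr Re z = 1" using norm_qpow[OF assms(1), of z] assms(3) by simp
  then show ?thesis using assms by (simp add: powr_def)
qed

lemma polar_isolated:
  assumes q: "0 < q" "q < 1"
  obtains e where "e > 0" "\<And>t t'. polar q t \<Longrightarrow> polar q t' \<Longrightarrow> dist t t' < e \<Longrightarrow> t = t'"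
proof
  define e where "e = min 1 (2 * pi / (- ln q))"
  have lnq: "- ln q > 0" using q by simp
  show "e > 0" using lnq by (simp add: e_def divide_pos_neg)
  fix t t' assume "polar q t" "polar q t'" and d: "dist t t' < e"
  then obtain r r' :: nat where r: "qpow q (t + of_nat r) = 1" "qpow q (t' + of_nat r') = 1"
    by (auto simp: polar_def)
  define z where "z = (t + of_nat r) - (t' + of_nat r')"
  have z1: "qpow q z = 1" using r by (simp add: z_def qpow_diff)
  have *: "\<bar>Re (t - t')\<bar> < 1" "\<bar>Im (t - t')\<bar> < 2 * pi / (- ln q)"
    using d abs_Re_le_cmod[of "t - t'"] abs_Im_le_cmod[of "t - t'"]
    by (simp_all add: e_def dist_norm)
  have "Im z = Im (t - t')" by (simp add: z_def)
  then have "\<bar>Im z\<bar> * (- ln q) < 2 * pi"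
    using mult_strict_right_mono[OF *(2) lnq] lnq by simp
  then have z0: "z = 0" using qpow_eq_1_iff_0[OF q] z1 by blast
  then have eq: "t - t' = of_int (int r' - int r)"
    by (simp add: z_def algebra_simps)
  have "\<bar>real_of_int (int r' - int r)\<bar> < 1"
    using *(1) unfolding eq by simp
  then have "int r' - int r = 0" by linarith
  then show "t = t'" using eq by simp
qed

lemma norm_one_minus_qpow_ge:
  assumes "0 < q" "q < 1" "Re z \<ge> d"
  shows "norm (1 - qpow q z) \<ge> 1 - q powr d"
proof -
  have "norm (qpow q z) \<le> q powr d"
    using assms by (simp add: norm_qpow powr_mono')
  moreover have "1 - norm (qpow q z) \<le> norm (1 - qpow q z)"
    using norm_triangle_ineq2[of 1 "qpow q z"] by simp
  ultimately show ?thesis by linarith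
qed

lemma powr_less_1: "0 < q \<Longrightarrow> q < 1 \<Longrightarrow> d > 0 \<Longrightarrow> q powr d < (1::real)"
  by (simp add: powr_def mult_pos_neg)

lemma norm_geom_factor_le:
  assumes "0 < q" "q < 1" "d > 0" "Re z \<ge> d"
  shows "norm (geom_factor q a z) \<le> q powr (a * Re z) / (1 - q powr d)"
proof -
  have "1 - q powr d > 0" using powr_less_1[of q d] assms by simp
  then show ?thesis
    using norm_one_minus_qpow_ge[of q d z] assms
    by (simp add: geom_factor_def norm_divide norm_qpow frac_le)
qed

lemma norm_gq_term_le:
  assumes q: "0 < q" "q < 1" and a: "a > 0" and d: "d > 0" "Re t + N \<ge> d" and s: "norm s \<le> R"
  shows "norm (neg_binom s (r + N) * geom_factor q a (t + of_nat (r + N)))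
           \<le> neg_binom R (r + N) * (q powr a) ^ (r + N) * (q powr (a * (d - N)) / (1 - q powr d))"
proof -
  have R: "R \<ge> 0" using s norm_ge_zero order_trans by blast
  have pos: "1 - q powr d > 0" using powr_less_1[of q d] q d by simp
  have "norm (geom_factor q a (t + of_nat (r + N))) \<le> q powr (a * Re (t + of_nat (r + N))) / (1 - q powr d)"
    by (rule norm_geom_factor_le) (use q d in auto)
  also have "q powr (a * Re (t + of_nat (r + N))) \<le> q powr (a * real (r + N) + a * (d - N))"
  proof (rule powr_mono')
    have "a * (d - real N + real (r + N)) \<le> a * Re (t + of_nat (r + N))"
      by (rule mult_left_mono) (use d a in auto)
    then show "a * real (r + N) + a * (d - N) \<le> a * Re (t + of_nat (r + N))"
      by (simp add: algebra_simps)
  qed (use q in auto)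
  also have "q powr (a * real (r + N) + a * (d - N)) = (q powr a) ^ (r + N) * q powr (a * (d - N))"
    using q by (simp add: powr_add powr_powr[symmetric] powr_realpow del: of_nat_add)
  finally have "norm (geom_factor q a (t + of_nat (r + N)))
        \<le> (q powr a) ^ (r + N) * q powr (a * (d - N)) / (1 - q powr d)"
    using pos by (simp add: divide_right_mono)
  then have "norm (neg_binom s (r + N)) * norm (geom_factor q a (t + of_nat (r + N)))
     \<le> neg_binom R (r + N) * ((q powr a) ^ (r + N) * q powr (a * (d - N)) / (1 - q powr d))"
    using norm_neg_binom_le[OF s] neg_binom_nonneg[OF R] by (intro mult_mono) auto
  then show ?thesis by (simp add: norm_mult mult.assoc)
qed

lemma summable_gq_majorant:
  fixes q a R C :: real
  assumes q: "0 < q" "q < 1" and a: "a > 0"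
  shows "summable (\<lambda>r. neg_binom R (r + N) * (q powr a) ^ (r + N) * C)"
proof -
  have "summable (\<lambda>r. neg_binom R r * (q powr a) ^ r)"
    using summable_neg_binom[of "q powr a" R] powr_less_1[OF q a] by simp
  then have "summable (\<lambda>r. neg_binom R (r + N) * (q powr a) ^ (r + N))"
    by (subst summable_iff_shift)
  then show ?thesis by (rule summable_mult2)
qed

lemma summable_gq_explicit:
  assumes q: "0 < q" "q < 1" and a: "a > 0"
  shows "summable (\<lambda>r. norm (neg_binom s r * geom_factor q a (t + of_nat r)))"
proof -
  obtain N :: nat where N: "1 - Re t \<le> N" using real_arch_simple by blast
  have "summable (\<lambda>r. norm (neg_binom s (r + N) * geom_factor q a (t + of_nat (r + N))))"
  proof (rule summable_comparison_test')
    show "norm (norm (neg_binom s (r + N) * geom_factor q a (t + of_nat (r + N))))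
       \<le> neg_binom (norm s) (r + N) * (q powr a) ^ (r + N) * (q powr (a * (1 - real N)) / (1 - q powr 1))" for r
      using norm_gq_term_le[OF q a, of 1 t N s "norm s" r] N by simp
  qed (rule summable_gq_majorant[OF q a])
  then show ?thesis by (subst (asm) summable_iff_shift)
qed

text \<open>
  On the half-plane \<open>Re t > - N\<close> only the first \<open>N\<close> terms of the explicit series can be singular.
  Clearing their denominators leaves a holomorphic numerator.
\<close>

definition gq_denom :: "real \<Rightarrow> nat \<Rightarrow> complex \<Rightarrow> complex"
  where "gq_denom q N t = (\<Prod>r<N. 1 - qpow q (t + of_nat r))"

definition gq_numer :: "real \<Rightarrow> real \<Rightarrow> nat \<Rightarrow> complex \<times> complex \<Rightarrow> complex"
  where "gq_numer q a N = (\<lambda>(s, t). qpow (1 - q) s *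
     ((\<Sum>r<N. neg_binom s r * qpow q (of_real a * (t + of_nat r)) *
                (\<Prod>r'\<in>{..<N} - {r}. 1 - qpow q (t + of_nat r'))) +
      gq_denom q N t * (\<Sum>r. neg_binom s (r + N) * geom_factor q a (t + of_nat (r + N)))))"

lemma one_minus_qpow_nonzero:
  assumes "0 < q" "q < 1" "Re z > 0"
  shows "1 - qpow q z \<noteq> 0"
  using qpow_eq_1_imp_Re_eq_0[of q z] assms by auto

lemma gq_denom_eq_0_iff:
  assumes "0 < q" "q < 1" "Re t > - real N"
  shows "gq_denom q N t = 0 \<longleftrightarrow> polar q t"
proof
  assume "polar q t"
  then obtain r where r: "qpow q (t + of_nat r) = 1" by (auto simp: polar_def)
  then have "Re t + real r = 0" using qpow_eq_1_imp_Re_eq_0[OF assms(1,2)] by fastforce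
  then have "r < N" using assms(3) by linarith
  then show "gq_denom q N t = 0" using r unfolding gq_denom_def by auto
qed (auto simp: gq_denom_def polar_def)

lemma gq_explicit_eq_quotient:
  assumes q: "0 < q" "q < 1" and a: "a > 0" and t: "\<not> polar q t" "Re t > - real N"
  shows "gq_explicit q a (s, t) = gq_numer q a N (s, t) / gq_denom q N t"
proof -
  have nz: "1 - qpow q (t + of_nat r) \<noteq> 0" for r using t by (auto simp: polar_def)
  have den: "gq_denom q N t \<noteq> 0" using gq_denom_eq_0_iff[OF q t(2)] t(1) by simp
  have "(\<Sum>r. neg_binom s r * geom_factor q a (t + of_nat r)) =
          (\<Sum>r. neg_binom s (r + N) * geom_factor q a (t + of_nat (r + N))) +
          (\<Sum>r<N. neg_binom s r * geom_factor q a (t + of_nat r))"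
    by (intro suminf_split_initial_segment summable_norm_cancel[OF summable_gq_explicit[OF q a]])
  moreover have "geom_factor q a (t + of_nat r) =
      qpow q (of_real a * (t + of_nat r)) * (\<Prod>r'\<in>{..<N} - {r}. 1 - qpow q (t + of_nat r')) / gq_denom q N t"
    if "r < N" for r
  proof -
    have "gq_denom q N t = (1 - qpow q (t + of_nat r)) * (\<Prod>r'\<in>{..<N} - {r}. 1 - qpow q (t + of_nat r'))"
      unfolding gq_denom_def using that by (intro prod.remove) auto
    then show ?thesis using den nz by (simp add: geom_factor_def)
  qed
  ultimately have "(\<Sum>r. neg_binom s r * geom_factor q a (t + of_nat r)) =
     (\<Sum>r. neg_binom s (r + N) * geom_factor q a (t + of_nat (r + N))) +
     (\<Sum>r<N. neg_binom s r * qpow q (of_real a * (t + of_nat r)) *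
                (\<Prod>r'\<in>{..<N} - {r}. 1 - qpow q (t + of_nat r'))) / gq_denom q N t"
    by (simp add: sum_divide_distrib mult.assoc)
  moreover have "x * (T + U / d) = x * (U + d * T) / d" if "d \<noteq> 0" for x T U d :: complex
    using that by (simp add: field_simps)
  ultimately show ?thesis
    using t(1) den unfolding gq_explicit_def gq_numer_def by simp
qed

lemma holomorphic2_on_gq_numer:
  assumes q: "0 < q" "q < 1" and a: "a > 0"
  shows "holomorphic2_on (gq_numer q a N) (UNIV \<times> {t. Re t > - real N})"
proof -
  define B where "B = {t. Re t > - real N}"
  have B: "open B" unfolding B_def by (intro open_halfspace_Re_gt)
  have "open ((UNIV::complex set) \<times> B)" by (intro open_Times B open_UNIV)
  define f where "f = (\<lambda>r (s, t). neg_binom s (r + N) * geom_factor q a (t + of_nat (r + N)))"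
  have nz: "qpow q (t + of_nat (r + N)) \<noteq> 1" if "t \<in> B" for t r
    using one_minus_qpow_nonzero[OF q, of "t + of_nat (r + N)"] that by (auto simp: B_def)
  have dom: "\<exists>V M. open V \<and> p \<in> V \<and> summable M \<and> (\<forall>r. \<forall>w\<in>V \<inter> UNIV \<times> B. norm (f r w) \<le> M r)"
    if "p \<in> UNIV \<times> B" for p :: "complex \<times> complex"
  proof -
    obtain s0 t0 where p: "p = (s0, t0)" by force
    define d where "d = (Re t0 + N) / 2"
    have d: "d > 0" using that by (auto simp: d_def p B_def)
    define V where "V = ball (0::complex) (norm s0 + 1) \<times> {t. Re t > d - N}"
    have "open V" unfolding V_def by (intro open_Times open_ball open_halfspace_Re_gt)
    moreover have "p \<in> V" using that by (auto simp: V_def p d_def B_def field_simps)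
    moreover have "norm (f r w) \<le> neg_binom (norm s0 + 1) (r + N) * (q powr a) ^ (r + N) *
         (q powr (a * (d - N)) / (1 - q powr d))" if "w \<in> V \<inter> UNIV \<times> B" for r w
      using that norm_gq_term_le[OF q a d, of "snd w" N "fst w" "norm s0 + 1" r]
      by (auto simp: f_def V_def)
    ultimately show ?thesis
      using summable_gq_majorant[OF q a] by (meson)
  qed
  have cont_f: "continuous_on (UNIV \<times> B) (f r)" for r
    unfolding f_def case_prod_unfold geom_factor_def
    by (intro continuous_intros) (use nz in auto)
  have contS: "continuous_on (UNIV \<times> B) (\<lambda>p. \<Sum>r. f r p)"
    by (rule continuous_on_suminf_locally_dominated[OF \<open>open (UNIV \<times> B)\<close> cont_f dom])
  have hol1: "(\<lambda>s. \<Sum>r. f r (s, t)) holomorphic_on UNIV" if t: "t \<in> B" for t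
  proof (rule holomorphic_on_suminf_locally_dominated)
    show "(\<lambda>s. f r (s, t)) holomorphic_on UNIV" for r
      unfolding f_def by (auto intro!: holomorphic_intros)
    fix s :: complex
    obtain V M where "open V" "(s, t) \<in> V" "summable M" "\<forall>r. \<forall>w\<in>V \<inter> UNIV \<times> B. norm (f r w) \<le> M r"
      using dom[of "(s, t)"] t by blast
    then show "\<exists>V M. open V \<and> s \<in> V \<and> summable M \<and> (\<forall>r. \<forall>w\<in>V \<inter> UNIV. norm (f r (w, t)) \<le> M r)"
      using t open_vimage[of V "\<lambda>s. (s, t)"]
      by (intro exI[of _ "(\<lambda>s. (s, t)) -` V"] exI[of _ M]) (auto intro!: continuous_intros)
  qed auto
  have hol2: "(\<lambda>t. \<Sum>r. f r (s, t)) holomorphic_on B" for s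
  proof (rule holomorphic_on_suminf_locally_dominated[OF B])
    show "(\<lambda>t. f r (s, t)) holomorphic_on B" for r
      unfolding f_def geom_factor_def case_prod_conv
      by (intro holomorphic_intros) (use nz in \<open>auto simp del: of_nat_add\<close>)
    fix t :: complex assume t: "t \<in> B"
    obtain V M where "open V" "(s, t) \<in> V" "summable M" "\<forall>r. \<forall>w\<in>V \<inter> UNIV \<times> B. norm (f r w) \<le> M r"
      using dom[of "(s, t)"] t by blast
    then show "\<exists>V M. open V \<and> t \<in> V \<and> summable M \<and> (\<forall>r. \<forall>w\<in>V \<inter> B. norm (f r (s, w)) \<le> M r)"
      using t open_vimage[of V "\<lambda>t. (s, t)"]
      by (intro exI[of _ "(\<lambda>t. (s, t)) -` V"] exI[of _ M]) (auto intro!: continuous_intros)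
  qed
  have eq: "gq_numer q a N = (\<lambda>(s, t). qpow (1 - q) s *
     ((\<Sum>r<N. neg_binom s r * qpow q (of_real a * (t + of_nat r)) *
                (\<Prod>r'\<in>{..<N} - {r}. 1 - qpow q (t + of_nat r'))) +
      (\<Prod>r<N. 1 - qpow q (t + of_nat r)) * (\<Sum>r. f r (s, t))))"
    by (simp add: gq_numer_def f_def gq_denom_def)
  have "holomorphic2_on (gq_numer q a N) (UNIV \<times> B)"
  proof (rule holomorphic2_on_TimesI[OF open_UNIV B])
    show "continuous_on (UNIV \<times> B) (gq_numer q a N)"
      unfolding eq case_prod_unfold by (intro continuous_intros) (use contS in simp)
    show "(\<lambda>s. gq_numer q a N (s, t)) holomorphic_on UNIV" if "t \<in> B" for t
      unfolding eq case_prod_conv by (intro holomorphic_intros hol1[OF that]) 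
    show "(\<lambda>t. gq_numer q a N (s, t)) holomorphic_on B" for s
      unfolding eq case_prod_conv by (intro holomorphic_intros hol2)
  qed
  then show ?thesis by (simp add: B_def)
qed

lemma holomorphic_on_gq_denom: "gq_denom q N holomorphic_on A"
  unfolding gq_denom_def by (intro holomorphic_intros)

lemma open_nonpolar_halfplane:
  assumes q: "0 < q" "q < 1"
  shows "open {t. Re t > - real N \<and> \<not> polar q t}"
proof -
  have "open {t\<in>{t. Re t > - real N}. gq_denom q N t \<in> - {0}}"
    by (rule open_Collect_mem_continuous[OF holomorphic_on_imp_continuous_on[OF holomorphic_on_gq_denom]])
       (auto simp: open_halfspace_Re_gt open_Compl)
  moreover have "{t\<in>{t. Re t > - real N}. gq_denom q N t \<in> - {0}} = {t. Re t > - real N \<and> \<not> polar q t}"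
    using gq_denom_eq_0_iff[OF q] by auto
  ultimately show ?thesis by simp
qed

lemma holomorphic2_on_gq_explicit_halfplane:
  assumes q: "0 < q" "q < 1" and a: "a > 0"
  shows "holomorphic2_on (gq_explicit q a) (UNIV \<times> {t. Re t > - real N \<and> \<not> polar q t})"
proof (rule holomorphic2_on_TimesI[OF open_UNIV open_nonpolar_halfplane[OF q]])
  define B where "B = {t. Re t > - real N \<and> \<not> polar q t}"
  have num: "holomorphic2_on (gq_numer q a N) (UNIV \<times> B)"
    by (rule holomorphic2_on_subset[OF holomorphic2_on_gq_numer[OF q a]]) (auto simp: B_def)
  have den: "gq_denom q N t \<noteq> 0" if "t \<in> B" for t
    using gq_denom_eq_0_iff[OF q] that by (auto simp: B_def)
  have contd: "continuous_on (UNIV \<times> B) (\<lambda>p. gq_denom q N (snd p))"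
    unfolding gq_denom_def by (intro continuous_intros)
  have eq: "gq_explicit q a p = gq_numer q a N p / gq_denom q N (snd p)" if "p \<in> UNIV \<times> B" for p :: "complex \<times> complex"
    using gq_explicit_eq_quotient[OF q a, of "snd p" N "fst p"] that by (auto simp: B_def)
  have "continuous_on (UNIV \<times> B) (\<lambda>p. gq_numer q a N p / gq_denom q N (snd p))"
    by (intro continuous_intros holomorphic2_on_imp_continuous_on[OF num] contd) (use den in auto)
  then show "continuous_on (UNIV \<times> {t. Re t > - real N \<and> \<not> polar q t}) (gq_explicit q a)"
    using eq by (subst continuous_on_cong[OF refl]) (auto simp: B_def)
  have opB: "open B" unfolding B_def by (rule open_nonpolar_halfplane[OF q])
  show "(\<lambda>s. gq_explicit q a (s, t)) holomorphic_on UNIV"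
    if "t \<in> {t. Re t > - real N \<and> \<not> polar q t}" for t
  proof -
    have t: "t \<in> B" using that by (simp add: B_def)
    have "(\<lambda>s. gq_numer q a N (s, t) / gq_denom q N t) holomorphic_on UNIV"
      by (intro holomorphic_intros holomorphic2_on_compose_curve[OF num]) (use t den in auto)
    then show ?thesis using eq t by (subst holomorphic_cong[OF refl]) auto
  qed
  show "(\<lambda>t. gq_explicit q a (s, t)) holomorphic_on {t. Re t > - real N \<and> \<not> polar q t}" for s
  proof -
    have "(\<lambda>t. gq_numer q a N (s, t) / gq_denom q N t) holomorphic_on B"
      by (intro holomorphic_intros holomorphic2_on_compose_curve[OF num] holomorphic_on_gq_denom opB)
         (use den in auto)
    then have "(\<lambda>t. gq_explicit q a (s, t)) holomorphic_on B"
      using eq by (subst holomorphic_cong[OF refl]) auto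
    then show ?thesis by (simp add: B_def)
  qed
qed

lemma holomorphic2_on_gq_explicit:
  assumes q: "0 < q" "q < 1" and a: "a > 0"
  shows "holomorphic2_on (gq_explicit q a) (UNIV \<times> {t. \<not> polar q t})"
  unfolding holomorphic2_on_def
proof
  fix p :: "complex \<times> complex" assume p: "p \<in> UNIV \<times> {t. \<not> polar q t}"
  obtain N :: nat where "1 - Re (snd p) \<le> N" using real_arch_simple by blast
  then have "p \<in> UNIV \<times> {t. Re t > - real N \<and> \<not> polar q t}" using p by auto
  then show "\<exists>A B. (gq_explicit q a has_derivative (\<lambda>(u, v). A * u + B * v)) (at p)"
    using holomorphic2_on_gq_explicit_halfplane[OF q a, of N] unfolding holomorphic2_on_def by blast
qed

lemma open_nonpolar:
  assumes q: "0 < q" "q < 1"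
  shows "open {t. \<not> polar q t}"
proof (rule Topological_Spaces.openI)
  fix t assume t: "t \<in> {t. \<not> polar q t}"
  obtain N :: nat where "1 - Re t \<le> N" using real_arch_simple by blast
  then show "\<exists>T. open T \<and> t \<in> T \<and> T \<subseteq> {t. \<not> polar q t}"
    using t open_nonpolar_halfplane[OF q, of N]
    by (intro exI[of _ "{t. Re t > - real N \<and> \<not> polar q t}"]) auto
qed

lemma eventually_nonpolar_at:
  assumes q: "0 < q" "q < 1"
  shows "\<forall>\<^sub>F t in at t0. \<not> polar q t"
proof -
  obtain e where e: "e > 0" "\<And>t t'. polar q t \<Longrightarrow> polar q t' \<Longrightarrow> dist t t' < e \<Longrightarrow> t = t'"
    using polar_isolated[OF q] by blast
  show ?thesis
  proof (cases "polar q t0")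
    case True
    then show ?thesis using e unfolding eventually_at by (metis)
  next
    case False
    then show ?thesis using open_nonpolar[OF q] 
      by (auto simp: eventually_at_topological)
  qed
qed

text \<open>
  Near a polar line the function is a quotient whose denominator vanishes on the whole line, while
  the numerator restricted to the line is a nonzero polynomial in \<open>s\<close> times a function without
  zeros.  Moving \<open>s\<close> off the zeros of this polynomial reaches a genuine pole in \<open>t\<close>; so the function
  is unbounded near the points of indeterminacy as well.
\<close>

lemma gq_explicit_unbounded:
  assumes q: "0 < q" "q < 1" and a: "a > 0" and pol: "polar q t0" and W: "open W" "(s0, t0) \<in> W"
  shows "\<not> bounded (gq_explicit q a ` W)"
proof
  assume "bounded (gq_explicit q a ` W)"
  then obtain C where C: "\<And>w. w \<in> W \<Longrightarrow> norm (gq_explicit q a w) \<le> C"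
    by (auto simp: bounded_iff)
  obtain r0 where r0: "qpow q (t0 + of_nat r0) = 1" using pol by (auto simp: polar_def)
  then have Re0: "Re t0 = - real r0" using qpow_eq_1_imp_Re_eq_0[OF q] by fastforce
  define N where "N = Suc r0"
  obtain A B where AB: "open A" "open B" "s0 \<in> A" "t0 \<in> B" "A \<times> B \<subseteq> W"
    using W by (metis open_prod_elim mem_Sigma_iff)
  have "infinite A" using AB finite_imp_not_open by blast
  then have "A - (\<lambda>k. - of_nat k) ` {..<r0} \<noteq> {}"
    by (metis Diff_eq_empty_iff finite_imageI finite_lessThan finite_subset)
  then obtain s1 where s1: "s1 \<in> A" "s1 \<notin> (\<lambda>k. - of_nat k) ` {..<r0}" by blast
  then have nb: "neg_binom s1 r0 \<noteq> 0"
    by (auto simp: neg_binom_def pochhammer_eq_0_iff)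
  have num: "holomorphic2_on (gq_numer q a N) (UNIV \<times> {t. Re t > - real N})"
    by (rule holomorphic2_on_gq_numer[OF q a])
  have op: "open {t. Re t > - real N}" by (rule open_halfspace_Re_gt)
  have t0N: "t0 \<in> {t. Re t > - real N}" by (simp add: Re0 N_def)
  have "(\<lambda>t. gq_numer q a N (s1, t)) holomorphic_on {t. Re t > - real N}"
    by (intro holomorphic2_on_compose_curve[OF num] holomorphic_intros op) auto
  then have contn: "isCont (\<lambda>t. gq_numer q a N (s1, t)) t0"
    using op t0N by (meson continuous_on_eq_continuous_at holomorphic_on_imp_continuous_on)
  have numnz: "gq_numer q a N (s1, t0) \<noteq> 0"
  proof -
    have den0: "gq_denom q N t0 = 0" using gq_denom_eq_0_iff[OF q] t0N pol by simp
    have "(\<Sum>r<N. neg_binom s1 r * qpow q (of_real a * (t0 + of_nat r)) *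
                (\<Prod>r'\<in>{..<N} - {r}. 1 - qpow q (t0 + of_nat r'))) =
          (\<Sum>r\<in>{r0}. neg_binom s1 r * qpow q (of_real a * (t0 + of_nat r)) *
                (\<Prod>r'\<in>{..<N} - {r}. 1 - qpow q (t0 + of_nat r')))"
    proof (rule sum.mono_neutral_right)
      show "\<forall>i\<in>{..<N} - {r0}. neg_binom s1 i * qpow q (of_real a * (t0 + of_nat i)) *
                (\<Prod>r'\<in>{..<N} - {i}. 1 - qpow q (t0 + of_nat r')) = 0"
      proof
        fix i assume "i \<in> {..<N} - {r0}"
        then have "r0 \<in> {..<N} - {i}" by (auto simp: N_def)
        then have "(\<Prod>r'\<in>{..<N} - {i}. 1 - qpow q (t0 + of_nat r')) = 0"
          using r0 by (intro prod_zero) (auto intro!: bexI[of _ r0])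
        then show "neg_binom s1 i * qpow q (of_real a * (t0 + of_nat i)) *
                (\<Prod>r'\<in>{..<N} - {i}. 1 - qpow q (t0 + of_nat r')) = 0" by simp
      qed
    qed (auto simp: N_def)
    moreover have "(\<Prod>r'\<in>{..<N} - {r0}. 1 - qpow q (t0 + of_nat r')) \<noteq> 0"
    proof -
      have "qpow q (t0 + of_nat r') \<noteq> 1" if "r' \<noteq> r0" for r'
        using qpow_eq_1_imp_Re_eq_0[OF q, of "t0 + of_nat r'"] Re0 that by auto
      then show ?thesis by auto
    qed
    ultimately show ?thesis using den0 nb by (simp add: gq_numer_def)
  qed
  have npol: "\<forall>\<^sub>F t in at t0. \<not> polar q t" by (rule eventually_nonpolar_at[OF q])
  have inN: "\<forall>\<^sub>F t in at t0. t \<in> {t. Re t > - real N} \<inter> B"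
    using op t0N AB by (intro eventually_at_in_open') auto
  have "is_pole (\<lambda>t. gq_numer q a N (s1, t) / gq_denom q N t) t0"
  proof (rule is_pole_divide[OF contn _ numnz])
    have "isCont (gq_denom q N) t0"
      using holomorphic_on_gq_denom[of q N UNIV]
      by (meson continuous_on_eq_continuous_at holomorphic_on_imp_continuous_on open_UNIV UNIV_I)
    moreover have "gq_denom q N t0 = 0" using gq_denom_eq_0_iff[OF q] t0N pol by simp
    ultimately have "gq_denom q N \<midarrow>t0\<rightarrow> 0" by (simp add: isCont_def)
    moreover have "\<forall>\<^sub>F t in at t0. gq_denom q N t \<noteq> 0"
      using npol inN by eventually_elim (use gq_denom_eq_0_iff[OF q] in auto)
    ultimately show "filterlim (gq_denom q N) (at 0) (at t0)"
      by (simp add: filterlim_at)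
  qed
  moreover have ev_eq: "\<forall>\<^sub>F t in at t0. gq_numer q a N (s1, t) / gq_denom q N t = gq_explicit q a (s1, t)"
    using npol inN by eventually_elim (use gq_explicit_eq_quotient[OF q a] in auto)
  ultimately have "filterlim (\<lambda>t. gq_explicit q a (s1, t)) at_infinity (at t0)"
    unfolding is_pole_def by (simp add: filterlim_cong[OF refl refl ev_eq])
  then have "\<forall>\<^sub>F t in at t0. norm (gq_explicit q a (s1, t)) \<ge> \<bar>C\<bar> + 1"
    unfolding filterlim_at_infinity[OF order.refl] by (auto dest: spec[of _ "\<bar>C\<bar> + 1"])
  then have "\<forall>\<^sub>F t in at t0. False"
    using inN
  proof eventually_elim
    case (elim t)
    then have "(s1, t) \<in> W" using AB s1 by auto
    then show False using C[of "(s1, t)"] elim by auto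
  qed
  then show False by simp
qed

lemma not_regular2_atI:
  assumes "\<And>W. open W \<Longrightarrow> z \<in> W \<Longrightarrow> \<not> bounded (F ` W)"
  shows "\<not> regular2_at F z"
proof
  assume "regular2_at F z"
  then obtain V where V: "open V" "z \<in> V" "holomorphic2_on F V" unfolding regular2_at_def by blast
  define W where "W = {w\<in>V. F w \<in> ball 0 (norm (F z) + 1)}"
  have "open W" unfolding W_def
    by (rule open_Collect_mem_continuous[OF holomorphic2_on_imp_continuous_on[OF V(3)] V(1)]) simp
  moreover have "z \<in> W" using V by (simp add: W_def)
  moreover have "bounded (F ` W)"
    by (rule bounded_subset[OF bounded_ball[of 0 "norm (F z) + 1"]]) (auto simp: W_def)
  ultimately show False using assms by blast
qed

lemma regular2_at_gq_explicit_iff: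
  assumes q: "0 < q" "q < 1" and a: "a > 0"
  shows "regular2_at (gq_explicit q a) (s, t) \<longleftrightarrow> \<not> polar q t"
proof
  assume "\<not> polar q t"
  then show "regular2_at (gq_explicit q a) (s, t)"
    unfolding regular2_at_def using holomorphic2_on_gq_explicit[OF q a] open_nonpolar[OF q]
    by (intro exI[of _ "UNIV \<times> {t. \<not> polar q t}"]) (auto intro: open_Times)
next
  assume "regular2_at (gq_explicit q a) (s, t)"
  then show "\<not> polar q t"
    using not_regular2_atI[of "(s, t)" "gq_explicit q a"] gq_explicit_unbounded[OF q a] by blast
qed

lemma nicely_meromorphic2_gq_explicit:
  assumes q: "0 < q" "q < 1" and a: "a > 0"
  shows "nicely_meromorphic2 (gq_explicit q a)"
  unfolding nicely_meromorphic2_def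
proof
  show "meromorphic2 (gq_explicit q a)"
    unfolding meromorphic2_def
  proof
    fix z :: "complex \<times> complex"
    obtain N :: nat where N: "1 - Re (snd z) \<le> N" using real_arch_simple by blast
    define V where "V = (UNIV :: complex set) \<times> {t. Re t > - real N}"
    define k where "k = (\<lambda>z :: complex \<times> complex. gq_denom q N (snd z))"
    have V: "open V" unfolding V_def by (intro open_Times open_halfspace_Re_gt open_UNIV)
    have zV: "z \<in> V" using N by (cases z) (simp add: V_def)
    have k: "holomorphic2_on k V" unfolding V_def k_def
    proof (rule holomorphic2_on_TimesI)
      show "continuous_on (UNIV \<times> {t. Re t > - real N}) (\<lambda>z :: complex \<times> complex. gq_denom q N (snd z))"
        unfolding gq_denom_def by (intro continuous_intros)
    qed (auto intro: open_halfspace_Re_gt holomorphic_on_gq_denom)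
    have dense: "V \<subseteq> closure {w\<in>V. k w \<noteq> 0}"
    proof
      fix w assume w: "w \<in> V"
      have "\<forall>\<^sub>F t in at (snd w). \<not> polar q t \<and> t \<in> {t. Re t > - real N}"
        using eventually_nonpolar_at[OF q] w
        by (intro eventually_conj eventually_at_in_open' open_halfspace_Re_gt) (auto simp: V_def)
      then have ev: "\<forall>\<^sub>F t in at (snd w). (fst w, t) \<in> {w\<in>V. k w \<noteq> 0}"
        by eventually_elim (use gq_denom_eq_0_iff[OF q] in \<open>auto simp: V_def k_def\<close>)
      have ev': "\<forall>\<^sub>F t in at (snd w). (fst w, t) \<in> closure {w\<in>V. k w \<noteq> 0}"
        by (rule eventually_mono[OF ev]) (rule subsetD[OF closure_subset])
      have "((\<lambda>t. (fst w, t)) \<longlongrightarrow> (fst w, snd w)) (at (snd w))"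
        by (intro tendsto_intros)
      then show "w \<in> closure {w\<in>V. k w \<noteq> 0}"
        by (metis (no_types) Lim_in_closed_set[OF closed_closure ev' at_neq_bot] prod.collapse)
    qed
    have eq: "gq_explicit q a w = gq_numer q a N w / k w" if "w \<in> V" "k w \<noteq> 0" for w
      using that gq_explicit_eq_quotient[OF q a, of "snd w" N "fst w"] gq_denom_eq_0_iff[OF q, of N "snd w"]
      by (auto simp: V_def k_def)
    show "\<exists>V h k. open V \<and> z \<in> V \<and> holomorphic2_on h V \<and> holomorphic2_on k V \<and>
       V \<subseteq> closure {w\<in>V. k w \<noteq> 0} \<and> (\<forall>w\<in>V. k w \<noteq> 0 \<longrightarrow> gq_explicit q a w = h w / k w)"
      using V zV k dense eq holomorphic2_on_gq_numer[OF q a, of N]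
      by (intro exI[of _ V] exI[of _ "gq_numer q a N"] exI[of _ k]) (auto simp: V_def)
  qed
  show "\<forall>z. regular2_at (gq_explicit q a) z \<or> gq_explicit q a z = 0 \<and>
         (\<forall>V. open V \<longrightarrow> z \<in> V \<longrightarrow> \<not> bounded (gq_explicit q a ` V))"
  proof
    fix z :: "complex \<times> complex"
    show "regular2_at (gq_explicit q a) z \<or> gq_explicit q a z = 0 \<and>
         (\<forall>V. open V \<longrightarrow> z \<in> V \<longrightarrow> \<not> bounded (gq_explicit q a ` V))"
    proof (cases "polar q (snd z)")
      case True
      then have "gq_explicit q a z = 0" by (simp add: gq_explicit_def case_prod_unfold)
      then show ?thesis
        using gq_explicit_unbounded[OF q a True, of _ "fst z"] by auto
    next
      case False
      then show ?thesis using regular2_at_gq_explicit_iff[OF q a, of "fst z" "snd z"] by simp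
    qed
  qed
qed

section \<open>The explicit function continues the series\<close>

text \<open>The term \<open>q\<^sup>x\<^sup>t / [x]\<^sub>q\<^sup>s\<close> of the series for \<open>g\<^sub>q\<close>.\<close>

definition gq_summand :: "real \<Rightarrow> real \<Rightarrow> complex \<Rightarrow> complex \<Rightarrow> complex"
  where "gq_summand q x s t = qpow q (of_real x * t) / qpow ((1 - q powr x) / (1 - q)) s"

lemma gq_summand_sums:
  assumes q: "0 < q" "q < 1" and a: "a > 0"
  shows "(\<lambda>r. qpow (1 - q) s * (neg_binom s r * qpow q (of_real a * (t + of_nat r)))) sums gq_summand q a s t"
proof -
  have qa: "q powr a < 1" "q powr a > 0" using q a powr_less_1 by auto
  have "(\<lambda>r. neg_binom s r * of_real (q powr a) ^ r) sums (1 - of_real (q powr a)) powr (- s)"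
    by (rule neg_binom_sums) (use qa in simp)
  then have "(\<lambda>r. qpow (1 - q) s * qpow q (of_real a * t) * (neg_binom s r * of_real (q powr a) ^ r)) sums
             (qpow (1 - q) s * qpow q (of_real a * t) * (1 - of_real (q powr a)) powr (- s))"
    by (rule sums_mult)
  moreover have "qpow (1 - q) s * qpow q (of_real a * t) * (1 - of_real (q powr a)) powr (- s) = gq_summand q a s t"
  proof -
    have 1: "(1 - of_real (q powr a)) powr (- s) = qpow (1 - q powr a) (- s)"
      using powr_eq_qpow[of "1 - q powr a" "- s"] qa by simp
    have "ln ((1 - q powr a) / (1 - q)) = ln (1 - q powr a) - ln (1 - q)"
      using q qa by (simp add: ln_divide_pos)
    then have 2: "qpow ((1 - q powr a) / (1 - q)) s = qpow (1 - q powr a) s / qpow (1 - q) s"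
      by (simp add: qpow_def left_diff_distrib exp_diff)
    show ?thesis
      unfolding gq_summand_def 1 2 qpow_minus by (simp add: field_simps)
  qed
  moreover have "qpow q (of_real a * (t + of_nat r)) = qpow q (of_real a * t) * of_real (q powr a) ^ r" for r
    using q by (simp add: distrib_left qpow_add mult.commute[of _ "of_nat r"] qpow_mult_of_nat qpow_of_real)
  ultimately show ?thesis by (simp add: mult_ac)
qed

lemma gq_explicit_shift:
  assumes q: "0 < q" "q < 1" and a: "a > 0" and t: "\<not> polar q t"
  shows "gq_explicit q a (s, t) = gq_summand q a s t + gq_explicit q (a + 1) (s, t)"
proof -
  have nz: "1 - qpow q (t + of_nat r) \<noteq> 0" for r using t by (auto simp: polar_def)
  have split: "geom_factor q a z = qpow q (of_real a * z) + geom_factor q (a + 1) z"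
    if "1 - qpow q z \<noteq> 0" for z
  proof -
    have "qpow q (of_real (a + 1) * z) = qpow q (of_real a * z) * qpow q z"
      by (simp add: distrib_right qpow_add)
    then show ?thesis using that by (simp add: geom_factor_def field_simps)
  qed
  have sm: "summable (\<lambda>r. neg_binom s r * geom_factor q (a + 1) (t + of_nat r))"
    by (rule summable_norm_cancel[OF summable_gq_explicit[OF q]]) (use a in simp)
  have "(\<lambda>r. qpow (1 - q) s * (neg_binom s r * qpow q (of_real a * (t + of_nat r))) +
             qpow (1 - q) s * (neg_binom s r * geom_factor q (a + 1) (t + of_nat r))) sums
        (gq_summand q a s t + qpow (1 - q) s * (\<Sum>r. neg_binom s r * geom_factor q (a + 1) (t + of_nat r)))"
    by (intro sums_add gq_summand_sums[OF q a] sums_mult summable_sums sm)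
  moreover have "qpow (1 - q) s * (neg_binom s r * qpow q (of_real a * (t + of_nat r))) +
             qpow (1 - q) s * (neg_binom s r * geom_factor q (a + 1) (t + of_nat r)) =
             qpow (1 - q) s * (neg_binom s r * geom_factor q a (t + of_nat r))" for r
    using split[OF nz[of r]] by (simp add: algebra_simps)
  ultimately have "(\<lambda>r. qpow (1 - q) s * (neg_binom s r * geom_factor q a (t + of_nat r))) sums
        (gq_summand q a s t + qpow (1 - q) s * (\<Sum>r. neg_binom s r * geom_factor q (a + 1) (t + of_nat r)))"
    by simp
  moreover have "(\<lambda>r. qpow (1 - q) s * (neg_binom s r * geom_factor q a (t + of_nat r))) sums
        (qpow (1 - q) s * (\<Sum>r. neg_binom s r * geom_factor q a (t + of_nat r)))"
    by (intro sums_mult summable_sums summable_norm_cancel[OF summable_gq_explicit[OF q a]])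
  ultimately show ?thesis
    using t sums_unique2 unfolding gq_explicit_def by fastforce
qed

lemma gq_explicit_shift_nat:
  assumes q: "0 < q" "q < 1" and a: "a > 0" and t: "\<not> polar q t"
  shows "gq_explicit q a (s, t) = (\<Sum>n<m. gq_summand q (real n + a) s t) + gq_explicit q (real m + a) (s, t)"
proof (induction m)
  case (Suc m)
  have "gq_explicit q (real m + a) (s, t) =
          gq_summand q (real m + a) s t + gq_explicit q (real m + a + 1) (s, t)"
    by (rule gq_explicit_shift[OF q _ t]) (use a in simp)
  with Suc show ?case by (simp add: add_ac)
qed simp

lemma nonpolar_Re_pos: "0 < q \<Longrightarrow> q < 1 \<Longrightarrow> Re t > 0 \<Longrightarrow> \<not> polar q t"
  using qpow_eq_1_imp_Re_eq_0[of q "t + of_nat r" for r] by (auto simp: polar_def)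

text \<open>
  Splitting off the first \<open>m\<close> terms replaces \<open>a\<close> by \<open>a + m\<close>, and for \<open>Re t > 0\<close> the explicit function
  at \<open>a + m\<close> is of the order \<open>q\<^sup>m\<^sup>t\<close>.
\<close>

lemma gq_explicit_sums:
  assumes q: "0 < q" "q < 1" and a: "a > 0" and t: "Re t > 0"
  shows "(\<lambda>n. gq_summand q (real n + a) s t) sums gq_explicit q a (s, t)"
proof -
  have np: "\<not> polar q t" by (rule nonpolar_Re_pos[OF q t])
  define M where "M = (\<lambda>r. neg_binom (norm s) r * (q powr a) ^ r * (q powr (a * (Re t - 0)) / (1 - q powr Re t)))"
  have M: "summable M"
    using summable_gq_majorant[OF q a, of "norm s" 0] unfolding M_def by simp
  have bound: "norm (gq_explicit q (real m + a) (s, t)) \<le> norm (qpow (1 - q) s) * (suminf M * (q powr Re t) ^ m)" for m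
  proof -
    have nb: "norm (neg_binom s r * geom_factor q (real m + a) (t + of_nat r)) \<le> M r * (q powr Re t) ^ m" for r
    proof -
      have "geom_factor q (real m + a) (t + of_nat r) =
              qpow q (t + of_nat r) ^ m * geom_factor q a (t + of_nat r)"
      proof -
        have "of_real (real m + a) * (t + of_nat r) = of_nat m * (t + of_nat r) + of_real a * (t + of_nat r)"
          by (simp add: distrib_right)
        then show ?thesis by (simp only: geom_factor_def qpow_add[of q "of_nat m * _"] qpow_mult_of_nat) simp
      qed
      moreover have "norm (qpow q (t + of_nat r)) \<le> q powr Re t"
        using q by (simp add: norm_qpow powr_mono')
      then have "norm (qpow q (t + of_nat r) ^ m) \<le> (q powr Re t) ^ m"
        by (simp add: norm_power power_mono)
      moreover have "norm (neg_binom s r * geom_factor q a (t + of_nat r)) \<le> M r"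
        using norm_gq_term_le[OF q a t, of t 0 s "norm s" r] by (simp add: M_def)
      ultimately have "norm (neg_binom s r * geom_factor q a (t + of_nat r)) * norm (qpow q (t + of_nat r) ^ m)
           \<le> M r * (q powr Re t) ^ m"
        by (intro mult_mono) (auto intro: order_trans[OF norm_ge_zero])
      then show ?thesis
        using \<open>geom_factor q (real m + a) (t + of_nat r) = _\<close> by (simp add: norm_mult mult_ac)
    qed
    have "norm (\<Sum>r. neg_binom s r * geom_factor q (real m + a) (t + of_nat r)) \<le>
            (\<Sum>r. M r * (q powr Re t) ^ m)"
      by (rule norm_suminf_le[OF nb summable_mult2[OF M]])
    also have "\<dots> = suminf M * (q powr Re t) ^ m"
      using suminf_mult2[OF M, of "(q powr Re t) ^ m"] by simp
    finally show ?thesis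
      using np by (simp add: gq_explicit_def norm_mult mult_left_mono)
  qed
  have "(\<lambda>m. norm (qpow (1 - q) s) * (suminf M * (q powr Re t) ^ m)) \<longlonglongrightarrow> norm (qpow (1 - q) s) * (suminf M * 0)"
    by (intro tendsto_intros LIMSEQ_power_zero) (use powr_less_1[OF q t] in simp)
  then have "(\<lambda>m. gq_explicit q (real m + a) (s, t)) \<longlonglongrightarrow> 0"
    by (intro Lim_null_comparison[OF always_eventually[OF allI[OF bound]]]) simp
  then have "(\<lambda>m. gq_explicit q a (s, t) - gq_explicit q (real m + a) (s, t)) \<longlonglongrightarrow> gq_explicit q a (s, t) - 0"
    by (intro tendsto_intros)
  moreover have "gq_explicit q a (s, t) - gq_explicit q (real m + a) (s, t) = (\<Sum>n<m. gq_summand q (real n + a) s t)" for m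
    using gq_explicit_shift_nat[OF q a np, of s m] by simp
  ultimately show ?thesis by (simp add: sums_def)
qed

lemma gq_explicit_eq_gq_series:
  assumes q: "0 < q" "q < 1" and a: "a > 0" and t: "Re t > 0"
  shows "gq_explicit q a (s, t) = gq_series q a s t"
proof -
  have "gq_summand q (real n + a) s t =
     of_real q powr ((of_nat n + of_real a) * t) / q_bracket q (of_nat n + of_real a) powr s" for n
  proof -
    have x: "(of_nat n + of_real a :: complex) = of_real (real n + a)" by simp
    have "q powr (real n + a) < 1" using powr_less_1[OF q, of "real n + a"] a by simp
    then have pos: "(1 - q powr (real n + a)) / (1 - q) > 0" using q by simp
    have "q_bracket q (of_nat n + of_real a) = of_real ((1 - q powr (real n + a)) / (1 - q))"
      unfolding q_bracket_def x powr_eq_qpow[OF q(1)] qpow_of_real[OF q(1)] by simp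
    then have "q_bracket q (of_nat n + of_real a) powr s = qpow ((1 - q powr (real n + a)) / (1 - q)) s"
      using powr_eq_qpow[OF pos] by simp
    then show ?thesis
      unfolding gq_summand_def powr_eq_qpow[OF q(1)] x by simp
  qed
  then show ?thesis
    using gq_explicit_sums[OF q a t, of s] by (simp add: gq_series_def sums_iff)
qed

theorem gq_eq_gq_explicit:
  assumes q: "0 < q" "q < 1" and a: "a > 0"
  shows "gq q a = gq_explicit q a"
  unfolding gq_def
proof (rule the_equality)
  show "nicely_meromorphic2 (gq_explicit q a) \<and>
          (\<forall>s t. Re t > 0 \<longrightarrow> gq_explicit q a (s, t) = gq_series q a s t)"
    using nicely_meromorphic2_gq_explicit[OF q a] gq_explicit_eq_gq_series[OF q a] by blast
  fix F assume F: "nicely_meromorphic2 F \<and> (\<forall>s t. Re t > 0 \<longrightarrow> F (s, t) = gq_series q a s t)"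
  show "F = gq_explicit q a"
  proof (rule nicely_meromorphic2_unique)
    show "open ((UNIV :: complex set) \<times> {t. Re t > 0})"
      by (intro open_Times open_halfspace_Re_gt open_UNIV)
    show "(UNIV :: complex set) \<times> {t. Re t > 0} \<noteq> {}"
      by (auto intro!: exI[of _ 1])
    show "F w = gq_explicit q a w" if "w \<in> UNIV \<times> {t. Re t > 0}" for w
      using that F gq_explicit_eq_gq_series[OF q a] by auto
  qed (use F nicely_meromorphic2_gq_explicit[OF q a] in auto)
qed

section \<open>The Beta function as a series\<close>

lemma neg_binom_asymptotic:
  fixes s :: complex
  shows "(\<lambda>n. neg_binom s n * exp ((1 - s) * of_real (ln (real n)))) \<longlonglongrightarrow> rGamma s"
proof -
  have "((- s) gchoose n) / ((-1) ^ n / exp ((- s + 1) * of_real (ln (real n)))) =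
        neg_binom s n * exp ((1 - s) * of_real (ln (real n)))" for n
    by (cases "even n") (simp_all add: neg_binom_gbinomial)
  then show ?thesis
    using gbinomial_asymptotic[of "- s"] by (simp add: rGamma_inverse_Gamma)
qed

lemma norm_neg_binom_bigo:
  fixes s :: complex
  obtains C where "C > 0" "\<And>n. n \<ge> 1 \<Longrightarrow> norm (neg_binom s n) \<le> C * real n powr (Re s - 1)"
proof -
  obtain C where C: "C > 0" "\<And>n. norm (neg_binom s n * exp ((1 - s) * of_real (ln (real n)))) \<le> C"
    using convergent_imp_Bseq[OF convergentI[OF neg_binom_asymptotic[of s]]] unfolding Bseq_def by auto
  have "norm (neg_binom s n) \<le> C * real n powr (Re s - 1)" if n: "n \<ge> 1" for n
  proof -
    have "norm (exp ((1 - s) * of_real (ln (real n)))) = real n powr (1 - Re s)"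
      using n by (simp add: powr_def)
    then have "norm (neg_binom s n) * real n powr (1 - Re s) \<le> C"
      using C(2)[of n] by (simp add: norm_mult)
    then have "norm (neg_binom s n) * real n powr (1 - Re s) * real n powr (Re s - 1) \<le> C * real n powr (Re s - 1)"
      by (rule mult_right_mono) simp
    moreover have "real n powr (1 - Re s) * real n powr (Re s - 1) = 1"
      using n by (simp add: powr_add[symmetric])
    ultimately show ?thesis by (simp add: mult.assoc)
  qed
  with C(1) show ?thesis using that by blast
qed

lemma summable_norm_neg_binom:
  fixes s :: complex
  assumes "Re s < 0"
  shows "summable (\<lambda>r. norm (neg_binom s r))"
proof -
  obtain C where C: "\<And>n. n \<ge> 1 \<Longrightarrow> norm (neg_binom s n) \<le> C * real n powr (Re s - 1)"
    using norm_neg_binom_bigo by blast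
  have "summable (\<lambda>n. C * real n powr (Re s - 1))"
    using assms by (intro summable_mult) (simp add: summable_real_powr_iff)
  then show ?thesis
    by (rule summable_comparison_test'[where N = 1]) (use C in auto)
qed

text \<open>
  The partial sums are again binomial coefficients, for \<open>s + 1\<close>, and these tend to \<open>0\<close>.
\<close>

lemma neg_binom_sums_0:
  fixes s :: complex
  assumes "Re s < 0"
  shows "(\<lambda>r. neg_binom s r) sums 0"
proof -
  have part: "(\<Sum>r<Suc n. neg_binom s r) = neg_binom (s + 1) n" for n
  proof (induction n)
    case (Suc n)
    then show ?case using neg_binom_shift[of "s + 1" n] by simp
  qed simp
  obtain C where C: "\<And>n. n \<ge> 1 \<Longrightarrow> norm (neg_binom (s + 1) n) \<le> C * real n powr (Re (s + 1) - 1)"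
    using norm_neg_binom_bigo by blast
  have "(\<lambda>n. C * real n powr (Re (s + 1) - 1)) \<longlonglongrightarrow> C * 0"
    using assms by (intro tendsto_intros tendsto_neg_powr filterlim_real_sequentially) auto
  moreover have "\<forall>\<^sub>F n in sequentially. norm (neg_binom (s + 1) n) \<le> C * real n powr (Re (s + 1) - 1)"
    using eventually_ge_at_top[of 1] by (rule eventually_mono) (rule C)
  ultimately have "(\<lambda>n. neg_binom (s + 1) n) \<longlonglongrightarrow> 0"
    using Lim_null_comparison by fastforce
  then have "(\<lambda>n. \<Sum>r<Suc n. neg_binom s r) \<longlonglongrightarrow> 0"
    unfolding part .
  then show ?thesis unfolding sums_def by (rule LIMSEQ_imp_Suc)
qed

definition beta_series :: "complex \<Rightarrow> complex \<Rightarrow> complex"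
  where "beta_series s t = (\<Sum>r. neg_binom s r / (t + of_nat r))"

lemma plus_of_nat_nonzero: "t \<notin> \<int>\<^sub>\<le>\<^sub>0 \<Longrightarrow> t + of_nat n \<noteq> (0::complex)"
  by (metis add_eq_0_iff2 minus_of_nat_in_nonpos_Ints)

lemma plus_of_nat_notin_nonpos_Ints: "t \<notin> \<int>\<^sub>\<le>\<^sub>0 \<Longrightarrow> t + of_nat n \<notin> (\<int>\<^sub>\<le>\<^sub>0 :: complex set)"
  using nonpos_Ints_diff_Nats[of "t + of_nat n" "of_nat n"] by auto

lemma summable_beta_series:
  assumes s: "Re s < 0"
  shows "summable (\<lambda>r. norm (neg_binom s r / (t + of_nat r)))"
proof -
  obtain N :: nat where N: "1 - Re t \<le> N" using real_arch_simple by blast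
  have "norm (neg_binom s r / (t + of_nat r)) \<le> norm (neg_binom s r)" if "r \<ge> N" for r
  proof -
    have "1 \<le> Re (t + of_nat r)" using N that by simp
    also have "\<dots> \<le> norm (t + of_nat r)" by (rule complex_Re_le_cmod)
    finally show ?thesis
      by (simp add: norm_divide divide_le_eq mult_left_le mult_le_cancel_left1)
  qed
  then show ?thesis
    by (intro summable_comparison_test'[OF summable_norm_neg_binom[OF s], of N]) auto
qed

lemma beta_series_sums:
  "Re s < 0 \<Longrightarrow> (\<lambda>r. neg_binom s r / (t + of_nat r)) sums beta_series s t"
  unfolding beta_series_def by (intro summable_sums summable_norm_cancel[OF summable_beta_series])

text \<open>
  The functional equation \<open>t B(t, 1 - s) = (t + 1 - s) B(t + 1, 1 - s)\<close>, obtained by writing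
  \<open>t / (t + r) = 1 - r / (t + r)\<close> and using that the coefficients sum to \<open>0\<close>.
\<close>

lemma beta_series_rec:
  assumes s: "Re s < 0" and t: "t \<notin> \<int>\<^sub>\<le>\<^sub>0"
  shows "t * beta_series s t = (t + 1 - s) * beta_series s (t + 1)"
proof -
  have nz: "t + of_nat r \<noteq> 0" for r by (rule plus_of_nat_nonzero[OF t])
  have "(\<lambda>r. neg_binom s r - t * (neg_binom s r / (t + of_nat r))) sums (0 - t * beta_series s t)"
    by (intro sums_diff sums_mult beta_series_sums neg_binom_sums_0 s)
  then have "(\<lambda>r. neg_binom s r - t * (neg_binom s r / (t + of_nat r))) sums (- (t * beta_series s t))"
    by simp
  then have "(\<lambda>r. neg_binom s (Suc r) - t * (neg_binom s (Suc r) / (t + of_nat (Suc r)))) sums (- (t * beta_series s t))"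
    using nz[of 0] by (subst sums_Suc_iff) simp
  moreover have "neg_binom s (Suc r) - t * (neg_binom s (Suc r) / (t + of_nat (Suc r))) =
      neg_binom s r - (t + 1 - s) * (neg_binom s r / (t + 1 + of_nat r))" for r
  proof -
    have n: "t + 1 + of_nat r \<noteq> 0" using nz[of "Suc r"] by (simp add: add_ac)
    have "neg_binom s (Suc r) - t * (neg_binom s (Suc r) / (t + of_nat (Suc r))) =
           (of_nat (Suc r) * neg_binom s (Suc r)) / (t + 1 + of_nat r)"
      using n by (simp add: field_simps)
    also have "\<dots> = (s + of_nat r) * neg_binom s r / (t + 1 + of_nat r)"
      by (simp only: neg_binom_Suc)
    also have "\<dots> = neg_binom s r - (t + 1 - s) * (neg_binom s r / (t + 1 + of_nat r))"
      using n by (simp add: field_simps)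
    finally show ?thesis .
  qed
  ultimately have "(\<lambda>r. neg_binom s r - (t + 1 - s) * (neg_binom s r / (t + 1 + of_nat r))) sums (- (t * beta_series s t))"
    by simp
  moreover have "(\<lambda>r. neg_binom s r - (t + 1 - s) * (neg_binom s r / (t + 1 + of_nat r))) sums
       (0 - (t + 1 - s) * beta_series s (t + 1))"
    by (intro sums_diff sums_mult beta_series_sums neg_binom_sums_0 s)
  ultimately show ?thesis using sums_unique2 by fastforce
qed

lemma beta_series_pochhammer:
  assumes s: "Re s < 0" and t: "t \<notin> \<int>\<^sub>\<le>\<^sub>0"
  shows "pochhammer t n * beta_series s t = pochhammer (t + 1 - s) n * beta_series s (t + of_nat n)"
proof (induction n)
  case (Suc n)
  have "pochhammer t (Suc n) * beta_series s t =
        (t + of_nat n) * (pochhammer (t + 1 - s) n * beta_series s (t + of_nat n))"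
    by (simp add: pochhammer_Suc Suc[symmetric])
  also have "\<dots> = pochhammer (t + 1 - s) n * ((t + of_nat n) * beta_series s (t + of_nat n))"
    by simp
  also have "\<dots> = pochhammer (t + 1 - s) (Suc n) * beta_series s (t + of_nat (Suc n))"
    by (subst beta_series_rec[OF s plus_of_nat_notin_nonpos_Ints[OF t]])
       (simp add: pochhammer_Suc algebra_simps)
  finally show ?case .
qed simp

lemma beta_series_1:
  assumes s: "Re s < 0"
  shows "(s - 1) * beta_series s 1 = -1"
proof -
  have "(\<lambda>r. neg_binom (s - 1) r) sums 0"
    by (rule neg_binom_sums_0) (use s in simp)
  then have "(\<lambda>r. neg_binom (s - 1) (Suc r)) sums (-1)"
    by (subst sums_Suc_iff) simp
  moreover have "neg_binom (s - 1) (Suc r) = (s - 1) * (neg_binom s r / (1 + of_nat r))" for r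
    by (simp add: neg_binom_def pochhammer_rec field_simps)
  ultimately have "(\<lambda>r. (s - 1) * (neg_binom s r / (1 + of_nat r))) sums (-1)" by simp
  moreover have "(\<lambda>r. (s - 1) * (neg_binom s r / (1 + of_nat r))) sums ((s - 1) * beta_series s 1)"
    by (intro sums_mult beta_series_sums s)
  ultimately show ?thesis using sums_unique2 by blast
qed

text \<open>
  The series is the Beta function \<open>\<Gamma>(t) \<Gamma>(1 - s) / \<Gamma>(t + 1 - s)\<close>.  Both sides satisfy the same
  recurrence in \<open>t\<close>, so it suffices to compare them at \<open>t + n\<close> for large \<open>n\<close>.  There the series
  depends on \<open>t\<close> only up to \<open>O(n\<^sup>-\<^sup>2)\<close>, which is negligible against its size \<open>n\<close> to the power \<open>s - 1\<close>
  because \<open>Re s > -1\<close>.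
\<close>

lemma beta_series_shift_asymptotic:
  assumes s: "-1 < Re s" "Re s < 0" and t: "t \<notin> \<int>\<^sub>\<le>\<^sub>0"
  shows "(\<lambda>n. exp ((1 - s) * of_real (ln (real n))) *
              (beta_series s (t + of_nat (n + 1)) - beta_series s (1 + of_nat (n + 1)))) \<longlonglongrightarrow> 0"
proof -
  define C where "C = (\<Sum>r. norm (neg_binom s r))"
  obtain N :: nat where N: "2 * \<bar>Re t\<bar> + 1 \<le> N" using real_arch_simple by blast
  have bound: "norm (beta_series s (t + of_nat (n + 1)) - beta_series s (1 + of_nat (n + 1)))
        \<le> C * norm (1 - t) * 2 / real n ^ 2" if n: "n \<ge> N" for n
  proof -
    have npos: "real n > 0" using N n by linarith
    have lb: "real n / 2 \<le> norm (t + of_nat (n + 1) + of_nat r)" for r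
    proof -
      have "real n / 2 \<le> Re (t + of_nat (n + 1) + of_nat r)" using N n by auto
      also have "\<dots> \<le> norm (t + of_nat (n + 1) + of_nat r)" by (rule complex_Re_le_cmod)
      finally show ?thesis .
    qed
    have lb1: "real n \<le> norm (1 + of_nat (n + 1) + of_nat r :: complex)" for r
    proof -
      have "real n \<le> Re (1 + of_nat (n + 1) + of_nat r :: complex)" by simp
      also have "\<dots> \<le> norm (1 + of_nat (n + 1) + of_nat r :: complex)" by (rule complex_Re_le_cmod)
      finally show ?thesis .
    qed
    have diff: "(\<lambda>r. neg_binom s r / (t + of_nat (n + 1) + of_nat r) - neg_binom s r / (1 + of_nat (n + 1) + of_nat r))
        sums (beta_series s (t + of_nat (n + 1)) - beta_series s (1 + of_nat (n + 1)))"
      by (intro sums_diff beta_series_sums s)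
    have le: "norm (neg_binom s r / (t + of_nat (n + 1) + of_nat r) - neg_binom s r / (1 + of_nat (n + 1) + of_nat r))
        \<le> norm (neg_binom s r) * (norm (1 - t) * 2 / real n ^ 2)" for r
    proof -
      define x y where "x = t + of_nat (n + 1) + of_nat r" and "y = (1 + of_nat (n + 1) + of_nat r :: complex)"
      have xy: "norm x \<ge> real n / 2" "norm y \<ge> real n" unfolding x_def y_def by (rule lb, rule lb1)
      then have nz: "x \<noteq> 0" "y \<noteq> 0" using npos by auto
      have "neg_binom s r / x - neg_binom s r / y = neg_binom s r * (y - x) / (x * y)"
        using nz by (simp add: field_simps)
      also have "y - x = 1 - t" by (simp add: x_def y_def)
      finally have "norm (neg_binom s r / x - neg_binom s r / y) = norm (neg_binom s r) * norm (1 - t) / (norm x * norm y)"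
        by (simp add: norm_mult norm_divide)
      also have "\<dots> \<le> norm (neg_binom s r) * norm (1 - t) / ((real n / 2) * real n)"
        using xy npos nz by (intro divide_left_mono mult_mono) auto
      also have "\<dots> = norm (neg_binom s r) * (norm (1 - t) * 2 / real n ^ 2)"
        by (simp add: power2_eq_square)
      finally show ?thesis by (simp add: x_def y_def)
    qed
    have sm: "summable (\<lambda>r. norm (neg_binom s r) * (norm (1 - t) * 2 / real n ^ 2))"
      by (intro summable_mult2 summable_norm_neg_binom s)
    have "norm (\<Sum>r. neg_binom s r / (t + of_nat (n + 1) + of_nat r) - neg_binom s r / (1 + of_nat (n + 1) + of_nat r))
       \<le> (\<Sum>r. norm (neg_binom s r) * (norm (1 - t) * 2 / real n ^ 2))"
      by (rule norm_suminf_le[OF le sm])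
    also have "\<dots> = C * (norm (1 - t) * 2 / real n ^ 2)"
      unfolding C_def by (rule suminf_mult2[symmetric]) (intro summable_norm_neg_binom s)
    finally show ?thesis using sums_unique[OF diff] by simp
  qed
  have "(\<lambda>n. (C * norm (1 - t) * 2) * real n powr (- 1 - Re s)) \<longlonglongrightarrow> (C * norm (1 - t) * 2) * 0"
    using s by (intro tendsto_intros tendsto_neg_powr filterlim_real_sequentially) auto
  then have lim: "(\<lambda>n. (C * norm (1 - t) * 2) * real n powr (- 1 - Re s)) \<longlonglongrightarrow> 0" by simp
  show ?thesis
  proof (rule Lim_null_comparison[OF _ lim])
    show "\<forall>\<^sub>F n in sequentially. norm (exp ((1 - s) * of_real (ln (real n))) *
              (beta_series s (t + of_nat (n + 1)) - beta_series s (1 + of_nat (n + 1))))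
            \<le> (C * norm (1 - t) * 2) * real n powr (- 1 - Re s)"
      using eventually_ge_at_top[of N]
    proof eventually_elim
      case (elim n)
      have npos: "real n > 0" using N elim by linarith
      have e: "norm (exp ((1 - s) * of_real (ln (real n)))) = real n powr (1 - Re s)"
        using npos by (simp add: powr_def)
      have p: "real n powr (1 - Re s) / real n ^ 2 = real n powr (- 1 - Re s)"
      proof -
        have "real n powr (- 1 - Re s) = real n powr ((1 - Re s) - 2)" by simp
        also have "\<dots> = real n powr (1 - Re s) / real n powr 2" by (rule powr_diff)
        finally show ?thesis using npos by (simp add: powr_numeral)
      qed
      have "real n powr (1 - Re s) * norm (beta_series s (t + of_nat (n + 1)) - beta_series s (1 + of_nat (n + 1)))
          \<le> real n powr (1 - Re s) * (C * norm (1 - t) * 2 / real n ^ 2)"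
        by (rule mult_left_mono[OF bound[OF elim]]) simp
      also have "\<dots> = (C * norm (1 - t) * 2) * (real n powr (1 - Re s) / real n ^ 2)"
        by simp
      finally show ?case unfolding norm_mult e p .
    qed
  qed
qed

lemma beta_series_eq_0_imp:
  assumes s: "-1 < Re s" "Re s < 0" and t: "t \<notin> \<int>\<^sub>\<le>\<^sub>0" and zero: "beta_series s t = 0"
  shows "t + 1 - s \<in> \<int>\<^sub>\<le>\<^sub>0"
proof -
  \<comment> \<open>\<open>D t n\<close> is the series at \<open>t + n + 1\<close>, normalised by its expected size \<open>n\<^sup>s\<^sup>-\<^sup>1\<close>; its limit does not
    depend on \<open>t\<close> and is known at \<open>t = 1\<close>.\<close>
  define D where "D = (\<lambda>t n. exp ((1 - s) * of_real (ln (real n))) * beta_series s (t + of_nat (n + 1)))"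
  have rec: "rGamma_series t n * beta_series s t = rGamma_series (t + 1 - s) n * D t n" if "t \<notin> \<int>\<^sub>\<le>\<^sub>0" for t n
  proof -
    define l :: complex where "l = of_real (ln (real n))"
    have e: "exp ((t + 1 - s) * l) = exp (t * l) * exp ((1 - s) * l)"
      by (simp add: exp_add[symmetric] algebra_simps)
    have "rGamma_series t n * beta_series s t =
            pochhammer t (n + 1) * beta_series s t / (fact n * exp (t * l))"
      by (simp add: rGamma_series_def l_def)
    also have "\<dots> = pochhammer (t + 1 - s) (n + 1) * beta_series s (t + of_nat (n + 1)) / (fact n * exp (t * l))"
      by (subst beta_series_pochhammer[OF s(2) that]) simp
    also have "\<dots> = rGamma_series (t + 1 - s) n * D t n"
      unfolding rGamma_series_def D_def of_real_def[symmetric] 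
      by (simp add: e l_def[symmetric])
    finally show ?thesis .
  qed
  have s2: "2 - s \<notin> \<int>\<^sub>\<le>\<^sub>0"
  proof
    assume "2 - s \<in> \<int>\<^sub>\<le>\<^sub>0"
    then obtain n where "2 - s = - of_nat n" by (elim nonpos_Ints_cases')
    then have "Re (2 - s) = - real n" by simp
    then show False using s by simp
  qed
  have "(\<lambda>n. rGamma_series 1 n * beta_series s 1 / rGamma_series (2 - s) n) \<longlonglongrightarrow>
          rGamma 1 * beta_series s 1 / rGamma (2 - s)"
    by (intro tendsto_intros) (use s2 in \<open>simp add: rGamma_eq_zero_iff\<close>)
  moreover have "rGamma_series 1 n * beta_series s 1 / rGamma_series (2 - s) n = D 1 n" for n
  proof -
    have "pochhammer (2 - s) (n + 1) \<noteq> 0"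
      unfolding pochhammer_eq_0_iff using s2 minus_of_nat_in_nonpos_Ints by metis
    then have "rGamma_series (2 - s) n \<noteq> 0" by (simp add: rGamma_series_def)
    then show ?thesis using rec[of 1 n] by simp
  qed
  ultimately have D1: "D 1 \<longlonglongrightarrow> rGamma 1 * beta_series s 1 / rGamma (2 - s)" by simp
  have "(\<lambda>n. (D t n - D 1 n) + D 1 n) \<longlonglongrightarrow> 0 + rGamma 1 * beta_series s 1 / rGamma (2 - s)"
    using beta_series_shift_asymptotic[OF s t] D1
    by (intro tendsto_add) (simp_all add: D_def right_diff_distrib)
  then have Dt: "D t \<longlonglongrightarrow> rGamma 1 * beta_series s 1 / rGamma (2 - s)" by simp
  have "(\<lambda>n. rGamma_series (t + 1 - s) n * D t n) \<longlonglongrightarrow>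
          rGamma (t + 1 - s) * (rGamma 1 * beta_series s 1 / rGamma (2 - s))"
    by (intro tendsto_intros Dt)
  moreover have "rGamma_series (t + 1 - s) n * D t n = 0" for n
    using rec[OF t, of n] zero by simp
  ultimately have "rGamma (t + 1 - s) * (rGamma 1 * beta_series s 1 / rGamma (2 - s)) = 0"
    by (simp only:) (rule LIMSEQ_unique[OF _ tendsto_const])
  moreover have "beta_series s 1 \<noteq> 0" using beta_series_1[OF s(2)] by auto
  moreover have "rGamma 1 \<noteq> (0::complex)" by simp
  moreover have "rGamma (2 - s) \<noteq> 0" using s2 by (simp add: rGamma_eq_zero_iff)
  ultimately show ?thesis by (simp add: rGamma_eq_zero_iff)
qed

section \<open>Necessity\<close>

text \<open>
  With \<open>l = log q\<close> and \<open>\<phi>(u) = (e\<^sup>u - 1) / u\<close> the quotient is \<open>z \<phi>(l z) / \<phi>(l)\<close>, and \<open>\<phi>\<close> is continuous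
  at \<open>0\<close> with value \<open>1\<close>.  The exponent may vary along with \<open>q\<close>.
\<close>

lemma tendsto_qpow_quotient:
  assumes f: "(f \<longlongrightarrow> 1) F" and ev: "\<forall>\<^sub>F p in F. 0 < f p \<and> f p < 1" and g: "(g \<longlongrightarrow> z) F"
  shows "((\<lambda>p. (1 - qpow (f p) (g p)) / of_real (1 - f p)) \<longlongrightarrow> z) F"
proof -
  define \<phi> :: "complex \<Rightarrow> complex" where "\<phi> = (\<lambda>u. if u = 0 then 1 else (exp u - 1) / u)"
  have "((\<lambda>h. (exp h - 1) / h) \<longlongrightarrow> (1 :: complex)) (at 0)"
    using DERIV_exp[of "0 :: complex"] by (simp add: DERIV_def)
  then have "(\<phi> \<longlongrightarrow> 1) (at 0)"
    by (rule Lim_transform_eventually) (auto simp: \<phi>_def eventually_at intro!: exI[of _ 1])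
  then have cont: "isCont \<phi> 0" by (simp add: isCont_def \<phi>_def)
  have ln: "((\<lambda>p. of_real (ln (f p)) :: complex) \<longlongrightarrow> 0) F"
    using tendsto_of_real[OF tendsto_ln[OF f]] by simp
  have "((\<lambda>p. g p * \<phi> (of_real (ln (f p)) * g p) / \<phi> (of_real (ln (f p)))) \<longlongrightarrow> z * \<phi> 0 / \<phi> 0) F"
    using tendsto_mult[OF ln g]
    by (intro tendsto_divide tendsto_mult g isCont_tendsto_compose[OF cont] ln) (simp_all add: \<phi>_def)
  then have lim: "((\<lambda>p. g p * \<phi> (of_real (ln (f p)) * g p) / \<phi> (of_real (ln (f p)))) \<longlongrightarrow> z) F"
    by (simp add: \<phi>_def)
  have "\<forall>\<^sub>F p in F. g p * \<phi> (of_real (ln (f p)) * g p) / \<phi> (of_real (ln (f p))) =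
          (1 - qpow (f p) (g p)) / of_real (1 - f p)"
    using ev
  proof eventually_elim
    case (elim p)
    define l :: complex where "l = of_real (ln (f p))"
    have l: "l \<noteq> 0" using elim by (simp add: l_def)
    have e: "exp l = of_real (f p)" unfolding l_def exp_of_real using elim by simp
    then have ne: "exp l - 1 \<noteq> 0" using elim by simp
    have "g p * \<phi> (l * g p) = (exp (l * g p) - 1) / l"
      using l by (simp add: \<phi>_def)
    then have "g p * \<phi> (l * g p) / \<phi> l = (exp (l * g p) - 1) / (exp l - 1)"
      using l ne by (simp add: \<phi>_def)
    also have "\<dots> = (1 - exp (l * g p)) / (1 - exp l)"
      by (metis minus_diff_eq minus_divide_divide)
    finally show ?case by (simp add: qpow_def l_def[symmetric] e)
  qed
  from Lim_transform_eventually[OF lim this] show ?thesis .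
qed

lemma tendsto_qpow_quotient_left:
  "((\<lambda>q. (1 - qpow q z) / of_real (1 - q)) \<longlongrightarrow> z) (at_left 1)"
proof (rule tendsto_qpow_quotient)
  have "\<forall>\<^sub>F q in at_left 1. q \<in> {0<..<1::real}" by (rule eventually_at_left_real) simp
  then show "\<forall>\<^sub>F q in at_left 1. 0 < q \<and> q < (1::real)" by (rule eventually_mono) simp
qed (rule tendsto_ident_at tendsto_const)+

lemma tendsto_geom_factor:
  assumes "z \<noteq> 0"
  shows "((\<lambda>q. of_real (1 - q) * geom_factor q a z) \<longlongrightarrow> 1 / z) (at_left 1)"
proof -
  have "((\<lambda>q. qpow q (of_real a * z)) \<longlongrightarrow> exp (of_real (ln 1) * (of_real a * z))) (at_left 1)"
    unfolding qpow_def by (intro tendsto_intros) auto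
  then have "((\<lambda>q. qpow q (of_real a * z) / ((1 - qpow q z) / of_real (1 - q))) \<longlongrightarrow> 1 / z) (at_left 1)"
    by (intro tendsto_divide tendsto_qpow_quotient_left assms) simp
  then show ?thesis by (simp add: geom_factor_def mult.commute)
qed

text \<open>
  For \<open>Re s < 0\<close> the coefficients are absolutely summable, so the limit may be taken termwise.
\<close>

lemma tendsto_gq_explicit_scaled:
  assumes s: "Re s < 0" and t: "t \<notin> \<int>\<^sub>\<le>\<^sub>0" and a: "a > 0"
  shows "((\<lambda>q. of_real (1 - q) * (\<Sum>r. neg_binom s r * geom_factor q a (t + of_nat r)))
            \<longlongrightarrow> beta_series s t) (at_left 1)"
proof -
  obtain N :: nat where N: "1 - Re t \<le> N" using real_arch_simple by blast
  have pos: "\<forall>\<^sub>F q in at_left 1. q \<in> {0<..<1::real}" by (rule eventually_at_left_real) simp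
  define f where "f = (\<lambda>r q. neg_binom s r * (of_real (1 - q) * geom_factor q a (t + of_nat r)))"
  have tan: "((\<lambda>q. \<Sum>r. f r q) \<longlongrightarrow> (\<Sum>r. neg_binom s r * (1 / (t + of_nat r)))) (at_left 1)"
  proof (rule tannerys_theorem[THEN conjunct2, THEN conjunct2])
    show "((\<lambda>q. f r q) \<longlongrightarrow> neg_binom s r * (1 / (t + of_nat r))) (at_left 1)" for r
      unfolding f_def by (intro tendsto_intros tendsto_geom_factor plus_of_nat_nonzero[OF t])
    show "summable (\<lambda>r. norm (neg_binom s r))" by (rule summable_norm_neg_binom[OF s])
    have "norm (f r q) \<le> norm (neg_binom s r)" if r: "r \<ge> N" and q: "q \<in> {0<..<1}" for r q
    proof -
      have "norm (geom_factor q a (t + of_nat r)) \<le> q powr (a * Re (t + of_nat r)) / (1 - q powr 1)"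
        using q r N by (intro norm_geom_factor_le) auto
      also have "\<dots> \<le> 1 / (1 - q)"
        using q r N a by (intro frac_le) (auto intro!: powr_le1 mult_nonneg_nonneg)
      finally have "(1 - q) * norm (geom_factor q a (t + of_nat r)) \<le> 1"
        using q by (simp add: field_simps)
      moreover have "norm (of_real (1 - q) * geom_factor q a (t + of_nat r)) = (1 - q) * norm (geom_factor q a (t + of_nat r))"
        using q by (simp only: norm_mult norm_of_real) simp
      ultimately show ?thesis
        unfolding f_def norm_mult[of "neg_binom s r"] by (simp add: mult_left_le)
    qed
    then show "\<forall>\<^sub>F (r, q) in at_top \<times>\<^sub>F at_left 1. norm (f r q) \<le> norm (neg_binom s r)"
      unfolding eventually_prod_filter using eventually_ge_at_top[of N] pos by blast
  qed simp
  have "(\<Sum>r. f r q) = of_real (1 - q) * (\<Sum>r. neg_binom s r * geom_factor q a (t + of_nat r))"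
    if "q \<in> {0<..<1}" for q
  proof -
    have "(\<lambda>r. of_real (1 - q) * (neg_binom s r * geom_factor q a (t + of_nat r))) sums
        (of_real (1 - q) * (\<Sum>r. neg_binom s r * geom_factor q a (t + of_nat r)))"
      by (intro sums_mult summable_sums summable_norm_cancel[OF summable_gq_explicit]) (use that a in auto)
    then show ?thesis by (simp add: f_def sums_iff mult_ac)
  qed
  then have "\<forall>\<^sub>F q in at_left 1. (\<Sum>r. f r q) = of_real (1 - q) * (\<Sum>r. neg_binom s r * geom_factor q a (t + of_nat r))"
    using pos by (auto elim: eventually_mono)
  then show ?thesis
    using Lim_transform_eventually[OF tan] by (simp add: beta_series_def)
qed

lemma nonpolarI:
  assumes "0 < q" "q < 1" "\<bar>Im t\<bar> * (- ln q) < 2 * pi" "t \<notin> \<int>\<^sub>\<le>\<^sub>0"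
  shows "\<not> polar q t"
proof
  assume "polar q t"
  then obtain r where "qpow q (t + of_nat r) = 1" by (auto simp: polar_def)
  then have "t + of_nat r = 0" using qpow_eq_1_iff_0[OF assms(1,2), of "t + of_nat r"] assms(3) by simp
  then show False using plus_of_nat_nonzero[OF assms(4)] by blast
qed

lemma eventually_small_log:
  assumes "e > 0"
  shows "\<forall>\<^sub>F q in at_left 1. q \<in> {0<..<1} \<and> c * (- ln q) < (e::real)"
proof (rule eventually_conj)
  show "\<forall>\<^sub>F q in at_left 1. q \<in> {0<..<1::real}" by (rule eventually_at_left_real) simp
  have "((\<lambda>q. c * (- ln q)) \<longlongrightarrow> c * (- ln 1)) (at_left (1::real))"
    by (intro tendsto_intros) auto
  then show "\<forall>\<^sub>F q in at_left 1. c * (- ln q) < e"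
    using assms by (intro order_tendstoD) auto
qed

text \<open>
  \<open>(1 - q)\<^sup>1\<^sup>-\<^sup>s g\<^sub>q(s, t, a)\<close> tends to \<open>B(t, 1 - s)\<close>; if \<open>g\<^sub>q(s, t, a)\<close> itself has a finite limit then
  the Beta function must vanish.
\<close>

lemma gq_explicit_convergent_imp:
  assumes s: "-1 < Re s" "Re s < 0" and t: "t \<notin> \<int>\<^sub>\<le>\<^sub>0" and a: "a > 0"
    and lim: "((\<lambda>q. gq_explicit q a (s, t)) \<longlongrightarrow> L) (at_left 1)"
  shows "t + 1 - s \<in> \<int>\<^sub>\<le>\<^sub>0"
proof -
  have lim0: "((\<lambda>q. (1 - q) powr (1 - Re s)) \<longlongrightarrow> (1 - 1) powr (1 - Re s)) (at_left (1::real))"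
    by (intro tendsto_powr' tendsto_intros) (use s in \<open>auto simp: eventually_at intro!: exI[of _ 1]\<close>)
  have ev: "\<forall>\<^sub>F q in at_left 1. q \<in> {0<..<1} \<and> \<bar>Im t\<bar> * (- ln q) < 2 * pi"
    by (rule eventually_small_log) simp
  then have "\<forall>\<^sub>F q in at_left 1. (1 - q) powr (1 - Re s) = norm (qpow (1 - q) (1 - s))"
    by eventually_elim (simp add: norm_qpow)
  from Lim_transform_eventually[OF lim0 this]
  have "((\<lambda>q. norm (qpow (1 - q) (1 - s))) \<longlongrightarrow> 0) (at_left 1)" by simp
  then have pw: "((\<lambda>q. qpow (1 - q) (1 - s)) \<longlongrightarrow> 0) (at_left 1)"
    by (rule tendsto_norm_zero_cancel)
  have "((\<lambda>q. qpow (1 - q) (1 - s) * gq_explicit q a (s, t)) \<longlongrightarrow> 0 * L) (at_left 1)"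
    by (intro tendsto_mult pw lim)
  moreover have "\<forall>\<^sub>F q in at_left 1. qpow (1 - q) (1 - s) * gq_explicit q a (s, t) =
      of_real (1 - q) * (\<Sum>r. neg_binom s r * geom_factor q a (t + of_nat r))"
    using ev
  proof eventually_elim
    case (elim q)
    have "\<not> polar q t" by (rule nonpolarI) (use elim t in auto)
    moreover have "qpow (1 - q) (1 - s) * qpow (1 - q) s = of_real (1 - q)"
      using elim qpow_of_real[of "1 - q" 1] by (simp flip: qpow_add)
    ultimately show ?case by (simp add: gq_explicit_def mult.assoc[symmetric])
  qed
  ultimately have "((\<lambda>q. of_real (1 - q) * (\<Sum>r. neg_binom s r * geom_factor q a (t + of_nat r))) \<longlongrightarrow> 0) (at_left 1)"
    using Lim_transform_eventually by fastforce
  then have "beta_series s t = 0"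
    using tendsto_unique[OF _ tendsto_gq_explicit_scaled[OF s(2) t a]] by simp
  then show ?thesis by (rule beta_series_eq_0_imp[OF s t])
qed

lemma Ints_valued_continuous_constant:
  fixes f :: "complex \<Rightarrow> complex"
  assumes "connected S" "continuous_on S f" "\<And>x. x \<in> S \<Longrightarrow> f x \<in> \<int>"
  shows "f constant_on S"
proof (rule continuous_discrete_range_constant[OF assms(1,2)])
  fix x assume x: "x \<in> S"
  have "1 \<le> norm (f y - f x)" if "y \<in> S" "f y \<noteq> f x" for y
  proof -
    have "f y - f x \<in> \<int>" by (intro Ints_diff assms(3) x that(1))
    then obtain k where k: "f y - f x = of_int k" by (auto elim: Ints_cases)
    then have "k \<noteq> 0" using that by auto
    then have "1 \<le> \<bar>real_of_int k\<bar>" by linarith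
    then show ?thesis unfolding k norm_of_int .
  qed
  then show "\<exists>e>0. \<forall>y. y \<in> S \<and> f y \<noteq> f x \<longrightarrow> e \<le> norm (f y - f x)"
    by (intro exI[of _ 1]) auto
qed

lemma gq_along_eq_gq_explicit:
  assumes q: "0 < q" "q < 1" and a: "a > 0"
    and \<phi>: "\<phi> analytic_on {s}" and np: "\<not> polar q (\<phi> s)"
  shows "gq_along q a \<phi> s = gq_explicit q a (s, \<phi> s)" "gq_along q a \<phi> analytic_on {s}"
proof -
  obtain T where T: "open T" "s \<in> T" "\<phi> holomorphic_on T"
    using \<phi> unfolding analytic_at by blast
  define S where "S = {w\<in>T. \<phi> w \<in> {t. \<not> polar q t}}"
  have S: "open S"
    unfolding S_def
    by (intro open_Collect_mem_continuous holomorphic_on_imp_continuous_on T open_nonpolar q)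
  have "(\<lambda>s. gq_explicit q a (s, \<phi> s)) holomorphic_on S"
    by (rule holomorphic2_on_compose_curve[OF holomorphic2_on_gq_explicit[OF q a]])
       (use S T in \<open>auto simp: S_def intro: holomorphic_on_subset holomorphic_intros\<close>)
  then have an: "(\<lambda>s. gq_explicit q a (s, \<phi> s)) analytic_on {s}"
    using S T(2) np by (auto simp: analytic_at S_def)
  show "gq_along q a \<phi> s = gq_explicit q a (s, \<phi> s)" "gq_along q a \<phi> analytic_on {s}"
    using an unfolding gq_along_def gq_eq_gq_explicit[OF q a]
    by (simp_all add: remove_sings_analytic_on)
qed

text \<open>
  The strip \<open>-1 < Re s < 0\<close> is the place where the Beta function limit is available.  Its centre
  is removed from the disc because \<open>\<phi>\<close> may have a pole there.
\<close>

theorem q_limit_formula_imp_shift: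
  fixes a :: real
  assumes a: "0 < a" and \<phi>: "\<phi> nicely_meromorphic_on UNIV" and lim: "q_limit_formula a \<phi>"
  shows "\<exists>\<nu>::nat. \<nu> > 0 \<and> (\<forall>s. \<phi> s = s - of_nat \<nu>)"
proof -
  define s0 :: complex where "s0 = - 1 / 2"
  have "isolated_singularity_at \<phi> s0"
    using \<phi> unfolding nicely_meromorphic_on_def
    by (meson UNIV_I meromorphic_on_isolated_singularity meromorphic_on_meromorphic_at)
  then obtain r0 where r0: "r0 > 0" "\<phi> analytic_on ball s0 r0 - {s0}"
    unfolding isolated_singularity_at_def by blast
  define D where "D = (ball s0 r0 - {s0}) \<inter> {s. -1 < Re s} \<inter> {s. Re s < 0}"
  have opD: "open D" unfolding D_def
    by (intro open_Int open_halfspace_Re_gt open_halfspace_Re_lt open_delete open_ball)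
  have an: "\<phi> analytic_on {s}" if "s \<in> D" for s
    using r0(2) that by (auto simp: D_def elim: analytic_on_subset)
  have contD: "continuous_on D \<phi>"
    using an analytic_imp_holomorphic analytic_on_analytic_at holomorphic_on_imp_continuous_on by metis
  have neD: "D \<noteq> {}"
  proof -
    define e where "e = min (r0 / 2) (1 / 4)"
    have "s0 + of_real e \<in> D"
      using r0(1) by (auto simp: D_def s0_def e_def dist_norm)
    then show ?thesis by blast
  qed
  have key: "\<phi> s + 1 - s \<in> \<int>\<^sub>\<le>\<^sub>0" if s: "s \<in> D" and t: "\<phi> s \<notin> \<int>\<^sub>\<le>\<^sub>0" for s
  proof -
    have ev: "\<forall>\<^sub>F q in at_left 1. q \<in> {0<..<1} \<and> \<bar>Im (\<phi> s)\<bar> * (- ln q) < 2 * pi"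
      by (rule eventually_small_log) simp
    have ev': "\<forall>\<^sub>F q in at_left 1. gq_along q a \<phi> s = gq_explicit q a (s, \<phi> s) \<and> \<not> is_pole (gq_along q a \<phi>) s"
      using ev
    proof eventually_elim
      case (elim q)
      then have "\<not> polar q (\<phi> s)" using nonpolarI[of q "\<phi> s"] t by auto
      then show ?case
        using gq_along_eq_gq_explicit[of q a \<phi> s] elim a an[OF s] analytic_at_imp_no_pole by auto
    qed
    have "s \<noteq> 1" using s by (auto simp: D_def)
    moreover have "\<not> is_pole \<phi> s" using an[OF s] by (rule analytic_at_imp_no_pole)
    moreover have "\<forall>\<^sub>F q in at_left 1. \<not> is_pole (gq_along q a \<phi>) s"
      using ev' by (rule eventually_mono) simp
    ultimately have "((\<lambda>q. gq_along q a \<phi> s) \<longlongrightarrow> hurwitz_zeta a s) (at_left 1)"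
      using lim unfolding q_limit_formula_def by blast
    then have "((\<lambda>q. gq_explicit q a (s, \<phi> s)) \<longlongrightarrow> hurwitz_zeta a s) (at_left 1)"
      by (rule Lim_transform_eventually) (use ev' in eventually_elim, simp)
    then show ?thesis
      using s by (intro gq_explicit_convergent_imp[OF _ _ t a]) (auto simp: D_def)
  qed
  show ?thesis
  proof (cases "\<exists>s\<in>D. \<phi> s \<notin> \<int>\<^sub>\<le>\<^sub>0")
    case True
    then obtain s1 where s1: "s1 \<in> D" "\<phi> s1 \<notin> \<int>\<^sub>\<le>\<^sub>0" by blast
    have "open {s\<in>D. \<phi> s \<in> - \<int>\<^sub>\<le>\<^sub>0}"
      by (intro open_Collect_mem_continuous contD opD) (simp add: open_Compl)
    then obtain r where r: "r > 0" "ball s1 r \<subseteq> {s\<in>D. \<phi> s \<in> - \<int>\<^sub>\<le>\<^sub>0}"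
      using s1 open_contains_ball[of "{s\<in>D. \<phi> s \<in> - \<int>\<^sub>\<le>\<^sub>0}"] by auto
    have "(\<lambda>s. \<phi> s + 1 - s) constant_on ball s1 r"
    proof (rule Ints_valued_continuous_constant)
      show "continuous_on (ball s1 r) (\<lambda>s. \<phi> s + 1 - s)"
        by (intro continuous_intros continuous_on_subset[OF contD]) (use r in auto)
      show "\<phi> s + 1 - s \<in> \<int>" if "s \<in> ball s1 r" for s
        using key[of s] that r(2) nonpos_Ints_Int by blast
    qed simp
    then obtain c where c: "\<And>s. s \<in> ball s1 r \<Longrightarrow> \<phi> s + 1 - s = c"
      unfolding constant_on_def by blast
    then have "c \<in> \<int>\<^sub>\<le>\<^sub>0" using key[OF s1] r(1) by fastforce
    then obtain n where n: "c = - of_nat n" by (elim nonpos_Ints_cases')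
    have "\<phi> = (\<lambda>s. s - of_nat (Suc n))"
    proof (rule nicely_meromorphic_on_unique[OF \<phi>])
      show "(\<lambda>s. s - of_nat (Suc n)) nicely_meromorphic_on UNIV"
        by (intro analytic_on_imp_nicely_meromorphic_on analytic_intros)
      show "\<phi> w = w - of_nat (Suc n)" if "w \<in> ball s1 r" for w
        using c[OF that] by (simp add: n algebra_simps)
    qed (use r in auto)
    then show ?thesis by (intro exI[of _ "Suc n"]) auto
  next
    case False
    obtain s1 where s1: "s1 \<in> D" using neD by blast
    obtain r where r: "r > 0" "ball s1 r \<subseteq> D" using opD s1 openE by blast
    have "\<phi> constant_on ball s1 r"
      by (rule Ints_valued_continuous_constant)
         (use False r nonpos_Ints_Int in \<open>blast intro: continuous_on_subset[OF contD] connected_ball\<close>)+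
    then obtain c where c: "\<And>s. s \<in> ball s1 r \<Longrightarrow> \<phi> s = c"
      unfolding constant_on_def by blast
    have "c \<in> \<int>\<^sub>\<le>\<^sub>0" using False s1 c[of s1] r(1) by auto
    then obtain n where n: "c = - of_nat n" by (elim nonpos_Ints_cases')
    have \<phi>c: "\<phi> = (\<lambda>_. c)"
      by (rule nicely_meromorphic_on_unique[OF \<phi>, of _ "ball s1 r"]) (use c r in auto)
    have "\<forall>\<^sub>F q in at_left 1. q \<in> {0<..<1} \<and> 0 * (- ln q) < (1::real)"
      by (rule eventually_small_log) simp
    moreover have "\<forall>\<^sub>F q in at_left 1. gq_along_well_defined q a \<phi>"
      using lim unfolding q_limit_formula_def by blast
    ultimately have "\<forall>\<^sub>F q in at_left 1. q \<in> {0<..<1} \<and> gq_along_well_defined q a \<phi>"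
      by eventually_elim simp
    then obtain q where q: "0 < q" "q < 1" "gq_along_well_defined q a \<phi>"
      using eventually_happens[of _ "at_left (1::real)"] by auto
    have "polar q c" unfolding polar_def n by (intro exI[of _ n]) simp
    then have "{s. \<not> is_pole \<phi> s \<and> \<not> regular2_at (gq q a) (s, \<phi> s)} = UNIV"
      by (simp add: \<phi>c gq_eq_gq_explicit[OF q(1,2) a] regular2_at_gq_explicit_iff[OF q(1,2) a])
    moreover have "{s. \<not> is_pole \<phi> s} = UNIV" by (simp add: \<phi>c)
    ultimately have "(UNIV :: complex set) sparse_in UNIV"
      using q(3) unfolding gq_along_well_defined_def by simp
    then show ?thesis by (simp add: sparse_in_open islimpt_UNIV)
  qed
qed

section \<open>Telescoping along the curve \<open>t = s - 1\<close>\<close>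

text \<open>
  The number \<open>q\<^sup>-\<^sup>x [x]\<^sub>q\<close>.  It tends to \<open>x\<close> as \<open>q\<close> tends to \<open>1\<close>, and along \<open>t = s - 1\<close> the summand of
  \<open>g\<^sub>q\<close> is a function of it.
\<close>

definition qW :: "real \<Rightarrow> real \<Rightarrow> real"
  where "qW q x = (q powr (- x) - 1) / (1 - q)"

lemma qW_ge:
  assumes "0 < q" "q < 1" "0 \<le> x"
  shows "x \<le> qW q x"
proof -
  have "x * (1 - q) \<le> x * (- ln q)"
    using ln_le_minus_one[of q] assms by (intro mult_left_mono) auto
  also have "1 + x * (- ln q) \<le> exp (x * (- ln q))" by (rule exp_ge_add_one_self)
  then have "x * (- ln q) \<le> q powr (- x) - 1"
    using assms by (simp add: powr_def)
  finally show ?thesis using assms by (simp add: qW_def field_simps)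
qed

lemma qW_plus_1:
  assumes "0 < q" "q < 1"
  shows "qW q (x + 1) = (qW q x + 1) / q"
proof -
  have "q powr (- (x + 1)) = q powr (- x) / q"
    using assms powr_diff[of q "- x" 1] by simp
  then show ?thesis using assms by (simp add: qW_def field_simps)
qed

definition diag_term :: "real \<Rightarrow> real \<Rightarrow> complex \<Rightarrow> complex"
  where "diag_term q w s = qpow w (- s) * of_real (1 + (1 - q) * w)"

lemma gq_summand_diag:
  assumes q: "0 < q" "q < 1" and x: "0 < x"
  shows "gq_summand q x s (s - 1) = diag_term q (qW q x) s"
proof -
  define w where "w = qW q x"
  have w: "w > 0" using qW_ge[OF q, of x] x by (simp add: w_def)
  have p: "q powr (- x) = 1 + (1 - q) * w" using q by (simp add: w_def qW_def)
  have "q powr x * q powr (- x) = 1" using q by (simp add: powr_add[symmetric])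
  then have "q powr x * w = (1 - q powr x) / (1 - q)"
    using q by (simp add: w_def qW_def right_diff_distrib)
  then have "ln ((1 - q powr x) / (1 - q)) = x * ln q + ln w"
    using q w by (simp add: ln_mult_pos ln_powr flip: \<open>q powr x * w = _\<close>)
  then have "gq_summand q x s (s - 1) =
      exp (of_real (ln q) * (of_real x * (s - 1))) / exp (of_real (x * ln q + ln w) * s)"
    by (simp add: gq_summand_def qpow_def)
  also have "\<dots> = exp (of_real (ln q) * (of_real x * (s - 1)) - of_real (x * ln q + ln w) * s)"
    by (rule exp_diff[symmetric])
  also have "of_real (ln q) * (of_real x * (s - 1)) - of_real (x * ln q + ln w) * s =
               of_real (ln w) * (- s) + of_real (- x * ln q)"
    by (simp add: algebra_simps)
  also have "exp \<dots> = qpow w (- s) * of_real (q powr (- x))"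
    unfolding exp_add exp_of_real using q by (simp add: qpow_def powr_def)
  finally show ?thesis by (simp add: diag_term_def w_def[symmetric] p)
qed

lemma norm_diag_term_le:
  assumes "0 < q" "q < 1" "1 \<le> w"
  shows "norm (diag_term q w s) \<le> 2 * w powr (1 - Re s)"
proof -
  have "(1 - q) * w \<le> 1 * w" using assms by (intro mult_right_mono) auto
  then have "1 + (1 - q) * w \<le> 2 * w" using assms(3) by linarith
  moreover have "0 \<le> (1 - q) * w" using assms by simp
  moreover have "norm (diag_term q w s) = w powr (- Re s) * (1 + (1 - q) * w)"
    using assms \<open>0 \<le> (1 - q) * w\<close> unfolding diag_term_def norm_mult norm_of_real by (simp add: norm_qpow)
  ultimately have "norm (diag_term q w s) \<le> w powr (- Re s) * (2 * w)"
    by (simp add: mult_left_mono)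
  also have "w powr (- Re s) * (2 * w) = 2 * (w powr 1 * w powr (- Re s))"
    using assms by simp
  also have "w powr 1 * w powr (- Re s) = w powr (1 - Re s)"
    unfolding powr_add[symmetric] by simp
  finally show ?thesis .
qed

lemma diag_term_shift:
  assumes "w > 0"
  shows "diag_term q w (s + of_nat j) = diag_term q w s * of_real ((1 / w) ^ j)"
proof -
  have "qpow w (of_nat j) = of_real w ^ j"
    using qpow_mult_of_nat[of w j 1] qpow_of_real[OF assms, of 1] assms by simp
  moreover have "qpow w (- (s + of_nat j)) = qpow w (- s) / qpow w (of_nat j)"
    using qpow_diff[of w "- s" "of_nat j"] by simp
  ultimately show ?thesis by (simp add: diag_term_def power_one_over field_simps)
qed

lemma qpow_mult_base: "a > 0 \<Longrightarrow> b > 0 \<Longrightarrow> qpow (a * b) z = qpow a z * qpow b z"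
  by (simp add: qpow_def ln_mult_pos distrib_right exp_add)

text \<open>
  With \<open>v = 1 / w + 1 - q\<close> one has \<open>(w + 1) / q = w (1 + v / q)\<close>.  So by the binomial series
  \<open>w\<^sup>1\<^sup>-\<^sup>s - ((w + 1) / q)\<^sup>1\<^sup>-\<^sup>s\<close> is \<open>w\<^sup>1\<^sup>-\<^sup>s v = diag_term q w s\<close> times a power series in \<open>v\<close>, whose
  coefficients these are.  A power of \<open>v\<close> does not decay as \<open>w\<close> grows, whereas \<open>1 / w\<close> does, and
  multiplication by \<open>1 / w\<close> turns \<open>diag_term\<close> at \<open>s\<close> into \<open>diag_term\<close> at \<open>s + 1\<close>.  Therefore the power
  series is recentred: the coefficients of the powers of \<open>1 / w\<close> are given by \<open>recentred_coeff\<close> below.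
\<close>

definition telescope_coeff :: "real \<Rightarrow> complex \<Rightarrow> nat \<Rightarrow> complex"
  where "telescope_coeff q s k = (-1) ^ k * neg_binom (s - 1) (Suc k) / of_real (q ^ Suc k)"

definition recentred_coeff :: "real \<Rightarrow> complex \<Rightarrow> nat \<Rightarrow> complex"
  where "recentred_coeff q s j = (\<Sum>k. telescope_coeff q s k * of_real (of_nat (k choose j) * (1 - q) ^ (k - j)))"

text \<open>
  Bounds the \<open>k\<close>-th term of the power series on \<open>\<bar>v\<bar> \<le> 1 / 2\<close> for all \<open>q \<ge> 3 / 4\<close>: then \<open>v / q \<le> 2 / 3\<close>
  stays away from the radius of convergence.
\<close>

definition coeff_major :: "real \<Rightarrow> nat \<Rightarrow> real"
  where "coeff_major R k = neg_binom R (Suc k) * (4 / 3) ^ Suc k * (1 / 2) ^ k"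

lemma summable_coeff_major: "summable (coeff_major R)"
proof -
  have "summable (\<lambda>k. neg_binom R k * (2 / 3) ^ k)" by (rule summable_neg_binom) auto
  then have "summable (\<lambda>k. 2 * (neg_binom R (Suc k) * (2 / 3) ^ Suc k))"
    by (intro summable_mult) (subst summable_Suc_iff)
  moreover have "2 * (neg_binom R (Suc k) * (2 / 3) ^ Suc k) = coeff_major R k" for k
  proof -
    have "(4 / 3 :: real) ^ Suc k * (1 / 2) ^ k = 2 * ((4 / 3) ^ Suc k * (1 / 2) ^ Suc k)" by simp
    also have "(4 / 3 :: real) ^ Suc k * (1 / 2) ^ Suc k = (2 / 3) ^ Suc k"
      by (simp only: power_mult_distrib[symmetric]) simp
    finally show ?thesis by (simp only: coeff_major_def mult.assoc mult.left_commute[of 2])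
  qed
  ultimately show ?thesis by (simp only:)
qed

lemma coeff_major_nonneg: "R \<ge> 0 \<Longrightarrow> coeff_major R k \<ge> 0"
  by (simp add: coeff_major_def neg_binom_nonneg)

lemma norm_telescope_coeff_le:
  assumes q: "3 / 4 \<le> q" and s: "norm (s - 1) \<le> R"
  shows "norm (telescope_coeff q s k) * (1 / 2) ^ k \<le> coeff_major R k"
proof -
  have R: "R \<ge> 0" using s norm_ge_zero order_trans by blast
  have "1 / q ^ Suc k \<le> (4 / 3) ^ Suc k"
  proof -
    have "(3 / 4) ^ Suc k \<le> q ^ Suc k" using q by (intro power_mono) auto
    then have "1 / q ^ Suc k \<le> 1 / (3 / 4) ^ Suc k" by (intro divide_left_mono) (use q in auto)
    also have "1 / (3 / 4 :: real) ^ Suc k = (4 / 3) ^ Suc k"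
      unfolding power_one_over[symmetric] by simp
    finally show ?thesis .
  qed
  then have "norm (neg_binom (s - 1) (Suc k)) * (1 / q ^ Suc k) \<le> neg_binom R (Suc k) * (4 / 3) ^ Suc k"
    using norm_neg_binom_le[OF s] neg_binom_nonneg[OF R] q by (intro mult_mono) auto
  moreover have "norm (telescope_coeff q s k) = norm (neg_binom (s - 1) (Suc k)) * (1 / q ^ Suc k)"
    using q unfolding telescope_coeff_def norm_mult norm_divide norm_of_real norm_power by simp
  ultimately show ?thesis unfolding coeff_major_def by (intro mult_right_mono) auto
qed

lemma choose_power_le:
  assumes "0 \<le> e" "e \<le> 1 / 4"
  shows "real (k choose j) * e ^ (k - j) \<le> 4 ^ j * (1 / 2) ^ k"
proof (cases "j \<le> k")
  case True
  have "real (k choose j) * (1 / 4) ^ j * e ^ (k - j) \<le>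
          (\<Sum>j\<le>k. real (k choose j) * (1 / 4) ^ j * e ^ (k - j))"
    by (rule member_le_sum) (use True assms in auto)
  also have "\<dots> = (1 / 4 + e) ^ k" by (simp add: binomial_ring)
  also have "\<dots> \<le> (1 / 2) ^ k" using assms by (intro power_mono) auto
  finally have "4 ^ j * (real (k choose j) * (1 / 4) ^ j * e ^ (k - j)) \<le> 4 ^ j * (1 / 2) ^ k"
    by (intro mult_left_mono) auto
  moreover have "(4::real) ^ j * (1 / 4) ^ j = 1"
    unfolding power_mult_distrib[symmetric] by simp
  then have "4 ^ j * (real (k choose j) * (1 / 4) ^ j * e ^ (k - j)) = real (k choose j) * e ^ (k - j)"
    by (metis mult.assoc mult.left_commute mult.left_neutral)
  ultimately show ?thesis by simp
qed (simp add: binomial_eq_0)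

lemma norm_recentred_coeff_term_le:
  assumes q: "3 / 4 \<le> q" "q < 1" and s: "norm (s - 1) \<le> R"
  shows "norm (telescope_coeff q s k * of_real (of_nat (k choose j) * (1 - q) ^ (k - j))) \<le> 4 ^ j * coeff_major R k"
proof -
  have "norm (telescope_coeff q s k * of_real (of_nat (k choose j) * (1 - q) ^ (k - j))) =
          norm (telescope_coeff q s k) * (real (k choose j) * (1 - q) ^ (k - j))"
    using q unfolding norm_mult norm_of_real by simp
  also have "\<dots> \<le> norm (telescope_coeff q s k) * (4 ^ j * (1 / 2) ^ k)"
    using q by (intro mult_left_mono choose_power_le) auto
  also have "\<dots> = 4 ^ j * (norm (telescope_coeff q s k) * (1 / 2) ^ k)" by simp
  also have "\<dots> \<le> 4 ^ j * coeff_major R k"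
    using norm_telescope_coeff_le[OF q(1) s] by (intro mult_left_mono) auto
  finally show ?thesis .
qed

lemma recentred_coeff_sums:
  assumes q: "3 / 4 \<le> q" "q < 1"
  shows "(\<lambda>k. telescope_coeff q s k * of_real (of_nat (k choose j) * (1 - q) ^ (k - j))) sums recentred_coeff q s j"
proof -
  have "summable (\<lambda>k. 4 ^ j * coeff_major (norm (s - 1)) k)"
    by (intro summable_mult summable_coeff_major)
  then have "summable (\<lambda>k. telescope_coeff q s k * of_real (of_nat (k choose j) * (1 - q) ^ (k - j)))"
    by (rule summable_comparison_test'[of _ 0]) (rule norm_recentred_coeff_term_le[OF q order.refl])
  then show ?thesis unfolding recentred_coeff_def by (rule summable_sums)
qed

text \<open>
  Dropping from the expansion of \<open>(e + y)\<^sup>k\<close> the terms of degree less than \<open>K\<close> in \<open>y\<close> leaves a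
  factor \<open>(y / \<rho>)\<^sup>K\<close> against the value at \<open>y = \<rho>\<close>.  This bounds the tail of the recentred power series
  term by term, without interchanging the two summations.
\<close>

lemma binomial_tail_bounds:
  fixes e y \<rho> :: real
  assumes "0 \<le> e" "0 \<le> y" "y \<le> \<rho>" "0 < \<rho>"
  shows "\<bar>(e + y) ^ k - (\<Sum>j<K. real (k choose j) * e ^ (k - j) * y ^ j)\<bar> \<le> (y / \<rho>) ^ K * (e + \<rho>) ^ k"
proof -
  define t where "t = (\<lambda>z j. real (k choose j) * e ^ (k - j) * z ^ j)"
  have bin: "(e + z) ^ k = (\<Sum>j\<le>k. t z j)" for z
    by (subst add.commute) (simp add: binomial_ring t_def mult_ac)
  have "(\<Sum>j<K. t y j) = (\<Sum>j\<in>{..k} \<inter> {..<K}. t y j)"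
    by (rule sum.mono_neutral_right) (auto simp: t_def binomial_eq_0 not_le)
  moreover have "(\<Sum>j\<le>k. t y j) = (\<Sum>j\<in>{..k} \<inter> {..<K}. t y j) + (\<Sum>j\<in>{..k} - {..<K}. t y j)"
    by (metis finite_atMost sum.Int_Diff)
  ultimately have eq: "(e + y) ^ k - (\<Sum>j<K. t y j) = (\<Sum>j\<in>{..k} - {..<K}. t y j)"
    by (simp add: bin)
  have "0 \<le> (\<Sum>j\<in>{..k} - {..<K}. t y j)"
    using assms by (intro sum_nonneg) (simp add: t_def)
  moreover have "(\<Sum>j\<in>{..k} - {..<K}. t y j) \<le> (\<Sum>j\<in>{..k} - {..<K}. (y / \<rho>) ^ K * t \<rho> j)"
  proof (rule sum_mono)
    fix j assume "j \<in> {..k} - {..<K}"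
    then have "(y / \<rho>) ^ j \<le> (y / \<rho>) ^ K"
      using assms by (intro power_decreasing) auto
    then have "(y / \<rho>) ^ j * \<rho> ^ j \<le> (y / \<rho>) ^ K * \<rho> ^ j"
      using assms by (intro mult_right_mono) auto
    then have "y ^ j \<le> (y / \<rho>) ^ K * \<rho> ^ j"
      using assms by (simp add: power_divide)
    then have "(real (k choose j) * e ^ (k - j)) * y ^ j \<le> (real (k choose j) * e ^ (k - j)) * ((y / \<rho>) ^ K * \<rho> ^ j)"
      using assms by (intro mult_left_mono) auto
    then show "t y j \<le> (y / \<rho>) ^ K * t \<rho> j" by (simp add: t_def mult_ac)
  qed
  moreover have "(\<Sum>j\<in>{..k} - {..<K}. (y / \<rho>) ^ K * t \<rho> j) \<le> (\<Sum>j\<le>k. (y / \<rho>) ^ K * t \<rho> j)"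
    using assms by (intro sum_mono2) (auto simp: t_def)
  moreover have "(\<Sum>j\<le>k. (y / \<rho>) ^ K * t \<rho> j) = (y / \<rho>) ^ K * (e + \<rho>) ^ k"
    by (simp add: bin sum_distrib_left)
  ultimately show ?thesis using eq by (simp add: t_def)
qed

lemma telescope_coeff_sums:
  assumes q: "3 / 4 \<le> q" "q < 1" and w: "4 \<le> w"
  shows "(\<lambda>k. diag_term q w s * (telescope_coeff q s k * of_real ((1 - q + 1 / w) ^ k))) sums
           (qpow w (1 - s) - qpow ((w + 1) / q) (1 - s))"
proof -
  define v where "v = 1 - q + 1 / w"
  have y: "0 < 1 / w" "1 / w \<le> 1 / 4" using w by (auto simp: field_simps)
  have v: "0 < v" "v \<le> 1 / 2" using q y unfolding v_def by linarith+
  have vq: "v / q < 1" "v / q > 0" using v q by (auto simp: divide_less_eq)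
  have "(\<lambda>k. neg_binom (s - 1) k * (of_real (- v / q)) ^ k) sums (1 - of_real (- v / q)) powr (- (s - 1))"
  proof (rule neg_binom_sums)
    have "\<bar>- v / q\<bar> = v / q" using v q by simp
    then show "norm (of_real (- v / q) :: complex) < 1" unfolding norm_of_real using vq by simp
  qed
  also have "(1 - of_real (- v / q) :: complex) = of_real (1 + v / q)" by simp
  also have "of_real (1 + v / q) powr (- (s - 1)) = qpow (1 + v / q) (1 - s)"
    using vq by (subst powr_eq_qpow) auto
  finally have "(\<lambda>k. neg_binom (s - 1) (Suc k) * (of_real (- v / q)) ^ Suc k) sums (qpow (1 + v / q) (1 - s) - 1)"
    by (subst sums_Suc_iff) simp
  then have "(\<lambda>k. (- qpow w (1 - s)) * (neg_binom (s - 1) (Suc k) * (of_real (- v / q)) ^ Suc k)) sums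
      ((- qpow w (1 - s)) * (qpow (1 + v / q) (1 - s) - 1))"
    by (rule sums_mult)
  moreover have "(- qpow w (1 - s)) * (qpow (1 + v / q) (1 - s) - 1) = qpow w (1 - s) - qpow ((w + 1) / q) (1 - s)"
  proof -
    have "(w + 1) / q = w * (1 + v / q)" using q w by (simp add: v_def field_simps)
    then have "qpow ((w + 1) / q) (1 - s) = qpow w (1 - s) * qpow (1 + v / q) (1 - s)"
      using qpow_mult_base[of w "1 + v / q"] w vq by simp
    then show ?thesis by (simp add: algebra_simps)
  qed
  moreover have "(- qpow w (1 - s)) * (neg_binom (s - 1) (Suc k) * (of_real (- v / q)) ^ Suc k) =
      diag_term q w s * (telescope_coeff q s k * of_real (v ^ k))" for k
  proof -
    have "qpow w (1 - s) * of_real v = diag_term q w s"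
    proof -
      have "qpow w (1 - s) = of_real w * qpow w (- s)"
        using qpow_add[of w 1 "- s"] qpow_of_real[of w 1] w by simp
      moreover have "w * v = 1 + (1 - q) * w" using w by (simp add: v_def field_simps)
      ultimately show ?thesis
        unfolding diag_term_def by (metis mult.assoc mult.commute of_real_mult)
    qed
    moreover have "(of_real (- v / q) :: complex) ^ Suc k = - ((-1) ^ k * of_real v * of_real (v ^ k) / of_real (q ^ Suc k))"
      by (simp add: power_divide power_minus[of "of_real v / of_real q"])
    ultimately show ?thesis
      by (simp add: telescope_coeff_def flip: \<open>qpow w (1 - s) * of_real v = diag_term q w s\<close>)
  qed
  ultimately show ?thesis by (simp add: v_def)
qed

definition remainder :: "nat \<Rightarrow> real \<Rightarrow> real \<Rightarrow> complex \<Rightarrow> complex"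
  where "remainder K q w s = (qpow w (1 - s) - qpow ((w + 1) / q) (1 - s)) -
           (\<Sum>j<K. recentred_coeff q s j * diag_term q w (s + of_nat j))"

definition rem_const :: "nat \<Rightarrow> real \<Rightarrow> real"
  where "rem_const K R = 2 * 4 ^ K * suminf (coeff_major R)"

text \<open>
  The remainder is \<open>diag_term\<close> times the tail, of order \<open>w\<^sup>-\<^sup>K\<close>, of a power series in \<open>1 / w\<close>.  The bound
  is uniform in \<open>q\<close>; it uses \<open>\<rho> = 1 / 4\<close> in the preceding estimate, hence \<open>w \<ge> 4\<close>.
\<close>

lemma norm_remainder_le:
  assumes q: "3 / 4 \<le> q" "q < 1" and w: "4 \<le> w" and s: "norm (s - 1) \<le> R"
  shows "norm (remainder K q w s) \<le> rem_const K R * w powr (1 - (Re s + K))"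
proof -
  have R: "R \<ge> 0" using s norm_ge_zero order_trans by blast
  define y where "y = 1 / w"
  have y: "0 < y" "y \<le> 1 / 4" using w by (auto simp: y_def field_simps)
  have "(\<lambda>k. \<Sum>j<K. (telescope_coeff q s k * of_real (of_nat (k choose j) * (1 - q) ^ (k - j))) * diag_term q w (s + of_nat j))
      sums (\<Sum>j<K. recentred_coeff q s j * diag_term q w (s + of_nat j))"
    by (intro sums_sum sums_mult2 recentred_coeff_sums q)
  from sums_diff[OF telescope_coeff_sums[OF q w, of s] this]
  have sums: "(\<lambda>k. diag_term q w s * (telescope_coeff q s k * of_real ((1 - q + 1 / w) ^ k)) -
      (\<Sum>j<K. (telescope_coeff q s k * of_real (of_nat (k choose j) * (1 - q) ^ (k - j))) * diag_term q w (s + of_nat j)))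
      sums remainder K q w s" by (simp add: remainder_def)
  have "diag_term q w s * (telescope_coeff q s k * of_real ((1 - q + 1 / w) ^ k)) -
      (\<Sum>j<K. (telescope_coeff q s k * of_real (of_nat (k choose j) * (1 - q) ^ (k - j))) * diag_term q w (s + of_nat j)) =
      diag_term q w s * (telescope_coeff q s k *
        of_real ((1 - q + y) ^ k - (\<Sum>j<K. real (k choose j) * (1 - q) ^ (k - j) * y ^ j)))" for k
  proof -
    have "(\<Sum>j<K. (telescope_coeff q s k * of_real (of_nat (k choose j) * (1 - q) ^ (k - j))) * diag_term q w (s + of_nat j)) =
          diag_term q w s * (telescope_coeff q s k * of_real (\<Sum>j<K. real (k choose j) * (1 - q) ^ (k - j) * y ^ j))"
      unfolding of_real_sum sum_distrib_left
      by (intro sum.cong refl, subst diag_term_shift) (use w in \<open>simp_all add: y_def mult_ac\<close>)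
    then show ?thesis by (simp add: y_def right_diff_distrib)
  qed
  then have sums: "(\<lambda>k. diag_term q w s * (telescope_coeff q s k *
        of_real ((1 - q + y) ^ k - (\<Sum>j<K. real (k choose j) * (1 - q) ^ (k - j) * y ^ j)))) sums remainder K q w s"
    using sums by simp
  have le: "norm (diag_term q w s * (telescope_coeff q s k *
        of_real ((1 - q + y) ^ k - (\<Sum>j<K. real (k choose j) * (1 - q) ^ (k - j) * y ^ j))))
        \<le> (norm (diag_term q w s) * (4 * y) ^ K) * coeff_major R k" for k
  proof -
    have "\<bar>(1 - q + y) ^ k - (\<Sum>j<K. real (k choose j) * (1 - q) ^ (k - j) * y ^ j)\<bar>
            \<le> (y / (1 / 4)) ^ K * (1 - q + 1 / 4) ^ k"
      by (rule binomial_tail_bounds) (use q y in auto)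
    also have "\<dots> \<le> (y / (1 / 4)) ^ K * (1 / 2) ^ k"
      using q y by (intro mult_left_mono power_mono) auto
    finally have "norm (telescope_coeff q s k) * \<bar>(1 - q + y) ^ k - (\<Sum>j<K. real (k choose j) * (1 - q) ^ (k - j) * y ^ j)\<bar>
        \<le> norm (telescope_coeff q s k) * ((4 * y) ^ K * (1 / 2) ^ k)"
      by (intro mult_left_mono) (auto simp: mult.commute)
    also have "\<dots> = (4 * y) ^ K * (norm (telescope_coeff q s k) * (1 / 2) ^ k)" by simp
    also have "\<dots> \<le> (4 * y) ^ K * coeff_major R k"
      using norm_telescope_coeff_le[OF q(1) s] y by (intro mult_left_mono) auto
    finally show ?thesis unfolding norm_mult norm_of_real mult.assoc by (intro mult_left_mono) auto
  qed
  have "norm (remainder K q w s) \<le> (\<Sum>k. (norm (diag_term q w s) * (4 * y) ^ K) * coeff_major R k)"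
    unfolding sums_unique[OF sums]
    by (rule norm_suminf_le[OF le]) (intro summable_mult summable_coeff_major)
  also have "\<dots> = (norm (diag_term q w s) * (4 * y) ^ K) * suminf (coeff_major R)"
    by (rule suminf_mult[OF summable_coeff_major])
  also have "\<dots> \<le> ((2 * w powr (1 - Re s)) * (4 * y) ^ K) * suminf (coeff_major R)"
    using norm_diag_term_le[of q w s] q w y
    by (intro mult_right_mono suminf_nonneg summable_coeff_major coeff_major_nonneg R) auto
  also have "\<dots> = rem_const K R * (w powr (1 - Re s) * y ^ K)"
    by (simp add: rem_const_def power_mult_distrib)
  also have "w powr (1 - Re s) * y ^ K = w powr (1 - (Re s + K))"
  proof -
    have "w powr (1 - (Re s + K)) = w powr ((1 - Re s) - real K)" by (simp add: algebra_simps)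
    also have "\<dots> = w powr (1 - Re s) / w ^ K" using w by (simp add: powr_diff powr_realpow)
    finally show ?thesis by (simp add: y_def power_divide)
  qed
  finally show ?thesis .
qed

lemma rem_const_nonneg: "R \<ge> 0 \<Longrightarrow> rem_const K R \<ge> 0"
  by (auto simp: rem_const_def intro!: mult_nonneg_nonneg suminf_nonneg summable_coeff_major coeff_major_nonneg)

section \<open>Joint limits in \<open>q\<close> and \<open>s\<close>\<close>

text \<open>
  A limit along this filter is a limit as \<open>q\<close> tends to \<open>1\<close> that is locally uniform in \<open>s\<close>, and the
  usual limit rules apply to it.
\<close>

definition qs_filter :: "complex \<Rightarrow> (real \<times> complex) filter"
  where "qs_filter s0 = at_left 1 \<times>\<^sub>F nhds s0"

lemma qs_filter_neq_bot [simp]: "qs_filter s0 \<noteq> bot"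
  by (simp add: qs_filter_def prod_filter_eq_bot)

lemma tendsto_fst_qs [tendsto_intros]: "(fst \<longlongrightarrow> 1) (qs_filter s0)"
  unfolding qs_filter_def by (rule filterlim_compose[OF tendsto_ident_at filterlim_fst])

lemma tendsto_snd_qs [tendsto_intros]: "(snd \<longlongrightarrow> s0) (qs_filter s0)"
  unfolding qs_filter_def by (rule filterlim_snd)

lemma eventually_qs:
  assumes "open U" "s0 \<in> U" "e > 0"
  shows "\<forall>\<^sub>F p in qs_filter s0. 3 / 4 \<le> fst p \<and> fst p < 1 \<and> c * (- ln (fst p)) < e \<and> snd p \<in> U"
proof -
  have "\<forall>\<^sub>F q in at_left 1. q \<in> {3/4<..<1::real}" by (rule eventually_at_left_real) simp
  then have "\<forall>\<^sub>F q in at_left 1. 3 / 4 \<le> q \<and> q < 1 \<and> c * (- ln q) < e"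
    using eventually_small_log[OF assms(3), of c] by eventually_elim auto
  moreover have "\<forall>\<^sub>F s in nhds s0. s \<in> U" by (rule eventually_nhds_in_open) (use assms in auto)
  ultimately show ?thesis
    unfolding qs_filter_def using eventually_prodI by (fastforce elim: eventually_mono)
qed

lemma tendsto_qs_shift:
  assumes "((\<lambda>p. f (fst p) (snd p)) \<longlongrightarrow> L) (qs_filter (s0 + c))"
  shows "((\<lambda>p. f (fst p) (snd p + c)) \<longlongrightarrow> L) (qs_filter s0)"
proof -
  have "filterlim (\<lambda>p. (fst p, snd p + c)) (qs_filter (s0 + c)) (qs_filter s0)"
    unfolding qs_filter_def
    by (intro filterlim_Pair filterlim_fst) 
       (intro tendsto_add tendsto_const filterlim_snd)
  from filterlim_compose[OF assms this] show ?thesis by simp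
qed

lemma tendsto_qs_pointwise:
  assumes "((\<lambda>p. f (fst p) (snd p)) \<longlongrightarrow> L) (qs_filter s)"
  shows "((\<lambda>q. f q s) \<longlongrightarrow> L) (at_left 1)"
proof -
  have "filterlim (\<lambda>q. (q, s)) (qs_filter s) (at_left 1)"
    unfolding qs_filter_def by (intro filterlim_Pair filterlim_ident tendsto_const)
  from filterlim_compose[OF assms this] show ?thesis by simp
qed

lemma tendsto_qpow [tendsto_intros]:
  assumes "(f \<longlongrightarrow> w) F" "(g \<longlongrightarrow> z) F" "w > 0"
  shows "((\<lambda>p. qpow (f p) (g p)) \<longlongrightarrow> qpow w z) F"
  unfolding qpow_def by (intro tendsto_intros assms) (use assms in auto)

lemma tendsto_neg_binom [tendsto_intros]:
  fixes f :: "'a \<Rightarrow> complex"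
  shows "(f \<longlongrightarrow> z) F \<Longrightarrow> ((\<lambda>p. neg_binom (f p) k) \<longlongrightarrow> neg_binom z k) F"
  unfolding neg_binom_def pochhammer_prod by (intro tendsto_intros) auto

lemma tendsto_qW_left: "((\<lambda>q. qW q x) \<longlongrightarrow> x) (at_left 1)"
proof -
  have pos: "\<forall>\<^sub>F q in at_left 1. q \<in> {0<..<1::real}" by (rule eventually_at_left_real) simp
  have "((\<lambda>q. - Re ((1 - qpow q (of_real (- x))) / of_real (1 - q))) \<longlongrightarrow> - Re (of_real (- x))) (at_left 1)"
    by (intro tendsto_intros tendsto_qpow_quotient_left)
  then have lim: "((\<lambda>q. - Re ((1 - qpow q (of_real (- x))) / of_real (1 - q))) \<longlongrightarrow> x) (at_left 1)"
    by simp
  have "\<forall>\<^sub>F q in at_left 1. - Re ((1 - qpow q (of_real (- x))) / of_real (1 - q)) = qW q x"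
    using pos
  proof eventually_elim
    case (elim q)
    have "(1 - qpow q (of_real (- x))) / of_real (1 - q) = of_real ((1 - q powr (- x)) / (1 - q))"
      using elim by (subst qpow_of_real) auto
    then have "- Re ((1 - qpow q (of_real (- x))) / of_real (1 - q)) = - ((1 - q powr (- x)) / (1 - q))"
      by (simp only: Re_complex_of_real)
    also have "\<dots> = qW q x" by (simp add: qW_def minus_divide_left)
    finally show ?case .
  qed
  from Lim_transform_eventually[OF lim this] show ?thesis .
qed

lemma tendsto_qW: "((\<lambda>p. qW (fst p) x) \<longlongrightarrow> x) (qs_filter s0)"
  unfolding qs_filter_def by (rule filterlim_compose[OF tendsto_qW_left filterlim_fst])

lemma tendsto_diag_term [tendsto_intros]:
  assumes "(f \<longlongrightarrow> w) (qs_filter s0)" "(g \<longlongrightarrow> z) (qs_filter s0)" "w > 0"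
  shows "((\<lambda>p. diag_term (fst p) (f p) (g p)) \<longlongrightarrow> qpow w (- z)) (qs_filter s0)"
proof -
  have "((\<lambda>p. diag_term (fst p) (f p) (g p)) \<longlongrightarrow> qpow w (- z) * of_real (1 + (1 - 1) * w)) (qs_filter s0)"
    unfolding diag_term_def by (intro tendsto_intros assms)
  then show ?thesis by simp
qed

lemma tendsto_recentred_coeff:
  "((\<lambda>p. recentred_coeff (fst p) (snd p) j) \<longlongrightarrow>
     (\<Sum>k. telescope_coeff 1 s0 k * of_real (of_nat (k choose j) * 0 ^ (k - j)))) (qs_filter s0)"
  unfolding recentred_coeff_def
proof (rule tannerys_theorem[THEN conjunct2, THEN conjunct2])
  define R where "R = norm (s0 - 1) + 1"
  show "summable (\<lambda>k. 4 ^ j * coeff_major R k)" by (intro summable_mult summable_coeff_major)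
  show "((\<lambda>p. telescope_coeff (fst p) (snd p) k * of_real (of_nat (k choose j) * (1 - fst p) ^ (k - j))) \<longlongrightarrow>
          telescope_coeff 1 s0 k * of_real (of_nat (k choose j) * 0 ^ (k - j))) (qs_filter s0)" for k
  proof -
    have "((\<lambda>p. telescope_coeff (fst p) (snd p) k * of_real (of_nat (k choose j) * (1 - fst p) ^ (k - j))) \<longlongrightarrow>
          telescope_coeff 1 s0 k * of_real (of_nat (k choose j) * (1 - 1) ^ (k - j))) (qs_filter s0)"
      unfolding telescope_coeff_def by (intro tendsto_intros) auto
    then show ?thesis by simp
  qed
  have "\<forall>\<^sub>F p in qs_filter s0. 3 / 4 \<le> fst p \<and> fst p < 1 \<and> 0 * (- ln (fst p)) < (1::real) \<and> snd p \<in> ball s0 1"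
    by (rule eventually_qs) auto
  then have "\<forall>\<^sub>F p in qs_filter s0. \<forall>k. norm (telescope_coeff (fst p) (snd p) k *
       of_real (of_nat (k choose j) * (1 - fst p) ^ (k - j))) \<le> 4 ^ j * coeff_major R k"
  proof eventually_elim
    case (elim p)
    have "norm (snd p - 1) \<le> norm (snd p - s0) + norm (s0 - 1)"
      using norm_triangle_ineq[of "snd p - s0" "s0 - 1"] by simp
    then have "norm (snd p - 1) \<le> R" using elim by (simp add: R_def dist_norm norm_minus_commute)
    then show ?case using elim norm_recentred_coeff_term_le[of "fst p" "snd p" R _ j] by blast
  qed
  then show "\<forall>\<^sub>F (k, p) in at_top \<times>\<^sub>F qs_filter s0. norm (telescope_coeff (fst p) (snd p) k *
       of_real (of_nat (k choose j) * (1 - fst p) ^ (k - j))) \<le> 4 ^ j * coeff_major R k"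
    unfolding eventually_prod_filter using eventually_True by blast
qed simp

text \<open>
  In the limit only \<open>k = 0\<close> contributes, since the other terms contain a power of \<open>1 - q\<close>.
\<close>

lemma tendsto_recentred_coeff_0: "((\<lambda>p. recentred_coeff (fst p) (snd p) 0) \<longlongrightarrow> s0 - 1) (qs_filter s0)"
proof -
  have "(\<Sum>k. telescope_coeff 1 s0 k * of_real (of_nat (k choose 0) * 0 ^ (k - 0))) = (\<Sum>k. telescope_coeff 1 s0 k * 0 ^ k)"
    by (intro suminf_cong) (simp add: of_real_power)
  also have "\<dots> = telescope_coeff 1 s0 0" by (rule powser_zero)
  also have "\<dots> = s0 - 1" by (simp add: telescope_coeff_def neg_binom_def)
  finally show ?thesis using tendsto_recentred_coeff[of 0 s0] by simp
qed

lemma powr_le_majorant: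
  assumes "real n + b \<le> w" "1 \<le> b" "0 < \<delta>" "e \<le> - (1 + \<delta>)"
  shows "w powr e \<le> real (Suc n) powr (- (1 + \<delta>))"
proof -
  have "w powr e \<le> real (Suc n) powr e"
    using assms by (intro powr_mono2') auto
  also have "\<dots> \<le> real (Suc n) powr (- (1 + \<delta>))"
    using assms by (intro powr_mono) auto
  finally show ?thesis .
qed

lemma summable_majorant: "\<delta> > 0 \<Longrightarrow> summable (\<lambda>n. real (Suc n) powr (- (1 + \<delta>)))"
  by (subst summable_Suc_iff) (simp add: summable_real_powr_iff)

text \<open>
  \<open>W(x) \<ge> x\<close> gives a majorant of the series that does not depend on \<open>q\<close>.  The factor
  \<open>1 + (1 - q) W \<le> 2 W\<close> costs one power of \<open>W\<close>, hence the bound \<open>2\<close> for \<open>Re s\<close> instead of \<open>1\<close>.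
\<close>

lemma tendsto_gq_explicit_right:
  assumes b: "1 \<le> b" and s0: "2 < Re s0"
  shows "summable (\<lambda>n. norm (qpow (real n + b) (- s0)))"
    "((\<lambda>p. gq_explicit (fst p) b (snd p, snd p - 1)) \<longlongrightarrow> (\<Sum>n. qpow (real n + b) (- s0))) (qs_filter s0)"
proof -
  define \<delta> where "\<delta> = (Re s0 - 2) / 2"
  have \<delta>: "\<delta> > 0" using s0 by (simp add: \<delta>_def)
  have ev: "\<forall>\<^sub>F p in qs_filter s0. 3 / 4 \<le> fst p \<and> fst p < 1 \<and> 0 * (- ln (fst p)) < (1::real) \<and>
              snd p \<in> {s. Re s > 2 + \<delta>}"
  proof (rule eventually_qs)
    show "s0 \<in> {s. Re s > 2 + \<delta>}" using s0 by (simp add: \<delta>_def field_simps)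
  qed (auto intro: open_halfspace_Re_gt)
  have bound: "norm (diag_term q (qW q (real n + b)) s) \<le> 2 * real (Suc n) powr (- (1 + \<delta>))"
    if "3 / 4 \<le> q" "q < 1" "Re s > 2 + \<delta>" for q s n
  proof -
    have w: "real n + b \<le> qW q (real n + b)" using that b by (intro qW_ge) auto
    then have "1 \<le> qW q (real n + b)" using b by linarith
    then have "norm (diag_term q (qW q (real n + b)) s) \<le> 2 * qW q (real n + b) powr (1 - Re s)"
      using that by (intro norm_diag_term_le) auto
    also have "\<dots> \<le> 2 * real (Suc n) powr (- (1 + \<delta>))"
      by (intro mult_left_mono powr_le_majorant[OF w b \<delta>]) (use that in auto)
    finally show ?thesis .
  qed
  have tan: "eventually (\<lambda>p. summable (\<lambda>n. norm (diag_term (fst p) (qW (fst p) (real n + b)) (snd p)))) (qs_filter s0) \<and>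
     summable (\<lambda>n. norm (qpow (real n + b) (- s0))) \<and>
     ((\<lambda>p. \<Sum>n. diag_term (fst p) (qW (fst p) (real n + b)) (snd p)) \<longlongrightarrow> (\<Sum>n. qpow (real n + b) (- s0))) (qs_filter s0)"
  proof (rule tannerys_theorem)
    show "((\<lambda>p. diag_term (fst p) (qW (fst p) (real n + b)) (snd p)) \<longlongrightarrow> qpow (real n + b) (- s0)) (qs_filter s0)" for n
      by (intro tendsto_intros tendsto_qW) (use b in auto)
    show "summable (\<lambda>n. 2 * real (Suc n) powr (- (1 + \<delta>)))"
      by (intro summable_mult summable_majorant \<delta>)
    have "\<forall>\<^sub>F p in qs_filter s0. \<forall>n. norm (diag_term (fst p) (qW (fst p) (real n + b)) (snd p)) \<le> 2 * real (Suc n) powr (- (1 + \<delta>))"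
      using ev by eventually_elim (use bound in auto)
    then show "\<forall>\<^sub>F (n, p) in at_top \<times>\<^sub>F qs_filter s0.
       norm (diag_term (fst p) (qW (fst p) (real n + b)) (snd p)) \<le> 2 * real (Suc n) powr (- (1 + \<delta>))"
      unfolding eventually_prod_filter using eventually_True by blast
  qed simp
  then show "summable (\<lambda>n. norm (qpow (real n + b) (- s0)))" by blast
  have "\<forall>\<^sub>F p in qs_filter s0. (\<Sum>n. diag_term (fst p) (qW (fst p) (real n + b)) (snd p)) =
           gq_explicit (fst p) b (snd p, snd p - 1)"
    using ev
  proof eventually_elim
    case (elim p)
    have "(\<lambda>n. gq_summand (fst p) (real n + b) (snd p) (snd p - 1)) sums gq_explicit (fst p) b (snd p, snd p - 1)"
      by (rule gq_explicit_sums) (use elim b \<delta> in auto)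
    moreover have "gq_summand (fst p) (real n + b) (snd p) (snd p - 1) =
        diag_term (fst p) (qW (fst p) (real n + b)) (snd p)" for n
      by (rule gq_summand_diag) (use elim b in auto)
    ultimately show ?case by (simp add: sums_iff)
  qed
  from Lim_transform_eventually[OF tan[THEN conjunct2, THEN conjunct2] this]
  show "((\<lambda>p. gq_explicit (fst p) b (snd p, snd p - 1)) \<longlongrightarrow> (\<Sum>n. qpow (real n + b) (- s0))) (qs_filter s0)" .
qed

section \<open>The recurrence\<close>

text \<open>
  Sum the definition of \<^const>\<open>remainder\<close> over \<open>w = W(n + b)\<close>: the differences telescope because
  \<open>W(x + 1) = (W(x) + 1) / q\<close>, and each \<open>diag_term\<close> at \<open>s + j\<close> sums to the value of \<open>g\<^sub>q\<close> there.
\<close>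

lemma diag_recurrence_right:
  assumes q: "3 / 4 \<le> q" "q < 1" and b: "4 \<le> b" and s: "2 < Re s"
  shows "(\<lambda>n. remainder K q (qW q (real n + b)) s) sums
     (qpow (qW q b) (1 - s) - (\<Sum>j<K. recentred_coeff q s j * gq_explicit q b (s + of_nat j, s + of_nat j - 1)))"
proof -
  have q0: "0 < q" "q < 1" using q by auto
  define f where "f = (\<lambda>n. qpow (qW q (real n + b)) (1 - s))"
  have w: "real n + b \<le> qW q (real n + b)" for n using q0 b by (intro qW_ge) auto
  have "f \<longlonglongrightarrow> 0"
  proof (rule Lim_null_comparison)
    have "norm (f n) \<le> real (Suc n) powr (- (1 + 0)) * 1" for n
    proof -
      have "qW q (real n + b) > 0" using w[of n] b by linarith
      then have "norm (f n) = qW q (real n + b) powr (1 - Re s)" by (simp add: f_def norm_qpow)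
      also have "\<dots> \<le> real (Suc n) powr (1 - Re s)"
        using w[of n] b s by (intro powr_mono2') auto
      also have "\<dots> \<le> real (Suc n) powr (- 1)" using s by (intro powr_mono) auto
      finally show ?thesis by simp
    qed
    then show "\<forall>\<^sub>F n in sequentially. norm (f n) \<le> real (Suc n) powr (- (1 + 0)) * 1" by simp
    have "(\<lambda>n. real n powr (-1)) \<longlonglongrightarrow> 0"
      by (intro tendsto_neg_powr filterlim_real_sequentially) auto
    then show "(\<lambda>n. real (Suc n) powr (- (1 + 0)) * 1) \<longlonglongrightarrow> 0"
      using LIMSEQ_Suc by fastforce
  qed
  then have "(\<lambda>n. f n - f (Suc n)) sums (f 0 - 0)" by (rule telescope_sums')
  moreover have "f (Suc n) = qpow ((qW q (real n + b) + 1) / q) (1 - s)" for n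
    using qW_plus_1[OF q0, of "real n + b"] by (simp add: f_def add_ac)
  ultimately have tel: "(\<lambda>n. qpow (qW q (real n + b)) (1 - s) - qpow ((qW q (real n + b) + 1) / q) (1 - s))
        sums qpow (qW q b) (1 - s)"
    by (simp add: f_def)
  have "(\<lambda>n. diag_term q (qW q (real n + b)) (s + of_nat j)) sums gq_explicit q b (s + of_nat j, s + of_nat j - 1)" for j
  proof -
    have "(\<lambda>n. gq_summand q (real n + b) (s + of_nat j) (s + of_nat j - 1)) sums gq_explicit q b (s + of_nat j, s + of_nat j - 1)"
      by (rule gq_explicit_sums) (use q0 b s in auto)
    moreover have "gq_summand q (real n + b) (s + of_nat j) (s + of_nat j - 1) =
        diag_term q (qW q (real n + b)) (s + of_nat j)" for n
      by (rule gq_summand_diag) (use q0 b in auto)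
    ultimately show ?thesis by simp
  qed
  then show ?thesis
    unfolding remainder_def by (intro sums_diff tel sums_sum sums_mult)
qed

lemma holomorphic_recentred_coeff:
  assumes q: "3 / 4 \<le> q" "q < 1"
  shows "(\<lambda>s. recentred_coeff q s j) holomorphic_on UNIV"
  unfolding recentred_coeff_def
proof (rule holomorphic_on_suminf_locally_dominated)
  show "(\<lambda>s. telescope_coeff q s k * of_real (of_nat (k choose j) * (1 - q) ^ (k - j))) holomorphic_on UNIV" for k
    unfolding telescope_coeff_def by (intro holomorphic_intros) (use q in auto)
  fix z :: complex
  have "norm (telescope_coeff q w k * of_real (of_nat (k choose j) * (1 - q) ^ (k - j))) \<le> 4 ^ j * coeff_major (norm (z - 1) + 1) k"
    if "w \<in> ball z 1" for w k
  proof (rule norm_recentred_coeff_term_le[OF q])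
    show "norm (w - 1) \<le> norm (z - 1) + 1"
      using norm_triangle_ineq[of "w - z" "z - 1"] that by (simp add: dist_norm norm_minus_commute)
  qed
  then show "\<exists>V M. open V \<and> z \<in> V \<and> summable M \<and> (\<forall>k. \<forall>w\<in>V \<inter> UNIV.
      norm (telescope_coeff q w k * of_real (of_nat (k choose j) * (1 - q) ^ (k - j))) \<le> M k)"
    by (intro exI[of _ "ball z 1"] exI[of _ "\<lambda>k. 4 ^ j * coeff_major (norm (z - 1) + 1) k"] conjI
          summable_mult summable_coeff_major) auto
qed auto

lemma norm_remainder_le_majorant:
  assumes q: "3 / 4 \<le> q" "q < 1" and b: "4 \<le> b" and s: "norm (s - 1) \<le> R"
    and \<delta>: "0 < \<delta>" "2 + \<delta> \<le> Re s + K"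
  shows "norm (remainder K q (qW q (real n + b)) s) \<le> rem_const K R * real (Suc n) powr (- (1 + \<delta>))"
proof -
  have R: "R \<ge> 0" using s norm_ge_zero order_trans by blast
  have w: "real n + b \<le> qW q (real n + b)" using q b by (intro qW_ge) auto
  then have "4 \<le> qW q (real n + b)" using b by linarith
  then have "norm (remainder K q (qW q (real n + b)) s) \<le> rem_const K R * qW q (real n + b) powr (1 - (Re s + K))"
    by (rule norm_remainder_le[OF q _ s])
  also have "\<dots> \<le> rem_const K R * real (Suc n) powr (- (1 + \<delta>))"
    by (intro mult_left_mono rem_const_nonneg R powr_le_majorant[OF w _ \<delta>(1)]) (use b \<delta> in auto)
  finally show ?thesis .
qed

lemma holomorphic_remainder_sum:
  assumes q: "3 / 4 \<le> q" "q < 1" and b: "4 \<le> b"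
  shows "(\<lambda>s. \<Sum>n. remainder K q (qW q (real n + b)) s) holomorphic_on {s. Re s > 2 - real K}"
proof (rule holomorphic_on_suminf_locally_dominated)
  show "open {s. Re s > 2 - real K}" by (rule open_halfspace_Re_gt)
  have w: "0 < qW q (real n + b)" for n using qW_ge[of q "real n + b"] q b by linarith
  show "(\<lambda>s. remainder K q (qW q (real n + b)) s) holomorphic_on {s. Re s > 2 - real K}" for n
    unfolding remainder_def diag_term_def
    by (intro holomorphic_intros holomorphic_on_subset[OF holomorphic_recentred_coeff[OF q]]) auto
  fix z assume z: "z \<in> {s. Re s > 2 - real K}"
  define \<delta> where "\<delta> = (Re z + K - 2) / 2"
  have \<delta>: "\<delta> > 0" using z by (simp add: \<delta>_def)
  define R where "R = norm (z - 1) + 1"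
  define V where "V = ball z 1 \<inter> {s. Re s > 2 + \<delta> - K}"
  have "open V" unfolding V_def by (intro open_Int open_ball open_halfspace_Re_gt)
  moreover have "z \<in> V" using \<delta> by (simp add: V_def \<delta>_def field_simps)
  moreover have "summable (\<lambda>n. rem_const K R * real (Suc n) powr (- (1 + \<delta>)))"
    by (intro summable_mult summable_majorant \<delta>)
  moreover have "norm (remainder K q (qW q (real n + b)) s) \<le> rem_const K R * real (Suc n) powr (- (1 + \<delta>))"
    if "s \<in> V" for n s
  proof (rule norm_remainder_le_majorant[OF q b _ \<delta>])
    show "norm (s - 1) \<le> R"
      using norm_triangle_ineq[of "s - z" "z - 1"] that by (simp add: V_def R_def dist_norm norm_minus_commute)
    show "2 + \<delta> \<le> Re s + K" using that by (simp add: V_def)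
  qed
  ultimately show "\<exists>V M. open V \<and> z \<in> V \<and> summable M \<and>
      (\<forall>n. \<forall>s\<in>V \<inter> {s. Re s > 2 - real K}. norm (remainder K q (qW q (real n + b)) s) \<le> M n)"
    by (metis IntE)
qed

lemma holomorphic_gq_explicit_curve:
  assumes q: "0 < q" "q < 1" and a: "a > 0" and S: "open S"
    and f: "f holomorphic_on S" and g: "g holomorphic_on S" and np: "\<And>s. s \<in> S \<Longrightarrow> \<not> polar q (g s)"
  shows "(\<lambda>s. gq_explicit q a (f s, g s)) holomorphic_on S"
  by (rule holomorphic2_on_compose_curve[OF holomorphic2_on_gq_explicit[OF q a] f g S]) (use np in auto)

lemma nonpolar_nonint:
  assumes "0 < q" "q < 1" "\<bar>Im s\<bar> * (- ln q) < 2 * pi" "s \<notin> \<int>"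
  shows "\<not> polar q (s + of_int k)"
proof (rule nonpolarI[OF assms(1,2)])
  show "\<bar>Im (s + of_int k)\<bar> * (- ln q) < 2 * pi" using assms by simp
  show "s + of_int k \<notin> \<int>\<^sub>\<le>\<^sub>0"
  proof
    assume "s + of_int k \<in> \<int>\<^sub>\<le>\<^sub>0"
    then have "s + of_int k - of_int k \<in> \<int>" by (rule Ints_diff[OF nonpos_Ints_Int Ints_of_int])
    then show False using assms(4) by simp
  qed
qed

text \<open>
  For fixed \<open>q\<close> the poles nearest to the real axis are integers.  So both sides are holomorphic in a
  half-strip \<open>Re s > 2 - K\<close> around the real axis without the integers, and the recurrence continues from
  \<open>Re s > 2\<close> to this connected set.
\<close>

lemma diag_recurrence:
  assumes q: "3 / 4 \<le> q" "q < 1" and b: "4 \<le> b" and s: "2 - real K < Re s"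
    and nint: "s \<notin> \<int>" and im: "\<bar>Im s\<bar> * (- ln q) < 2 * pi"
  shows "(\<Sum>n. remainder K q (qW q (real n + b)) s) =
     qpow (qW q b) (1 - s) - (\<Sum>j<K. recentred_coeff q s j * gq_explicit q b (s + of_nat j, s + of_nat j - 1))"
proof -
  have q0: "0 < q" "q < 1" and lnq: "- ln q > 0" using q by auto
  define c where "c = 2 * pi / (- ln q)"
  have c: "c > 0" using lnq by (simp add: c_def divide_pos_neg)
  have imc: "\<bar>Im z\<bar> * (- ln q) < 2 * pi \<longleftrightarrow> \<bar>Im z\<bar> < c" for z
    unfolding c_def by (subst pos_less_divide_eq[OF lnq]) simp
  define A where "A = {z. Re z > 2 - real K} \<inter> {z. Im z < c} \<inter> {z. Im z > - c}"
  define \<Omega> where "\<Omega> = A - \<int>"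
  have A: "open A" unfolding A_def
    by (intro open_Int open_halfspace_Re_gt open_halfspace_Im_lt open_halfspace_Im_gt)
  have conA: "convex A" unfolding A_def
    by (intro convex_Int convex_halfspace_Re_gt convex_halfspace_Im_lt convex_halfspace_Im_gt)
  have \<Omega>: "open \<Omega>" unfolding \<Omega>_def by (intro open_Diff A closed_Ints)
  have "countable (\<int> :: complex set)" unfolding Ints_def by simp
  then have con: "connected \<Omega>" unfolding \<Omega>_def
    by (intro connected_open_diff_countable A convex_connected conA) simp_all
  have np: "\<not> polar q (z + of_int k)" if "z \<in> \<Omega>" for z k
    by (rule nonpolar_nonint[OF q0 imc[THEN iffD2]]) (use that in \<open>auto simp: \<Omega>_def A_def\<close>)
  have "(\<lambda>z. gq_explicit q b (z + of_nat j, z + of_nat j - 1)) holomorphic_on \<Omega>" for j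
  proof (rule holomorphic_gq_explicit_curve[OF q0 _ \<Omega>])
    show "\<not> polar q (z + of_nat j - 1)" if "z \<in> \<Omega>" for z
      using np[OF that, of "int j - 1"] by (simp add: algebra_simps)
  qed (use b in \<open>auto intro!: holomorphic_intros\<close>)
  then have hol: "(\<lambda>z. qpow (qW q b) (1 - z) - (\<Sum>j<K. recentred_coeff q z j * gq_explicit q b (z + of_nat j, z + of_nat j - 1)))
      holomorphic_on \<Omega>"
    by (intro holomorphic_intros holomorphic_on_subset[OF holomorphic_recentred_coeff[OF q]]) auto
  define O1 where "O1 = \<Omega> \<inter> {z. Re z > 2}"
  show ?thesis
  proof (rule analytic_continuation_open[of O1 \<Omega> "\<lambda>s. \<Sum>n. remainder K q (qW q (real n + b)) s"
        "\<lambda>z. qpow (qW q b) (1 - z) - (\<Sum>j<K. recentred_coeff q z j * gq_explicit q b (z + of_nat j, z + of_nat j - 1))" s])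
    show "open O1" unfolding O1_def by (intro open_Int \<Omega> open_halfspace_Re_gt)
    have "Complex 3 (c / 2) \<notin> \<int>"
    proof
      assume "Complex 3 (c / 2) \<in> \<int>"
      then obtain k where "Complex 3 (c / 2) = of_int k" by (auto elim: Ints_cases)
      then have "Im (Complex 3 (c / 2)) = Im (of_int k :: complex)" by simp
      then show False using c by simp
    qed
    then have "Complex 3 (c / 2) \<in> O1" using c by (simp add: O1_def \<Omega>_def A_def)
    then show "O1 \<noteq> {}" by blast
    show "(\<lambda>s. \<Sum>n. remainder K q (qW q (real n + b)) s) holomorphic_on \<Omega>"
      by (rule holomorphic_on_subset[OF holomorphic_remainder_sum[OF q b]]) (auto simp: \<Omega>_def A_def)
    show "s \<in> \<Omega>" using s nint imc[THEN iffD1, OF im] by (auto simp: \<Omega>_def A_def)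
    show "(\<Sum>n. remainder K q (qW q (real n + b)) z) =
       qpow (qW q b) (1 - z) - (\<Sum>j<K. recentred_coeff q z j * gq_explicit q b (z + of_nat j, z + of_nat j - 1))"
      if "z \<in> O1" for z
      using diag_recurrence_right[OF q b, of z K] that by (simp add: O1_def sums_iff)
  qed (use \<Omega> con hol in \<open>auto simp: O1_def\<close>)
qed

lemma tendsto_remainder:
  assumes x: "4 \<le> x"
  shows "\<exists>L. ((\<lambda>p. remainder K (fst p) (qW (fst p) x) (snd p)) \<longlongrightarrow> L) (qs_filter s0)"
proof -
  have "((\<lambda>p. remainder K (fst p) (qW (fst p) x) (snd p)) \<longlongrightarrow>
     qpow x (1 - s0) - qpow ((x + 1) / 1) (1 - s0) -
     (\<Sum>j<K. (\<Sum>k. telescope_coeff 1 s0 k * of_real (of_nat (k choose j) * 0 ^ (k - j))) * qpow x (- (s0 + of_nat j)))) (qs_filter s0)"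
    unfolding remainder_def
    by (intro tendsto_diff tendsto_qpow tendsto_sum tendsto_mult tendsto_recentred_coeff tendsto_diag_term
          tendsto_qW tendsto_const tendsto_snd_qs tendsto_divide tendsto_add tendsto_fst_qs) (use x in auto)
  then show ?thesis by blast
qed

lemma tendsto_remainder_sum:
  assumes b: "4 \<le> b" and s0: "2 - real K < Re s0"
  shows "\<exists>L. ((\<lambda>p. \<Sum>n. remainder K (fst p) (qW (fst p) (real n + b)) (snd p)) \<longlongrightarrow> L) (qs_filter s0)"
proof -
  define \<delta> where "\<delta> = (Re s0 + K - 2) / 2"
  have \<delta>: "\<delta> > 0" using s0 by (simp add: \<delta>_def)
  define R where "R = norm (s0 - 1) + 1"
  have "\<forall>n. \<exists>L. ((\<lambda>p. remainder K (fst p) (qW (fst p) (real n + b)) (snd p)) \<longlongrightarrow> L) (qs_filter s0)"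
    using tendsto_remainder b by simp
  then obtain L where L: "\<And>n. ((\<lambda>p. remainder K (fst p) (qW (fst p) (real n + b)) (snd p)) \<longlongrightarrow> L n) (qs_filter s0)"
    by metis
  have "((\<lambda>p. \<Sum>n. remainder K (fst p) (qW (fst p) (real n + b)) (snd p)) \<longlongrightarrow> suminf L) (qs_filter s0)"
  proof (rule tannerys_theorem[THEN conjunct2, THEN conjunct2, OF L])
    show "summable (\<lambda>n. rem_const K R * real (Suc n) powr (- (1 + \<delta>)))"
      by (intro summable_mult summable_majorant \<delta>)
    have "\<forall>\<^sub>F p in qs_filter s0. 3 / 4 \<le> fst p \<and> fst p < 1 \<and> 0 * (- ln (fst p)) < (1::real) \<and>
              snd p \<in> ball s0 1 \<inter> {s. Re s > 2 + \<delta> - K}"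
    proof (rule eventually_qs)
      show "s0 \<in> ball s0 1 \<inter> {s. Re s > 2 + \<delta> - K}" using \<delta> by (simp add: \<delta>_def field_simps)
    qed (auto intro: open_halfspace_Re_gt open_Int)
    then have "\<forall>\<^sub>F p in qs_filter s0. \<forall>n. norm (remainder K (fst p) (qW (fst p) (real n + b)) (snd p))
                  \<le> rem_const K R * real (Suc n) powr (- (1 + \<delta>))"
    proof eventually_elim
      case (elim p)
      show ?case
      proof
        fix n
        show "norm (remainder K (fst p) (qW (fst p) (real n + b)) (snd p)) \<le> rem_const K R * real (Suc n) powr (- (1 + \<delta>))"
        proof (rule norm_remainder_le_majorant[OF _ _ b _ \<delta>])
          show "norm (snd p - 1) \<le> R"
            using norm_triangle_ineq[of "snd p - s0" "s0 - 1"] elim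
            by (simp add: R_def dist_norm norm_minus_commute)
        qed (use elim in auto)
      qed
    qed
    then show "\<forall>\<^sub>F (n, p) in at_top \<times>\<^sub>F qs_filter s0. norm (remainder K (fst p) (qW (fst p) (real n + b)) (snd p))
                  \<le> rem_const K R * real (Suc n) powr (- (1 + \<delta>))"
      unfolding eventually_prod_filter using eventually_True by blast
  qed simp
  then show ?thesis by blast
qed

text \<open>
  The recurrence is solved for its term with \<open>j = 0\<close>, whose coefficient tends to \<open>s\<^sub>0 - 1 \<noteq> 0\<close>.
\<close>

lemma gq_explicit_diag_convergent_step:
  assumes b: "4 \<le> b" and nint: "s0 \<notin> \<int>" and s0: "2 - real K < Re s0"
    and IH: "\<And>j. j \<in> {1..<K} \<Longrightarrow>
      \<exists>L. ((\<lambda>p. gq_explicit (fst p) b (snd p, snd p - 1)) \<longlongrightarrow> L) (qs_filter (s0 + of_nat j))"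
    and K: "K \<ge> 1"
  shows "\<exists>L. ((\<lambda>p. gq_explicit (fst p) b (snd p, snd p - 1)) \<longlongrightarrow> L) (qs_filter s0)"
proof -
  have "\<forall>j\<in>{1..<K}. \<exists>L. ((\<lambda>p. gq_explicit (fst p) b (snd p + of_nat j, snd p + of_nat j - 1)) \<longlongrightarrow> L) (qs_filter s0)"
  proof
    fix j assume "j \<in> {1..<K}"
    then obtain L where "((\<lambda>p. gq_explicit (fst p) b (snd p, snd p - 1)) \<longlongrightarrow> L) (qs_filter (s0 + of_nat j))"
      using IH by blast
    from tendsto_qs_shift[where f = "\<lambda>q s. gq_explicit q b (s, s - 1)", OF this]
    show "\<exists>L. ((\<lambda>p. gq_explicit (fst p) b (snd p + of_nat j, snd p + of_nat j - 1)) \<longlongrightarrow> L) (qs_filter s0)"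
      by blast
  qed
  from bchoice[OF this] obtain G where G: "\<forall>j\<in>{1..<K}.
      ((\<lambda>p. gq_explicit (fst p) b (snd p + of_nat j, snd p + of_nat j - 1)) \<longlongrightarrow> G j) (qs_filter s0)"
    by blast
  obtain L where L: "((\<lambda>p. \<Sum>n. remainder K (fst p) (qW (fst p) (real n + b)) (snd p)) \<longlongrightarrow> L) (qs_filter s0)"
    using tendsto_remainder_sum[OF b s0] by blast
  have ne: "s0 - 1 \<noteq> 0" using nint by auto
  define D where "D = (\<lambda>j. \<Sum>k. telescope_coeff 1 s0 k * of_real (of_nat (k choose j) * 0 ^ (k - j)))"
  have lim: "((\<lambda>p. (qpow (qW (fst p) b) (1 - snd p) -
          (\<Sum>n. remainder K (fst p) (qW (fst p) (real n + b)) (snd p)) -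
          (\<Sum>j=1..<K. recentred_coeff (fst p) (snd p) j * gq_explicit (fst p) b (snd p + of_nat j, snd p + of_nat j - 1))) /
          recentred_coeff (fst p) (snd p) 0) \<longlongrightarrow>
        (qpow b (1 - s0) - L - (\<Sum>j=1..<K. D j * G j)) / (s0 - 1)) (qs_filter s0)"
    unfolding D_def
    by (intro tendsto_divide tendsto_diff tendsto_sum tendsto_mult tendsto_qpow tendsto_qW tendsto_const
          tendsto_snd_qs tendsto_recentred_coeff tendsto_recentred_coeff_0 L G[rule_format] ne) (use b in auto)
  have ev: "\<forall>\<^sub>F p in qs_filter s0. (qpow (qW (fst p) b) (1 - snd p) -
          (\<Sum>n. remainder K (fst p) (qW (fst p) (real n + b)) (snd p)) -
          (\<Sum>j=1..<K. recentred_coeff (fst p) (snd p) j * gq_explicit (fst p) b (snd p + of_nat j, snd p + of_nat j - 1))) /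
          recentred_coeff (fst p) (snd p) 0 = gq_explicit (fst p) b (snd p, snd p - 1)"
  proof -
    have d0: "\<forall>\<^sub>F p in qs_filter s0. recentred_coeff (fst p) (snd p) 0 \<noteq> 0"
      by (rule tendsto_imp_eventually_ne[OF tendsto_recentred_coeff_0 ne])
    have "\<forall>\<^sub>F p in qs_filter s0. 3 / 4 \<le> fst p \<and> fst p < 1 \<and> (\<bar>Im s0\<bar> + 1) * (- ln (fst p)) < 2 * pi \<and>
              snd p \<in> ball s0 1 \<inter> {s. Re s > 2 - real K} \<inter> - \<int>"
      by (rule eventually_qs) (use s0 nint in \<open>auto simp: open_halfspace_Re_gt open_Int open_Compl\<close>)
    then show ?thesis using d0
    proof eventually_elim
      case (elim p)
      have "\<bar>Im (snd p)\<bar> \<le> \<bar>Im s0\<bar> + 1"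
      proof -
        have "norm (snd p - s0) < 1" using elim by (simp add: dist_norm norm_minus_commute)
        then have "\<bar>Im (snd p) - Im s0\<bar> < 1" using abs_Im_le_cmod[of "snd p - s0"] by simp
        then show ?thesis by linarith
      qed
      then have "\<bar>Im (snd p)\<bar> * (- ln (fst p)) \<le> (\<bar>Im s0\<bar> + 1) * (- ln (fst p))"
        using elim by (intro mult_right_mono) auto
      then have im: "\<bar>Im (snd p)\<bar> * (- ln (fst p)) < 2 * pi" using elim by linarith
      have rec: "(\<Sum>n. remainder K (fst p) (qW (fst p) (real n + b)) (snd p)) =
         qpow (qW (fst p) b) (1 - snd p) -
         (\<Sum>j<K. recentred_coeff (fst p) (snd p) j * gq_explicit (fst p) b (snd p + of_nat j, snd p + of_nat j - 1))"
        by (rule diag_recurrence) (use elim b im in auto)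
      have "{..<K} = insert 0 {1..<K}" using K by auto
      then have "(\<Sum>j<K. recentred_coeff (fst p) (snd p) j * gq_explicit (fst p) b (snd p + of_nat j, snd p + of_nat j - 1)) =
         recentred_coeff (fst p) (snd p) 0 * gq_explicit (fst p) b (snd p, snd p - 1) +
         (\<Sum>j=1..<K. recentred_coeff (fst p) (snd p) j * gq_explicit (fst p) b (snd p + of_nat j, snd p + of_nat j - 1))"
        by simp
      then show ?case using rec elim by simp
    qed
  qed
  from Lim_transform_eventually[OF lim ev] show ?thesis by blast
qed

lemma gq_explicit_diag_convergent_ge_4:
  assumes b: "4 \<le> b" and nint: "s0 \<notin> \<int>"
  shows "\<exists>L. ((\<lambda>p. gq_explicit (fst p) b (snd p, snd p - 1)) \<longlongrightarrow> L) (qs_filter s0)"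
proof -
  have "\<exists>L. ((\<lambda>p. gq_explicit (fst p) b (snd p, snd p - 1)) \<longlongrightarrow> L) (qs_filter s0)"
    if "s0 \<notin> \<int>" "2 - real m < Re s0" for m s0
    using that
  proof (induction m arbitrary: s0)
    case 0
    then show ?case using tendsto_gq_explicit_right[of b s0] b by auto
  next
    case (Suc m)
    show ?case
    proof (rule gq_explicit_diag_convergent_step[OF b Suc.prems(1), of "Suc m"])
      fix j assume "j \<in> {1..<Suc m}"
      moreover have "s0 + of_nat j \<notin> \<int>"
        using Suc.prems(1) Ints_diff[of "s0 + of_nat j" "of_nat j"] by auto
      ultimately show "\<exists>L. ((\<lambda>p. gq_explicit (fst p) b (snd p, snd p - 1)) \<longlongrightarrow> L) (qs_filter (s0 + of_nat j))"
        using Suc.prems(2) by (intro Suc.IH) auto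
    qed (use Suc.prems in auto)
  qed
  moreover obtain m :: nat where "2 - Re s0 < m" using reals_Archimedean2 by blast
  then have "2 - real m < Re s0" by linarith
  ultimately show ?thesis using nint by blast
qed

section \<open>Limits of holomorphic functions from limits on a circle\<close>

text \<open>
  Convergence along \<^const>\<open>qs_filter\<close> is uniform near each point, hence uniform on compact sets.
\<close>

lemma uniform_limit_on_sphere:
  fixes h :: "real \<Rightarrow> complex \<Rightarrow> complex"
  assumes lim: "\<And>s. s \<in> sphere z r \<Longrightarrow> ((\<lambda>p. h (fst p) (snd p)) \<longlongrightarrow> Z s) (qs_filter s)"
  shows "uniform_limit (sphere z r) h Z (at_left 1)"
proof (rule uniform_limitI)
  fix e :: real assume e: "e > 0"
  have "\<exists>U. open U \<and> s \<in> U \<and> (\<forall>\<^sub>F q in at_left 1. \<forall>w\<in>U \<inter> sphere z r. dist (h q w) (Z w) < e)"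
    if s: "s \<in> sphere z r" for s
  proof -
    have "\<forall>\<^sub>F p in qs_filter s. dist (h (fst p) (snd p)) (Z s) < e / 2"
      by (rule tendstoD[OF lim[OF s]]) (use e in simp)
    then obtain P Q where P: "eventually P (at_left (1::real))" and Q: "eventually Q (nhds s)"
      and PQ: "\<And>q w. P q \<Longrightarrow> Q w \<Longrightarrow> dist (h q w) (Z s) < e / 2"
      unfolding qs_filter_def eventually_prod_filter by auto
    obtain U where U: "open U" "s \<in> U" "\<And>w. w \<in> U \<Longrightarrow> Q w"
      using Q unfolding eventually_nhds by blast
    have Z: "dist (Z w) (Z s) \<le> e / 2" if w: "w \<in> U \<inter> sphere z r" for w
    proof (rule tendsto_upperbound)
      show "((\<lambda>q. dist (h q w) (Z s)) \<longlongrightarrow> dist (Z w) (Z s)) (at_left 1)"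
        by (intro tendsto_intros tendsto_qs_pointwise lim) (use w in auto)
      show "\<forall>\<^sub>F q in at_left 1. dist (h q w) (Z s) \<le> e / 2"
        using P by eventually_elim (use PQ U(3) w in \<open>auto intro: less_imp_le\<close>)
    qed simp
    have "\<forall>\<^sub>F q in at_left 1. \<forall>w\<in>U \<inter> sphere z r. dist (h q w) (Z w) < e"
      using P
    proof eventually_elim
      case (elim q)
      show ?case
      proof
        fix w assume w: "w \<in> U \<inter> sphere z r"
        have "dist (h q w) (Z w) \<le> dist (h q w) (Z s) + dist (Z w) (Z s)" by (rule dist_triangle2)
        then show "dist (h q w) (Z w) < e" using Z[OF w] PQ[OF elim U(3)[of w]] w by auto
      qed
    qed
    with U show ?thesis by blast
  qed
  then have "\<forall>s\<in>sphere z r. \<exists>U. open U \<and> s \<in> U \<and>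
      (\<forall>\<^sub>F q in at_left 1. \<forall>w\<in>U \<inter> sphere z r. dist (h q w) (Z w) < e)"
    by (rule ballI)
  from bchoice[OF this] obtain U where U: "\<forall>s\<in>sphere z r. open (U s) \<and> s \<in> U s \<and>
      (\<forall>\<^sub>F q in at_left 1. \<forall>w\<in>U s \<inter> sphere z r. dist (h q w) (Z w) < e)" ..
  obtain C where C: "C \<subseteq> sphere z r" "finite C" "sphere z r \<subseteq> (\<Union>s\<in>C. U s)"
  proof (rule compactE_image[of "sphere z r" "sphere z r" U, OF compact_sphere])
    show "open (U s)" if "s \<in> sphere z r" for s using U that by blast
    show "sphere z r \<subseteq> (\<Union>s\<in>sphere z r. U s)" using U by blast
  qed (rule that)
  have "\<forall>\<^sub>F q in at_left 1. \<forall>s\<in>C. \<forall>w\<in>U s \<inter> sphere z r. dist (h q w) (Z w) < e"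
    using U C by (intro eventually_ball_finite) auto
  then show "\<forall>\<^sub>F q in at_left 1. \<forall>w\<in>sphere z r. dist (h q w) (Z w) < e"
    by (rule eventually_mono) (use C(3) in blast)
qed

text \<open>
  By Cauchy's formula the values inside are integrals over the circle, and those converge.  In this
  way limits at integers are obtained from limits at other points.
\<close>

lemma holomorphic_limit_in_disc:
  fixes h :: "real \<Rightarrow> complex \<Rightarrow> complex"
  assumes r: "0 < r" and hol: "\<forall>\<^sub>F q in at_left 1. h q holomorphic_on cball z r"
    and lim: "\<And>s. s \<in> sphere z r \<Longrightarrow> ((\<lambda>p. h (fst p) (snd p)) \<longlongrightarrow> Z s) (qs_filter s)"
  obtains J where "J holomorphic_on ball z r" "\<And>s. s \<in> ball z r \<Longrightarrow> ((\<lambda>q. h q s) \<longlongrightarrow> J s) (at_left 1)"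
proof
  define J where "J = (\<lambda>s. contour_integral (circlepath z r) (\<lambda>w. Z w / (w - s)) / (2 * of_real pi * \<i>))"
  have ul: "uniform_limit (sphere z r) h Z (at_left 1)"
    by (rule uniform_limit_on_sphere[OF lim])
  have contZ: "continuous_on (sphere z r) Z"
  proof (rule uniform_limit_theorem[OF _ ul])
    show "\<forall>\<^sub>F q in at_left 1. continuous_on (sphere z r) (h q)"
      using hol by eventually_elim
        (meson holomorphic_on_imp_continuous_on continuous_on_subset sphere_cball)
  qed simp
  have key: "(\<lambda>w. Z w / (w - s)) contour_integrable_on circlepath z r"
      "((\<lambda>q. 2 * of_real pi * \<i> * h q s) \<longlongrightarrow> contour_integral (circlepath z r) (\<lambda>w. Z w / (w - s))) (at_left 1)"
    if s: "s \<in> ball z r" for s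
  proof -
    have lb: "r - dist z s \<le> norm (w - s)" if "w \<in> sphere z r" for w
      using that dist_triangle[of z w s] by (simp add: dist_norm norm_minus_commute)
    have ul': "uniform_limit (sphere z r) (\<lambda>q w. h q w / (w - s)) (\<lambda>w. Z w / (w - s)) (at_left 1)"
      by (rule uniform_lim_divide[OF ul uniform_limit_const _ lb])
         (use s in \<open>auto intro!: compact_imp_bounded compact_continuous_image contZ\<close>)
    have ci: "\<forall>\<^sub>F q in at_left 1. ((\<lambda>w. h q w / (w - s)) has_contour_integral 2 * of_real pi * \<i> * h q s) (circlepath z r)"
      using hol by eventually_elim
        (rule Cauchy_integral_circlepath_simple, use s in \<open>auto simp: dist_norm norm_minus_commute\<close>)
    have ci': "\<forall>\<^sub>F q in at_left 1. (\<lambda>w. h q w / (w - s)) contour_integrable_on circlepath z r"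
      using ci by eventually_elim (auto simp: contour_integrable_on_def)
    note * = contour_integral_uniform_limit_circlepath[OF ci' ul' _ r]
    show "(\<lambda>w. Z w / (w - s)) contour_integrable_on circlepath z r"
      by (rule *(1)) simp
    have "((\<lambda>q. contour_integral (circlepath z r) (\<lambda>w. h q w / (w - s))) \<longlongrightarrow>
        contour_integral (circlepath z r) (\<lambda>w. Z w / (w - s))) (at_left 1)"
      by (rule *(2)) simp
    moreover have "\<forall>\<^sub>F q in at_left 1. contour_integral (circlepath z r) (\<lambda>w. h q w / (w - s)) = 2 * of_real pi * \<i> * h q s"
      using ci by eventually_elim (rule contour_integral_unique)
    ultimately show "((\<lambda>q. 2 * of_real pi * \<i> * h q s) \<longlongrightarrow> contour_integral (circlepath z r) (\<lambda>w. Z w / (w - s))) (at_left 1)"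
      by (rule Lim_transform_eventually)
  qed
  show "((\<lambda>q. h q s) \<longlongrightarrow> J s) (at_left 1)" if "s \<in> ball z r" for s
  proof -
    have "((\<lambda>q. 2 * of_real pi * \<i> * h q s / (2 * of_real pi * \<i>)) \<longlongrightarrow> J s) (at_left 1)"
      unfolding J_def by (intro tendsto_divide key(2) that tendsto_const) auto
    then show ?thesis by simp
  qed
  show "J holomorphic_on ball z r"
  proof -
    have "(\<lambda>s. contour_integral (circlepath z r) (\<lambda>w. Z w / (w - s))) holomorphic_on ball z r"
      unfolding holomorphic_on_open[OF open_ball]
    proof
      fix w assume w: "w \<in> ball z r"
      have "continuous_on (path_image (circlepath z r)) Z" using contZ r by simp
      from Cauchy_next_derivative_circlepath(2)[OF this _ _ w, of 1
          "\<lambda>s. contour_integral (circlepath z r) (\<lambda>w. Z w / (w - s))"]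
      show "\<exists>f'. ((\<lambda>s. contour_integral (circlepath z r) (\<lambda>w. Z w / (w - s))) has_field_derivative f') (at w)"
        using key(1) has_contour_integral_integral by auto
    qed
    then show ?thesis unfolding J_def by (intro holomorphic_intros) auto
  qed
qed

section \<open>The limit function and the Hurwitz zeta function\<close>

lemma tendsto_gq_summand:
  assumes "x > 0"
  shows "((\<lambda>p. gq_summand (fst p) x (snd p) (snd p - 1)) \<longlongrightarrow> qpow x (- s0)) (qs_filter s0)"
proof (rule Lim_transform_eventually)
  show "((\<lambda>p. diag_term (fst p) (qW (fst p) x) (snd p)) \<longlongrightarrow> qpow x (- s0)) (qs_filter s0)"
    by (intro tendsto_intros tendsto_qW assms)
  have "\<forall>\<^sub>F p in qs_filter s0. 3 / 4 \<le> fst p \<and> fst p < 1 \<and> 0 * (- ln (fst p)) < (1::real) \<and> snd p \<in> UNIV"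
    by (rule eventually_qs) auto
  then show "\<forall>\<^sub>F p in qs_filter s0. diag_term (fst p) (qW (fst p) x) (snd p) = gq_summand (fst p) x (snd p) (snd p - 1)"
    by eventually_elim (use gq_summand_diag assms in auto)
qed

lemma eventually_qs_nonpolar:
  assumes "s0 \<notin> \<int>"
  shows "\<forall>\<^sub>F p in qs_filter s0. 3 / 4 \<le> fst p \<and> fst p < 1 \<and> (\<forall>k::int. \<not> polar (fst p) (snd p + of_int k))"
proof -
  have "\<forall>\<^sub>F p in qs_filter s0. 3 / 4 \<le> fst p \<and> fst p < 1 \<and> (\<bar>Im s0\<bar> + 1) * (- ln (fst p)) < 2 * pi \<and>
              snd p \<in> ball s0 1 \<inter> - \<int>"
    by (rule eventually_qs) (use assms in \<open>auto simp: open_Int open_Compl\<close>)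
  then show ?thesis
  proof eventually_elim
    case (elim p)
    have "norm (snd p - s0) < 1" using elim by (simp add: dist_norm norm_minus_commute)
    then have "\<bar>Im (snd p) - Im s0\<bar> < 1" using abs_Im_le_cmod[of "snd p - s0"] by simp
    then have "\<bar>Im (snd p)\<bar> * (- ln (fst p)) \<le> (\<bar>Im s0\<bar> + 1) * (- ln (fst p))"
      using elim by (intro mult_right_mono) auto
    then have "\<bar>Im (snd p)\<bar> * (- ln (fst p)) < 2 * pi" using elim by linarith
    then show ?case using nonpolar_nonint[of "fst p" "snd p"] elim by auto
  qed
qed

lemma gq_explicit_diag_limit_shift:
  assumes a: "a > 0" and nint: "s0 \<notin> \<int>"
    and lim: "((\<lambda>p. gq_explicit (fst p) (real m + a) (snd p, snd p - 1)) \<longlongrightarrow> L) (qs_filter s0)"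
  shows "((\<lambda>p. gq_explicit (fst p) a (snd p, snd p - 1)) \<longlongrightarrow> (\<Sum>n<m. qpow (real n + a) (- s0)) + L) (qs_filter s0)"
proof (rule Lim_transform_eventually)
  show "((\<lambda>p. (\<Sum>n<m. gq_summand (fst p) (real n + a) (snd p) (snd p - 1)) +
        gq_explicit (fst p) (real m + a) (snd p, snd p - 1)) \<longlongrightarrow> (\<Sum>n<m. qpow (real n + a) (- s0)) + L) (qs_filter s0)"
    by (intro tendsto_add tendsto_sum tendsto_gq_summand lim) (use a in auto)
  show "\<forall>\<^sub>F p in qs_filter s0. (\<Sum>n<m. gq_summand (fst p) (real n + a) (snd p) (snd p - 1)) +
        gq_explicit (fst p) (real m + a) (snd p, snd p - 1) = gq_explicit (fst p) a (snd p, snd p - 1)"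
    using eventually_qs_nonpolar[OF nint]
  proof eventually_elim
    case (elim p)
    then have "\<not> polar (fst p) (snd p + of_int (- 1))" by blast
    then have np: "\<not> polar (fst p) (snd p - 1)" by simp
    have "0 < fst p" "fst p < 1" using conjunct1[OF elim] conjunct1[OF conjunct2[OF elim]] by linarith+
    from gq_explicit_shift_nat[OF this a np] show ?case by (rule sym)
  qed
qed

text \<open>
  The function along \<open>t = s - 1\<close> converges at every \<open>s\<close> that is no integer.  The right values at integers
  are supplied by \<^const>\<open>remove_sings\<close> in the construction of the Hurwitz zeta function.
\<close>

definition zeta_limit :: "real \<Rightarrow> complex \<Rightarrow> complex"
  where "zeta_limit a s = Lim (qs_filter s) (\<lambda>p. gq_explicit (fst p) a (snd p, snd p - 1))"

lemma tendsto_zeta_limit: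
  assumes a: "a > 0" and nint: "s0 \<notin> \<int>"
  shows "((\<lambda>p. gq_explicit (fst p) a (snd p, snd p - 1)) \<longlongrightarrow> zeta_limit a s0) (qs_filter s0)"
proof -
  have "4 \<le> real 4 + a" using a by simp
  then obtain L where "((\<lambda>p. gq_explicit (fst p) (real 4 + a) (snd p, snd p - 1)) \<longlongrightarrow> L) (qs_filter s0)"
    using gq_explicit_diag_convergent_ge_4[OF _ nint] by blast
  note lim = gq_explicit_diag_limit_shift[OF a nint this]
  then show ?thesis
    unfolding zeta_limit_def tendsto_Lim[OF qs_filter_neq_bot lim] .
qed

lemma zeta_limit_eq_series:
  assumes a: "a > 0" and nint: "s \<notin> \<int>" and s: "2 < Re s"
  shows "zeta_limit a s = (\<Sum>n. qpow (real n + a) (- s))"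
proof -
  have r: "summable (\<lambda>n. norm (qpow (real n + (real 1 + a)) (- s)))"
    "((\<lambda>p. gq_explicit (fst p) (real 1 + a) (snd p, snd p - 1)) \<longlongrightarrow> (\<Sum>n. qpow (real n + (real 1 + a)) (- s))) (qs_filter s)"
    using tendsto_gq_explicit_right[of "real 1 + a" s] a s by auto
  have "summable (\<lambda>n. qpow (real (n + 1) + a) (- s))"
    using summable_norm_cancel[OF r(1)] by (simp add: add_ac)
  then have sm: "summable (\<lambda>n. qpow (real n + a) (- s))" by (subst (asm) summable_iff_shift)
  have "zeta_limit a s = (\<Sum>n<1. qpow (real n + a) (- s)) + (\<Sum>n. qpow (real n + (real 1 + a)) (- s))"
    by (rule tendsto_unique[OF qs_filter_neq_bot tendsto_zeta_limit[OF a nint]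
          gq_explicit_diag_limit_shift[OF a nint r(2)]])
  also have "\<dots> = (\<Sum>n. qpow (real n + a) (- s))"
    using suminf_split_initial_segment[OF sm, of 1] by (simp add: add_ac)
  finally show ?thesis .
qed

lemma isolated_from_Ints:
  fixes z :: complex
  obtains r where "r > 0" "\<And>s. s \<in> cball z r \<Longrightarrow> s \<noteq> z \<Longrightarrow> s \<notin> \<int>"
proof -
  have "(\<int> :: complex set) - {z} = of_int ` {k. of_int k \<noteq> z}" by (auto elim: Ints_cases)
  then have "closed ((\<int> :: complex set) - {z})" using closed_of_int_image by metis
  then have "open (- ((\<int> :: complex set) - {z}))" by (rule open_Compl)
  then obtain r where "r > 0" "cball z r \<subseteq> - (\<int> - {z})" using open_contains_cball by blast
  then show ?thesis using that[of r] by blast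
qed

text \<open>
  Multiplied by the denominator of the explicit formula, the functions for \<open>q < 1\<close> are
  holomorphic near any given point, integers included.  So the limit function is locally a
  quotient of holomorphic functions.
\<close>

lemma zeta_limit_local_quotient:
  assumes a: "a > 0"
  obtains r J Q where "r > 0" "J holomorphic_on ball z r" "Q holomorphic_on ball z r"
    "\<And>s. s \<in> ball z r \<Longrightarrow> s \<noteq> z \<Longrightarrow> s \<notin> \<int>"
    "\<And>s. s \<in> ball z r \<Longrightarrow> s \<notin> \<int> \<Longrightarrow> Q s \<noteq> 0 \<and> zeta_limit a s = J s / Q s"
proof -
  obtain r where r: "r > 0" "\<And>s. s \<in> cball z r \<Longrightarrow> s \<noteq> z \<Longrightarrow> s \<notin> \<int>"
    using isolated_from_Ints by blast
  obtain N :: nat where N: "2 + \<bar>Re z\<bar> + r \<le> N" using real_arch_simple by blast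
  have half: "Re (s - 1) > - real N" if "s \<in> cball z r" for s
    using that N abs_Re_le_cmod[of "s - z"] by (simp add: dist_norm norm_minus_commute)
  define Q where "Q = (\<lambda>s::complex. \<Prod>k<N. s + of_int (int k - 1))"
  \<comment> \<open>The \<open>N\<close> factors of the denominator all vanish as \<open>q\<close> tends to \<open>1\<close>, each like \<open>1 - q\<close>.\<close>
  define h where "h = (\<lambda>q s. gq_numer q a N (s, s - 1) / of_real (1 - q) ^ N)"
  define D where "D = (\<lambda>q s. \<Prod>k<N. (1 - qpow q (s + of_int (int k - 1))) / of_real (1 - q))"
  have Qnz: "Q s \<noteq> 0" if "s \<notin> \<int>" for s
  proof
    assume "Q s = 0"
    then obtain k where "s + of_int (int k - 1) = 0" unfolding Q_def by auto
    then have "s = of_int (- (int k - 1))" by (simp only: of_int_minus add_eq_0_iff2)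
    then show False using that by (metis Ints_of_int)
  qed
  have "\<forall>\<^sub>F q in at_left 1. q \<in> {0<..<1::real}" by (rule eventually_at_left_real) simp
  then have hol: "\<forall>\<^sub>F q in at_left 1. h q holomorphic_on cball z r"
  proof eventually_elim
    case (elim q)
    have op: "open {s. Re (s - 1) > - real N}"
      using open_halfspace_Re_gt[of "1 - real N"] by (simp add: algebra_simps)
    have "(\<lambda>s. gq_numer q a N (s, s - 1)) holomorphic_on {s. Re (s - 1) > - real N}"
      by (rule holomorphic2_on_compose_curve[OF holomorphic2_on_gq_numer])
         (use elim a op in \<open>auto intro!: holomorphic_intros\<close>)
    then have "(\<lambda>s. gq_numer q a N (s, s - 1)) holomorphic_on cball z r"
      by (rule holomorphic_on_subset) (use half in auto)
    then show ?case unfolding h_def by (intro holomorphic_intros) (use elim in auto)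
  qed
  have lim: "((\<lambda>p. h (fst p) (snd p)) \<longlongrightarrow> zeta_limit a s * Q s) (qs_filter s)"
    if s: "s \<in> cball z r" "s \<notin> \<int>" for s
  proof (rule Lim_transform_eventually)
    have pos: "\<forall>\<^sub>F p in qs_filter s. 0 < fst p \<and> fst p < 1"
      using eventually_qs_nonpolar[OF s(2)] by (rule eventually_mono) (auto intro: less_le_trans[of 0 "3/4"])
    show "((\<lambda>p. gq_explicit (fst p) a (snd p, snd p - 1) * D (fst p) (snd p)) \<longlongrightarrow> zeta_limit a s * Q s) (qs_filter s)"
      unfolding D_def Q_def
      by (intro tendsto_mult tendsto_prod tendsto_zeta_limit[OF a s(2)] tendsto_qpow_quotient
            tendsto_fst_qs pos tendsto_add tendsto_snd_qs tendsto_const)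
    have "open {s. Re (s - 1) > - real N}"
      using open_halfspace_Re_gt[of "1 - real N"] by (simp add: algebra_simps)
    then have "\<forall>\<^sub>F p in qs_filter s. 3 / 4 \<le> fst p \<and> fst p < 1 \<and> 0 * (- ln (fst p)) < (1::real) \<and>
                 snd p \<in> {s. Re (s - 1) > - real N}"
      by (rule eventually_qs) (use half[OF s(1)] in auto)
    then show "\<forall>\<^sub>F p in qs_filter s. gq_explicit (fst p) a (snd p, snd p - 1) * D (fst p) (snd p) = h (fst p) (snd p)"
      using eventually_qs_nonpolar[OF s(2)]
    proof eventually_elim
      case (elim p)
      have q: "0 < fst p" "fst p < 1" using elim(1) by auto
      have "\<not> polar (fst p) (snd p + of_int (- 1))" using elim(2) by blast
      then have np: "\<not> polar (fst p) (snd p - 1)" by simp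
      have re: "Re (snd p - 1) > - real N" using elim(1) by simp
      have den: "gq_denom (fst p) N (snd p - 1) \<noteq> 0" using gq_denom_eq_0_iff[OF q re] np by simp
      have "D (fst p) (snd p) = gq_denom (fst p) N (snd p - 1) / of_real (1 - fst p) ^ N"
        by (simp add: D_def gq_denom_def prod_dividef algebra_simps)
      then show ?case
        using gq_explicit_eq_quotient[OF q a np re, of "snd p"] den by (simp add: h_def)
    qed
  qed
  obtain J where J: "J holomorphic_on ball z r" "\<And>s. s \<in> ball z r \<Longrightarrow> ((\<lambda>q. h q s) \<longlongrightarrow> J s) (at_left 1)"
  proof (rule holomorphic_limit_in_disc[OF r(1) hol])
    show "((\<lambda>p. h (fst p) (snd p)) \<longlongrightarrow> zeta_limit a s * Q s) (qs_filter s)" if "s \<in> sphere z r" for s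
      by (rule lim) (use that r in auto)
  qed (rule that)
  have "zeta_limit a s = J s / Q s" if "s \<in> ball z r" "s \<notin> \<int>" for s
  proof -
    have "((\<lambda>q. h q s) \<longlongrightarrow> zeta_limit a s * Q s) (at_left 1)"
      by (rule tendsto_qs_pointwise[OF lim]) (use that in auto)
    then have "zeta_limit a s * Q s = J s"
      using J(2)[OF that(1)] tendsto_unique by (metis trivial_limit_at_left_real)
    then show ?thesis using Qnz[OF that(2)] by (simp add: field_simps)
  qed
  moreover have "Q holomorphic_on ball z r" unfolding Q_def by (intro holomorphic_intros)
  ultimately show ?thesis using that[of r J Q] r J(1) Qnz by auto
qed

lemma zeta_limit_meromorphic:
  assumes a: "a > 0"
  shows "zeta_limit a meromorphic_on UNIV" "s \<notin> \<int> \<Longrightarrow> zeta_limit a analytic_on {s}"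
proof -
  show "zeta_limit a meromorphic_on UNIV"
    unfolding meromorphic_on_meromorphic_at[of _ UNIV]
  proof
    fix z
    obtain r J Q where r: "r > 0" "J holomorphic_on ball z r" "Q holomorphic_on ball z r"
      "\<And>s. s \<in> ball z r \<Longrightarrow> s \<noteq> z \<Longrightarrow> s \<notin> \<int>"
      "\<And>s. s \<in> ball z r \<Longrightarrow> s \<notin> \<int> \<Longrightarrow> Q s \<noteq> 0 \<and> zeta_limit a s = J s / Q s"
      using zeta_limit_local_quotient[OF a] by metis
    have "(\<lambda>s. J s / Q s) meromorphic_on {z}"
      using r(1,2,3) analytic_at
      by (intro meromorphic_on_divide analytic_on_imp_meromorphic_on) (auto simp: analytic_at intro!: exI[of _ "ball z r"])
    moreover have "\<forall>\<^sub>F s in at z. zeta_limit a s = J s / Q s"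
      unfolding eventually_at using r by (intro exI[of _ r]) (auto simp: dist_commute)
    ultimately show "zeta_limit a meromorphic_on {z}"
      using meromorphic_on_cong[of "{z}" "zeta_limit a" "\<lambda>s. J s / Q s"] by auto
  qed
  assume nint: "s \<notin> \<int>"
  obtain r J Q where r: "r > 0" "J holomorphic_on ball s r" "Q holomorphic_on ball s r"
      "\<And>w. w \<in> ball s r \<Longrightarrow> w \<noteq> s \<Longrightarrow> w \<notin> \<int>"
      "\<And>w. w \<in> ball s r \<Longrightarrow> w \<notin> \<int> \<Longrightarrow> Q w \<noteq> 0 \<and> zeta_limit a w = J w / Q w"
    using zeta_limit_local_quotient[OF a] by metis
  have "(\<lambda>w. J w / Q w) holomorphic_on ball s r"
    by (intro holomorphic_intros r) (metis r(4,5) nint)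
  then have "zeta_limit a holomorphic_on ball s r"
    by (rule holomorphic_transform) (metis r(4,5) nint)
  then show "zeta_limit a analytic_on {s}" using r(1) by (auto simp: analytic_at intro!: exI[of _ "ball s r"])
qed

lemma holomorphic_hurwitz_series:
  assumes a: "a > 0"
  shows "(\<lambda>s. \<Sum>n. qpow (real n + a) (- s)) holomorphic_on {s. Re s > 1}"
proof -
  have bound: "norm (qpow (real n + (1 + a)) (- s)) \<le> real (Suc n) powr (- (1 + \<delta>))"
    if "\<delta> > 0" "Re s \<ge> 1 + \<delta>" for n s \<delta>
    using powr_le_majorant[of n "1 + a" "real n + (1 + a)" \<delta> "- Re s"] that a by (simp add: norm_qpow)
  have sm: "summable (\<lambda>n. qpow (real n + a) (- s))" if "Re s > 1" for s
  proof -
    have "summable (\<lambda>n. qpow (real n + (1 + a)) (- s))"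
      by (rule summable_comparison_test'[OF summable_majorant[of "Re s - 1"], of 0])
         (use bound[of "Re s - 1" s] that in auto)
    then have "summable (\<lambda>n. qpow (real (Suc n) + a) (- s))" by (simp add: add_ac)
    then show ?thesis by (subst (asm) summable_Suc_iff[of "\<lambda>n. qpow (real n + a) (- s)"])
  qed
  have "(\<lambda>s. qpow a (- s) + (\<Sum>n. qpow (real n + (1 + a)) (- s))) holomorphic_on {s. Re s > 1}"
  proof (intro holomorphic_intros holomorphic_on_suminf_locally_dominated)
    show "open {s. Re s > 1}" by (rule open_halfspace_Re_gt)
    fix z assume z: "z \<in> {s. Re s > 1}"
    define \<delta> where "\<delta> = (Re z - 1) / 2"
    have \<delta>: "\<delta> > 0" using z by (simp add: \<delta>_def)
    have "z \<in> {s. Re s > 1 + \<delta>}" using z by (simp add: \<delta>_def field_simps)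
    then show "\<exists>V M. open V \<and> z \<in> V \<and> summable M \<and>
        (\<forall>n. \<forall>w\<in>V \<inter> {s. Re s > 1}. norm (qpow (real n + (1 + a)) (- w)) \<le> M n)"
      using summable_majorant[OF \<delta>] bound[OF \<delta>]
      by (intro exI[of _ "{s. Re s > 1 + \<delta>}"] exI[of _ "\<lambda>n. real (Suc n) powr (- (1 + \<delta>))"])
         (auto intro: open_halfspace_Re_gt)
  qed
  moreover have "(\<Sum>n. qpow (real n + a) (- s)) = qpow a (- s) + (\<Sum>n. qpow (real n + (1 + a)) (- s))"
    if "Re s > 1" for s
    using suminf_split_head[OF sm[OF that]] by (simp add: add_ac)
  ultimately show ?thesis by (subst holomorphic_cong[OF refl]) auto
qed

text \<open>
  The limit function is meromorphic and equals the Dirichlet series for \<open>Re s > 2\<close>, hence for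
  \<open>Re s > 1\<close>.  This proves at once that the continuation exists and that it is the limit.
\<close>

theorem hurwitz_zeta_properties:
  assumes a: "a > 0"
  shows "hurwitz_zeta a nicely_meromorphic_on UNIV"
    and "s \<notin> \<int> \<Longrightarrow> hurwitz_zeta a s = zeta_limit a s"
proof -
  define H where "H = remove_sings (zeta_limit a)"
  have H: "H nicely_meromorphic_on UNIV"
    unfolding H_def by (rule remove_sings_nicely_meromorphic[OF zeta_limit_meromorphic(1)[OF a]])
  have Hz: "H s = zeta_limit a s" if "s \<notin> \<int>" for s
    unfolding H_def by (rule remove_sings_at_analytic[OF zeta_limit_meromorphic(2)[OF a that]])
  define S where "S = (\<lambda>s. \<Sum>n. qpow (real n + a) (- s))"
  have S: "S holomorphic_on {s. Re s > 1}" unfolding S_def by (rule holomorphic_hurwitz_series[OF a])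
  define \<Omega> where "\<Omega> = {s. Re s > 1} - \<int>"
  have \<Omega>: "open \<Omega>" unfolding \<Omega>_def by (intro open_Diff open_halfspace_Re_gt closed_Ints)
  have "countable (\<int> :: complex set)" unfolding Ints_def by simp
  then have con: "connected \<Omega>" unfolding \<Omega>_def
    by (intro connected_open_diff_countable open_halfspace_Re_gt convex_connected convex_halfspace_Re_gt) simp_all
  have HS: "H s = S s" if s: "s \<in> \<Omega>" for s
  proof (rule analytic_continuation_open[of "\<Omega> \<inter> {s. Re s > 2}" \<Omega> H S s])
    show "open (\<Omega> \<inter> {s. Re s > 2})" by (intro open_Int \<Omega> open_halfspace_Re_gt)
    have "Complex 3 (1 / 2) \<notin> \<int>" by (auto simp: complex_eq_iff elim!: Ints_cases)
    then have "Complex 3 (1 / 2) \<in> \<Omega> \<inter> {s. Re s > 2}" by (simp add: \<Omega>_def)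
    then show "\<Omega> \<inter> {s. Re s > 2} \<noteq> {}" by blast
    have "zeta_limit a holomorphic_on \<Omega>"
      using zeta_limit_meromorphic(2)[OF a] analytic_imp_holomorphic analytic_on_analytic_at[of "zeta_limit a" \<Omega>]
      by (auto simp: \<Omega>_def)
    then show "H holomorphic_on \<Omega>" by (rule holomorphic_transform) (auto simp: Hz \<Omega>_def)
    show "S holomorphic_on \<Omega>" by (rule holomorphic_on_subset[OF S]) (auto simp: \<Omega>_def)
    show "H z = S z" if "z \<in> \<Omega> \<inter> {s. Re s > 2}" for z
      using that zeta_limit_eq_series[OF a] Hz by (auto simp: \<Omega>_def S_def)
  qed (use \<Omega> con s in auto)
  have HS': "H s = S s" if s: "Re s > 1" for s
  proof (rule nicely_meromorphic_on_tendsto_imp_eq[OF H])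
    have "isCont S s"
      using holomorphic_on_imp_continuous_on[OF S] s open_halfspace_Re_gt[of 1]
      by (simp add: continuous_on_eq_continuous_at)
    then have "S \<midarrow>s\<rightarrow> S s" by (simp add: isCont_def)
    moreover have "\<forall>\<^sub>F w in at s. S w = H w"
    proof -
      obtain r where r: "r > 0" "\<And>w. w \<in> cball s r \<Longrightarrow> w \<noteq> s \<Longrightarrow> w \<notin> \<int>"
        using isolated_from_Ints by blast
      have "\<forall>\<^sub>F w in at s. w \<in> {w. Re w > 1}"
        using s by (intro eventually_at_in_open' open_halfspace_Re_gt) auto
      moreover have "\<forall>\<^sub>F w in at s. w \<notin> \<int>"
        unfolding eventually_at using r by (intro exI[of _ r]) (auto simp: dist_commute)
      ultimately show ?thesis by eventually_elim (use HS in \<open>auto simp: \<Omega>_def\<close>)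
    qed
    ultimately show "H \<midarrow>s\<rightarrow> S s" by (rule Lim_transform_eventually)
  qed
  have series: "S s = (\<Sum>n. (of_nat n + of_real a) powr (- s))" for s
  proof -
    have "qpow (real n + a) (- s) = (of_nat n + of_real a) powr (- s)" for n
      using powr_eq_qpow[of "real n + a" "- s"] a by simp
    then show ?thesis by (simp add: S_def)
  qed
  have "hurwitz_zeta a = H"
    unfolding hurwitz_zeta_def
  proof (rule the_equality)
    show "H nicely_meromorphic_on UNIV \<and> (\<forall>s. Re s > 1 \<longrightarrow> H s = (\<Sum>n. (of_nat n + of_real a) powr (- s)))"
      using H HS' series by simp
    fix f assume f: "f nicely_meromorphic_on UNIV \<and> (\<forall>s. Re s > 1 \<longrightarrow> f s = (\<Sum>n. (of_nat n + of_real a) powr (- s)))"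
    show "f = H"
    proof (rule nicely_meromorphic_on_unique)
      show "open {s. Re s > 1}" by (rule open_halfspace_Re_gt)
      show "{s. Re s > 1} \<noteq> {}" by (auto intro!: exI[of _ 2])
      show "f w = H w" if "w \<in> {s. Re s > 1}" for w using that f HS' series by simp
    qed (use f H in auto)
  qed
  then show "hurwitz_zeta a nicely_meromorphic_on UNIV"
    and "s \<notin> \<int> \<Longrightarrow> hurwitz_zeta a s = zeta_limit a s"
    using H Hz by auto
qed

section \<open>Sufficiency\<close>

text \<open>
  On the level of the series this says \<open>q\<^sup>x = 1 - (1 - q) [x]\<^sub>q\<close>; for the explicit function it is Pascal's
  rule for the binomial coefficients.
\<close>

lemma gq_explicit_step:
  assumes q: "0 < q" "q < 1" and a: "a > 0" and np: "\<not> polar q t"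
  shows "gq_explicit q a (s, t) = gq_explicit q a (s, t + 1) + of_real (1 - q) * gq_explicit q a (s - 1, t)"
proof -
  have np1: "\<not> polar q (t + 1)"
  proof
    assume "polar q (t + 1)"
    then obtain r where "qpow q (t + 1 + of_nat r) = 1" by (auto simp: polar_def)
    then have "qpow q (t + of_nat (Suc r)) = 1" by (simp add: add_ac)
    then show False using np polar_def by blast
  qed
  define E where "E = (\<lambda>r. geom_factor q a (t + of_nat r))"
  have E1: "geom_factor q a (t + 1 + of_nat r) = E (Suc r)" for r by (simp add: E_def add_ac)
  have S: "(\<lambda>r. neg_binom s r * E r) sums (\<Sum>r. neg_binom s r * E r)" for s
    unfolding E_def by (intro summable_sums summable_norm_cancel[OF summable_gq_explicit] q a)
  have S1: "(\<lambda>r. neg_binom s r * E (Suc r)) sums (\<Sum>r. neg_binom s r * E (Suc r))"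
    unfolding E1[symmetric] by (intro summable_sums summable_norm_cancel[OF summable_gq_explicit] q a)
  have "(\<lambda>r. neg_binom (s - 1) (Suc r) * E (Suc r)) sums ((\<Sum>r. neg_binom (s - 1) r * E r) - E 0)"
    using S[of "s - 1"] by (subst sums_Suc_iff) simp
  moreover have "(\<lambda>r. neg_binom s (Suc r) * E (Suc r)) sums ((\<Sum>r. neg_binom s r * E r) - E 0)"
    using S[of s] by (subst sums_Suc_iff) simp
  then have "(\<lambda>r. neg_binom s (Suc r) * E (Suc r) - neg_binom s r * E (Suc r)) sums
     ((\<Sum>r. neg_binom s r * E r) - E 0 - (\<Sum>r. neg_binom s r * E (Suc r)))"
    by (rule sums_diff[OF _ S1])
  then have "(\<lambda>r. neg_binom (s - 1) (Suc r) * E (Suc r)) sums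
     ((\<Sum>r. neg_binom s r * E r) - E 0 - (\<Sum>r. neg_binom s r * E (Suc r)))"
    by (simp add: neg_binom_shift left_diff_distrib)
  ultimately have "(\<Sum>r. neg_binom (s - 1) r * E r) - E 0 = (\<Sum>r. neg_binom s r * E r) - E 0 - (\<Sum>r. neg_binom s r * E (Suc r))"
    by (rule sums_unique2)
  then have main: "(\<Sum>r. neg_binom s r * E r) = (\<Sum>r. neg_binom s r * E (Suc r)) + (\<Sum>r. neg_binom (s - 1) r * E r)"
    by simp
  have "of_real (1 - q) * qpow (1 - q) (s - 1) = qpow (1 - q) s"
    using q qpow_add[of "1 - q" 1 "s - 1"] qpow_of_real[of "1 - q" 1] by simp
  then have "of_real (1 - q) * gq_explicit q a (s - 1, t) = qpow (1 - q) s * (\<Sum>r. neg_binom (s - 1) r * E r)"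
    using np by (simp add: gq_explicit_def E_def flip: mult.assoc)
  moreover have "gq_explicit q a (s, t) = qpow (1 - q) s * (\<Sum>r. neg_binom s r * E r)"
    using np by (simp add: gq_explicit_def E_def)
  moreover have "gq_explicit q a (s, t + 1) = qpow (1 - q) s * (\<Sum>r. neg_binom s r * E (Suc r))"
    using np1 by (simp add: gq_explicit_def E1)
  ultimately show ?thesis by (simp add: main distrib_left)
qed

lemma tendsto_gq_explicit_shifted:
  assumes a: "a > 0" and \<nu>: "\<nu> \<ge> 1" and nint: "s0 \<notin> \<int>"
  shows "((\<lambda>p. gq_explicit (fst p) a (snd p, snd p - of_nat \<nu>)) \<longlongrightarrow> zeta_limit a s0) (qs_filter s0)"
  using \<nu> nint
proof (induction \<nu> arbitrary: s0 rule: dec_induct)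
  case base
  then show ?case using tendsto_zeta_limit[OF a] by simp
next
  case (step \<nu>)
  have nint1: "s0 + (- 1) \<notin> \<int>"
  proof
    assume "s0 + (- 1) \<in> \<int>"
    then have "s0 + (- 1) + 1 \<in> \<int>" by (rule Ints_add) simp
    then show False using step.prems by simp
  qed
  have 1: "((\<lambda>p. gq_explicit (fst p) a (snd p + (- 1), snd p + (- 1) - of_nat \<nu>)) \<longlongrightarrow> zeta_limit a (s0 + (- 1))) (qs_filter s0)"
    using tendsto_qs_shift[where f = "\<lambda>q s. gq_explicit q a (s, s - of_nat \<nu>)"] step.IH[OF nint1] by blast
  have "((\<lambda>p. gq_explicit (fst p) a (snd p, snd p - of_nat \<nu>) + of_real (1 - fst p) *
        gq_explicit (fst p) a (snd p + (- 1), snd p + (- 1) - of_nat \<nu>)) \<longlongrightarrow>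
       zeta_limit a s0 + of_real (1 - 1) * zeta_limit a (s0 + (- 1))) (qs_filter s0)"
    by (intro tendsto_add tendsto_mult tendsto_of_real tendsto_diff tendsto_const tendsto_fst_qs 1 step.IH step.prems)
  then have "((\<lambda>p. gq_explicit (fst p) a (snd p, snd p - of_nat \<nu>) + of_real (1 - fst p) *
        gq_explicit (fst p) a (snd p + (- 1), snd p + (- 1) - of_nat \<nu>)) \<longlongrightarrow> zeta_limit a s0) (qs_filter s0)"
    by simp
  then show ?case
  proof (rule Lim_transform_eventually)
    show "\<forall>\<^sub>F p in qs_filter s0. gq_explicit (fst p) a (snd p, snd p - of_nat \<nu>) + of_real (1 - fst p) *
        gq_explicit (fst p) a (snd p + (- 1), snd p + (- 1) - of_nat \<nu>) =
        gq_explicit (fst p) a (snd p, snd p - of_nat (Suc \<nu>))"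
      using eventually_qs_nonpolar[OF step.prems]
    proof eventually_elim
      case (elim p)
      have "\<not> polar (fst p) (snd p + of_int (- int (Suc \<nu>)))" using elim by blast
      moreover have "snd p + of_int (- int (Suc \<nu>)) = snd p - of_nat (Suc \<nu>)" by simp
      ultimately have np: "\<not> polar (fst p) (snd p - of_nat (Suc \<nu>))" by metis
      have eqs: "snd p - of_nat (Suc \<nu>) + 1 = snd p - of_nat \<nu>"
        "snd p - 1 - of_nat \<nu> = snd p - of_nat (Suc \<nu>)" "snd p + (- 1) = snd p - 1" by simp_all
      have "0 < fst p" "fst p < 1" using conjunct1[OF elim] conjunct1[OF conjunct2[OF elim]] by linarith+
      from gq_explicit_step[OF this a np, of "snd p"] show ?case
        unfolding eqs by (rule sym)
    qed
  qed
qed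

lemma eventually_nonpolar_shift:
  assumes q: "0 < q" "q < 1"
  shows "\<forall>\<^sub>F s in at z. \<not> polar q (s - c)"
proof -
  obtain d where "d > 0" "\<And>t. t \<noteq> z - c \<Longrightarrow> dist t (z - c) < d \<Longrightarrow> \<not> polar q t"
    using eventually_nonpolar_at[OF q, of "z - c"] unfolding eventually_at by auto
  then show ?thesis
    unfolding eventually_at by (intro exI[of _ d]) (auto simp: dist_norm)
qed

lemma gq_curve_meromorphic:
  assumes q: "0 < q" "q < 1" and a: "a > 0"
  shows "(\<lambda>s. gq q a (s, s - c)) meromorphic_on UNIV"
  unfolding meromorphic_on_meromorphic_at[of _ UNIV]
proof
  fix z
  obtain N :: nat where N: "1 - Re (z - c) \<le> N" using real_arch_simple by blast
  define V where "V = {s. Re s > Re c - real N}"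
  have V: "open V" "z \<in> V" using N by (auto simp: V_def open_halfspace_Re_gt)
  have "(\<lambda>s. gq_numer q a N (s, s - c)) holomorphic_on V"
    by (rule holomorphic2_on_compose_curve[OF holomorphic2_on_gq_numer])
       (use q a V in \<open>auto simp: V_def intro!: holomorphic_intros\<close>)
  moreover have "(\<lambda>s. gq_denom q N (s - c)) holomorphic_on V"
    unfolding gq_denom_def by (intro holomorphic_intros)
  ultimately have "(\<lambda>s. gq_numer q a N (s, s - c) / gq_denom q N (s - c)) meromorphic_on {z}"
    using V by (intro meromorphic_on_divide analytic_on_imp_meromorphic_on) (auto simp: analytic_at)
  moreover have "\<forall>\<^sub>F s in at z. gq q a (s, s - c) = gq_numer q a N (s, s - c) / gq_denom q N (s - c)"
  proof -
    have "\<forall>\<^sub>F s in at z. s \<in> V" using V by (intro eventually_at_in_open') auto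
    then show ?thesis using eventually_nonpolar_shift[OF q, of c z]
      by eventually_elim
         (use gq_explicit_eq_quotient[OF q a] gq_eq_gq_explicit[OF q a] in \<open>auto simp: V_def\<close>)
  qed
  ultimately show "(\<lambda>s. gq q a (s, s - c)) meromorphic_on {z}"
    using meromorphic_on_cong[of "{z}" "\<lambda>s. gq q a (s, s - c)"
        "\<lambda>s. gq_numer q a N (s, s - c) / gq_denom q N (s - c)" "{z}"] by auto
qed

lemma gq_along_shift_well_defined:
  assumes q: "0 < q" "q < 1" and a: "a > 0"
  shows "gq_along_well_defined q a (\<lambda>s. s - c)"
proof -
  have "\<not> is_pole (\<lambda>s. s - c) s" for s
    by (intro analytic_at_imp_no_pole analytic_intros)
  then show ?thesis
    unfolding gq_along_well_defined_def gq_along_def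
    using eventually_nonpolar_shift[OF q] gq_curve_meromorphic[OF q a]
    by (auto simp: gq_eq_gq_explicit[OF q a] regular2_at_gq_explicit_iff[OF q a]
          sparse_in_eventually_iff intro: remove_sings_meromorphic)
qed

text \<open>
  The limit is taken on a circle around \<open>s\<close> that meets no integer and is carried to the centre by
  Cauchy's formula.  The hypothesis on poles makes the functions holomorphic at the centre.
\<close>

lemma gq_along_shift_tendsto:
  assumes a: "a > 0" and \<nu>: "\<nu> \<ge> 1"
    and nopole: "\<forall>\<^sub>F q in at_left 1. \<not> is_pole (gq_along q a (\<lambda>s. s - of_nat \<nu>)) s"
  shows "((\<lambda>q. gq_along q a (\<lambda>s. s - of_nat \<nu>) s) \<longlongrightarrow> hurwitz_zeta a s) (at_left 1)"
proof -
  define g where "g = (\<lambda>q. gq_along q a (\<lambda>s. s - of_nat \<nu>))"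
  have off: "g q w = gq_explicit q a (w, w - of_nat \<nu>)" "g q analytic_on {w}"
    if "0 < q" "q < 1" "\<not> polar q (w - of_nat \<nu>)" for q w
    unfolding g_def
  proof -
    have "(\<lambda>s. s - of_nat \<nu>) analytic_on {w}" by (intro analytic_intros)
    from gq_along_eq_gq_explicit[OF that(1,2) a this that(3)]
    show "gq_along q a (\<lambda>s. s - of_nat \<nu>) w = gq_explicit q a (w, w - of_nat \<nu>)"
      "gq_along q a (\<lambda>s. s - of_nat \<nu>) analytic_on {w}" by simp_all
  qed
  have lim: "((\<lambda>p. g (fst p) (snd p)) \<longlongrightarrow> zeta_limit a w) (qs_filter w)" if w: "w \<notin> \<int>" for w
  proof (rule Lim_transform_eventually[OF tendsto_gq_explicit_shifted[OF a \<nu> w]])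
    show "\<forall>\<^sub>F p in qs_filter w. gq_explicit (fst p) a (snd p, snd p - of_nat \<nu>) = g (fst p) (snd p)"
      using eventually_qs_nonpolar[OF w]
    proof eventually_elim
      case (elim p)
      have "\<not> polar (fst p) (snd p + of_int (- int \<nu>))" using elim by blast
      then show ?case using off(1)[of "fst p" "snd p"] conjunct1[OF elim] conjunct1[OF conjunct2[OF elim]] by simp
    qed
  qed
  obtain r where r: "r > 0" "\<And>w. w \<in> cball s r \<Longrightarrow> w \<noteq> s \<Longrightarrow> w \<notin> \<int>"
    using isolated_from_Ints by blast
  have "\<forall>\<^sub>F q in at_left 1. q \<in> {0<..<1} \<and> (\<bar>Im s\<bar> + r) * (- ln q) < 2 * pi"
    by (rule eventually_small_log) simp
  then have hol: "\<forall>\<^sub>F q in at_left 1. g q holomorphic_on cball s r"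
    using nopole
  proof eventually_elim
    case (elim q)
    have "g q analytic_on {w}" if w: "w \<in> cball s r" for w
    proof (cases "w = s")
      case True
      have "g q nicely_meromorphic_on UNIV"
        unfolding g_def gq_along_def
        by (intro remove_sings_nicely_meromorphic gq_curve_meromorphic) (use elim a in auto)
      then show ?thesis
        using elim True by (intro nicely_meromorphic_on_imp_analytic_at) (auto simp: g_def)
    next
      case False
      have "\<bar>Im w - Im s\<bar> \<le> r"
        using w abs_Im_le_cmod[of "w - s"] by (simp add: dist_norm norm_minus_commute)
      then have "\<bar>Im w\<bar> * (- ln q) \<le> (\<bar>Im s\<bar> + r) * (- ln q)"
        using elim by (intro mult_right_mono) auto
      then have "\<bar>Im w\<bar> * (- ln q) < 2 * pi" using elim by linarith
      then have "\<not> polar q (w + of_int (- int \<nu>))"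
        using elim r(2)[OF w False] by (intro nonpolar_nonint) auto
      then show ?thesis using off(2)[of q w] elim by simp
    qed
    then show ?case using analytic_imp_holomorphic analytic_on_analytic_at by blast
  qed
  obtain J where J: "J holomorphic_on ball s r" "\<And>w. w \<in> ball s r \<Longrightarrow> ((\<lambda>q. g q w) \<longlongrightarrow> J w) (at_left 1)"
  proof (rule holomorphic_limit_in_disc[OF r(1) hol])
    show "((\<lambda>p. g (fst p) (snd p)) \<longlongrightarrow> zeta_limit a w) (qs_filter w)" if "w \<in> sphere s r" for w
      by (rule lim) (use that r in auto)
  qed (rule that)
  have eq: "J w = hurwitz_zeta a w" if "w \<in> ball s r" "w \<noteq> s" for w
  proof -
    have w: "w \<notin> \<int>" using r(2)[of w] that by auto
    have "J w = zeta_limit a w"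
      by (rule tendsto_unique[OF _ J(2)[OF that(1)] tendsto_qs_pointwise[OF lim[OF w]]]) simp
    then show ?thesis using hurwitz_zeta_properties(2)[OF a w] by simp
  qed
  have "isCont J s"
    using holomorphic_on_imp_continuous_on[OF J(1)] r(1) by (simp add: continuous_on_eq_continuous_at)
  then have "J \<midarrow>s\<rightarrow> J s" by (simp add: isCont_def)
  moreover have "\<forall>\<^sub>F w in at s. J w = hurwitz_zeta a w"
    unfolding eventually_at using eq r(1) by (intro exI[of _ r]) (auto simp: dist_commute)
  ultimately have "hurwitz_zeta a \<midarrow>s\<rightarrow> J s" by (rule Lim_transform_eventually)
  then have "hurwitz_zeta a s = J s"
    by (rule nicely_meromorphic_on_tendsto_imp_eq[OF hurwitz_zeta_properties(1)[OF a]])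
  then show ?thesis using J(2)[of s] r(1) by (simp add: g_def)
qed

theorem theorem2p1:
  fixes a :: real and \<phi> :: "complex \<Rightarrow> complex"
  assumes "0 < a" and "a \<le> 1"
    and "\<phi> nicely_meromorphic_on UNIV"
  shows "q_limit_formula a \<phi> \<longleftrightarrow> (\<exists>\<nu>::nat. \<nu> > 0 \<and> (\<forall>s. \<phi> s = s - of_nat \<nu>))"
proof
  assume "q_limit_formula a \<phi>"
  then show "\<exists>\<nu>::nat. \<nu> > 0 \<and> (\<forall>s. \<phi> s = s - of_nat \<nu>)"
    by (rule q_limit_formula_imp_shift[OF assms(1,3)])
next
  assume "\<exists>\<nu>::nat. \<nu> > 0 \<and> (\<forall>s. \<phi> s = s - of_nat \<nu>)"
  then obtain \<nu> :: nat where \<nu>: "\<nu> \<ge> 1" "\<phi> = (\<lambda>s. s - of_nat \<nu>)" by (auto simp: fun_eq_iff)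
  have "\<forall>\<^sub>F q in at_left 1. q \<in> {0<..<1::real}" by (rule eventually_at_left_real) simp
  then have "\<forall>\<^sub>F q in at_left 1. gq_along_well_defined q a \<phi>"
    by eventually_elim (use gq_along_shift_well_defined assms(1) \<nu>(2) in auto)
  then show "q_limit_formula a \<phi>"
    unfolding q_limit_formula_def \<nu>(2) using gq_along_shift_tendsto[OF assms(1) \<nu>(1)] by blast
qed

end
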